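(* For $\gamma>0$ let $u_\gamma$ be the unique minimizer of $\mathcal F_\gamma$. Then, as $\gamma\downarrow0$, the whole family $u_\gamma$ converges in $L^1(\Omega)$ to the unique minimizer of $\mathcal F_0$. The same holds for asymptotic minimizers, i.e. for families $(u_\gamma)_{\gamma>0}\subset L^1(\Omega)$ satisfying $\mathcal F_\gamma(u_\gamma)\le\inf\mathcal F_\gamma+o(1)$ as $\gamma\downarrow0$.
   Context: $\Omega\subset\mathbb R^N$ is a bounded Lipschitz domain, $f\in L^2(\Omega)$, $\alpha>0$ is fixed, and $\kappa\in L^\infty(\Omega)$ is fixed with $0<\kappa_-\le\kappa(x)\le\kappa_+<\infty$ for a.e. $x\in\Omega$. With $\log^+r:=\max\{0,\log r\}$ for $r>0$ and $\log^+0:=0$, define for $\gamma>0$ $$\varphi_\gamma(x,t):=\alpha t\Bigl(1+\gamma\log^+\frac{t}{\kappa(x)}\Bigr),\qquad t\ge0,$$ $X_\gamma:=\{u\in L^2(\Omega)\cap W^{1,1}(\Omega):\int_\Omega\varphi_\gamma(x,|\nabla u|)\,dx<\infty\}$, and $$\mathcal F_\gamma(u):=\begin{cases}\frac12\|u-f\|_{L^2(\Omega)}^2+\int_\Omega\varphi_\gamma(x,|\nabla u|)\,dx,&u\in X_\gamma,\\+\infty,&u\in L^1(\Omega)\setminus X_\gamma.\end{cases}$$ The ROF functional is $$\mathcal F_0(u):=\begin{cases}\frac12\|u-f\|_{L^2(\Omega)}^2+\alpha|Du|(\Omega),&u\in BV(\Omega)\cap L^2(\Omega),\\+\infty,&u\in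 L^1(\Omega)\setminus(BV(\Omega)\cap L^2(\Omega)),\end{cases}$$ where $|Du|(\Omega)$ is the total variation of the distributional derivative $Du$. For every $\gamma>0$, $\mathcal F_\gamma$ has a unique minimizer (in $X_\gamma$). *)

theory Defs
  imports "HOL-Analysis.Analysis"
begin

text \<open>
  Functions on \<open>\<Omega>\<close> are represented by total functions, of which only the restriction to \<open>\<Omega>\<close>
  matters; elements of Lebesgue and Sobolev spaces are not quotiented, so equality of such
  elements is equality almost everywhere on \<open>\<Omega>\<close>.
\<close>

text \<open>
  Near each boundary point, \<open>\<Omega>\<close> is the strict supergraph of a Lipschitz function \<open>g\<close> over the
  hyperplane orthogonal to a unit vector \<open>e\<close>; the point \<open>x\<close> has height \<open>x \<bullet> e\<close> over its
  orthogonal projection \<open>x - (x \<bullet> e) *\<^sub>R e\<close>.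
\<close>

definition lipschitz_boundary :: "'a::euclidean_space set \<Rightarrow> bool" where
  "lipschitz_boundary \<Omega> \<longleftrightarrow>
     (\<forall>p\<in>frontier \<Omega>. \<exists>r>0. \<exists>e. norm e = 1 \<and>
        (\<exists>g::'a \<Rightarrow> real. (\<exists>L. L-lipschitz_on {y. y \<bullet> e = 0} g) \<and>
           \<Omega> \<inter> ball p r = {x \<in> ball p r. x \<bullet> e > g (x - (x \<bullet> e) *\<^sub>R e)}))"

definition bounded_lipschitz_domain :: "'a::euclidean_space set \<Rightarrow> bool" where
  "bounded_lipschitz_domain \<Omega> \<longleftrightarrow>
     \<Omega> \<noteq> {} \<and> open \<Omega> \<and> connected \<Omega> \<and> bounded \<Omega> \<and> lipschitz_boundary \<Omega>"

definition L1_space :: "'a::euclidean_space set \<Rightarrow> ('a \<Rightarrow> 'b::euclidean_space) set" where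
  "L1_space \<Omega> = {u. integrable (lebesgue_on \<Omega>) u}"

definition L2_space :: "'a::euclidean_space set \<Rightarrow> ('a \<Rightarrow> real) set" where
  "L2_space \<Omega> = {u \<in> borel_measurable (lebesgue_on \<Omega>). integrable (lebesgue_on \<Omega>) (\<lambda>x. (u x)\<^sup>2)}"

primrec Ck :: "nat \<Rightarrow> ('a::euclidean_space \<Rightarrow> 'b::real_normed_vector) \<Rightarrow> bool" where
  "Ck 0 f \<longleftrightarrow> continuous_on UNIV f"
| "Ck (Suc k) f \<longleftrightarrow> (\<forall>x. f differentiable (at x)) \<and>
     (\<forall>b\<in>Basis. Ck k (\<lambda>x. frechet_derivative f (at x) b))"

text \<open>\<open>C\<^sub>c\<^sup>\<infinity>(\<Omega>)\<close>, each element extended by zero to the whole space.\<close>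

definition test_functions ::
    "'a::euclidean_space set \<Rightarrow> ('a \<Rightarrow> 'b::real_normed_vector) set" where
  "test_functions \<Omega> =
     {\<phi>. (\<forall>k. Ck k \<phi>) \<and> compact (closure {x. \<phi> x \<noteq> 0}) \<and> closure {x. \<phi> x \<noteq> 0} \<subseteq> \<Omega>}"

definition has_weak_gradient ::
    "'a::euclidean_space set \<Rightarrow> ('a \<Rightarrow> real) \<Rightarrow> ('a \<Rightarrow> 'a) \<Rightarrow> bool" where
  "has_weak_gradient \<Omega> u g \<longleftrightarrow> g \<in> L1_space \<Omega> \<and>
     (\<forall>\<phi>\<in>test_functions \<Omega>. \<forall>b\<in>Basis.
        (LINT x|lebesgue_on \<Omega>. u x * frechet_derivative \<phi> (at x) b) =
        - (LINT x|lebesgue_on \<Omega>. (g x \<bullet> b) * \<phi> x))"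

definition W11_space :: "'a::euclidean_space set \<Rightarrow> ('a \<Rightarrow> real) set" where
  "W11_space \<Omega> = {u \<in> L1_space \<Omega>. \<exists>g. has_weak_gradient \<Omega> u g}"

text \<open>A representative of \<open>\<nabla>u\<close>, which is determined up to a null set; meaningful for \<open>u\<close> in \<open>W\<^sup>1\<^sup>,\<^sup>1(\<Omega>)\<close>.\<close>

definition weak_gradient :: "'a::euclidean_space set \<Rightarrow> ('a \<Rightarrow> real) \<Rightarrow> 'a \<Rightarrow> 'a" where
  "weak_gradient \<Omega> u = (SOME g. has_weak_gradient \<Omega> u g)"

definition divergence :: "('a::euclidean_space \<Rightarrow> 'a) \<Rightarrow> 'a \<Rightarrow> real" where
  "divergence \<phi> x = (\<Sum>b\<in>Basis. frechet_derivative \<phi> (at x) b \<bullet> b)"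

text \<open>The distribution \<open>Du\<close>, as a functional on test vector fields.\<close>

definition distributional_derivative ::
    "'a::euclidean_space set \<Rightarrow> ('a \<Rightarrow> real) \<Rightarrow> ('a \<Rightarrow> 'a) \<Rightarrow> real" where
  "distributional_derivative \<Omega> u \<phi> = - (LINT x|lebesgue_on \<Omega>. u x * divergence \<phi> x)"

text \<open>
  \<open>|Du|(\<Omega>)\<close>, for \<open>u\<close> in \<open>L\<^sup>1(\<Omega>)\<close>. It is finite iff \<open>Du\<close> is a finite vector-valued Radon measure,
  and then it is the mass of the total variation measure.
\<close>

definition total_variation :: "'a::euclidean_space set \<Rightarrow> ('a \<Rightarrow> real) \<Rightarrow> ereal" where
  "total_variation \<Omega> u =
     (SUP \<phi>\<in>{\<phi> \<in> test_functions \<Omega>. \<forall>x. norm (\<phi> x) \<le> 1}.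
        ereal (distributional_derivative \<Omega> u \<phi>))"

definition BV_space :: "'a::euclidean_space set \<Rightarrow> ('a \<Rightarrow> real) set" where
  "BV_space \<Omega> = {u \<in> L1_space \<Omega>. total_variation \<Omega> u < \<infinity>}"

definition log_plus :: "real \<Rightarrow> real" where
  "log_plus r = (if r > 0 then max 0 (ln r) else 0)"

definition phi :: "real \<Rightarrow> ('a \<Rightarrow> real) \<Rightarrow> real \<Rightarrow> 'a \<Rightarrow> real \<Rightarrow> real" where
  "phi \<alpha> \<kappa> \<gamma> x t = \<alpha> * t * (1 + \<gamma> * log_plus (t / \<kappa> x))"

definition phi_energy ::
    "'a::euclidean_space set \<Rightarrow> real \<Rightarrow> ('a \<Rightarrow> real) \<Rightarrow> real \<Rightarrow> ('a \<Rightarrow> real) \<Rightarrow> ennreal" where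
  "phi_energy \<Omega> \<alpha> \<kappa> \<gamma> u =
     (\<integral>\<^sup>+x. ennreal (phi \<alpha> \<kappa> \<gamma> x (norm (weak_gradient \<Omega> u x))) \<partial>lebesgue_on \<Omega>)"

definition X_space ::
    "'a::euclidean_space set \<Rightarrow> real \<Rightarrow> ('a \<Rightarrow> real) \<Rightarrow> real \<Rightarrow> ('a \<Rightarrow> real) set" where
  "X_space \<Omega> \<alpha> \<kappa> \<gamma> = {u \<in> L2_space \<Omega> \<inter> W11_space \<Omega>. phi_energy \<Omega> \<alpha> \<kappa> \<gamma> u < \<infinity>}"

definition fidelity :: "'a::euclidean_space set \<Rightarrow> ('a \<Rightarrow> real) \<Rightarrow> ('a \<Rightarrow> real) \<Rightarrow> real" where
  "fidelity \<Omega> f u = 1 / 2 * (LINT x|lebesgue_on \<Omega>. (u x - f x)\<^sup>2)"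

definition F_gamma ::
    "'a::euclidean_space set \<Rightarrow> ('a \<Rightarrow> real) \<Rightarrow> real \<Rightarrow> ('a \<Rightarrow> real) \<Rightarrow> real \<Rightarrow> ('a \<Rightarrow> real) \<Rightarrow> ereal"
  where
  "F_gamma \<Omega> f \<alpha> \<kappa> \<gamma> u =
     (if u \<in> X_space \<Omega> \<alpha> \<kappa> \<gamma>
      then ereal (fidelity \<Omega> f u) + enn2ereal (phi_energy \<Omega> \<alpha> \<kappa> \<gamma> u)
      else \<infinity>)"

definition F_ROF ::
    "'a::euclidean_space set \<Rightarrow> ('a \<Rightarrow> real) \<Rightarrow> real \<Rightarrow> ('a \<Rightarrow> real) \<Rightarrow> ereal" where
  "F_ROF \<Omega> f \<alpha> u =
     (if u \<in> BV_space \<Omega> \<inter> L2_space \<Omega>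
      then ereal (fidelity \<Omega> f u) + ereal \<alpha> * total_variation \<Omega> u
      else \<infinity>)"

definition is_L1_minimizer ::
    "'a::euclidean_space set \<Rightarrow> (('a \<Rightarrow> real) \<Rightarrow> ereal) \<Rightarrow> ('a \<Rightarrow> real) \<Rightarrow> bool" where
  "is_L1_minimizer \<Omega> F u \<longleftrightarrow> u \<in> L1_space \<Omega> \<and> (\<forall>v\<in>L1_space \<Omega>. F u \<le> F v)"

definition is_unique_L1_minimizer ::
    "'a::euclidean_space set \<Rightarrow> (('a \<Rightarrow> real) \<Rightarrow> ereal) \<Rightarrow> ('a \<Rightarrow> real) \<Rightarrow> bool" where
  "is_unique_L1_minimizer \<Omega> F u \<longleftrightarrow> is_L1_minimizer \<Omega> F u \<and>
     (\<forall>v. is_L1_minimizer \<Omega> F v \<longrightarrow> (AE x in lebesgue_on \<Omega>. v x = u x))"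

definition asymptotic_minimizers ::
    "'a::euclidean_space set \<Rightarrow> (real \<Rightarrow> ('a \<Rightarrow> real) \<Rightarrow> ereal) \<Rightarrow> (real \<Rightarrow> 'a \<Rightarrow> real) \<Rightarrow> bool" where
  "asymptotic_minimizers \<Omega> F u \<longleftrightarrow>
     (\<forall>\<gamma>>0. u \<gamma> \<in> L1_space \<Omega>) \<and>
     (\<exists>\<epsilon>::real \<Rightarrow> real. (\<epsilon> \<longlongrightarrow> 0) (at_right 0) \<and>
        (\<forall>\<^sub>F \<gamma> in at_right 0. F \<gamma> (u \<gamma>) \<le> (INF v\<in>L1_space \<Omega>. F \<gamma> v) + ereal (\<epsilon> \<gamma>)))"

definition tendsto_L1 ::
    "'a::euclidean_space set \<Rightarrow> (real \<Rightarrow> 'a \<Rightarrow> real) \<Rightarrow> ('a \<Rightarrow> real) \<Rightarrow> real filter \<Rightarrow> bool" where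
  "tendsto_L1 \<Omega> u v G \<longleftrightarrow>
     ((\<lambda>\<gamma>. \<integral>\<^sup>+x. ennreal \<bar>u \<gamma> x - v x\<bar> \<partial>lebesgue_on \<Omega>) \<longlongrightarrow> 0) G"

end

(*
Write F_0 for the ROF functional and m for its infimum. F_0 is strongly convex in L^2, so
|u - v|_2^2 <= 4 (F_0(u) - m) + 4 (F_0(v) - m). Hence minimizing sequences are Cauchy in L^2, and
lower semicontinuity gives the unique minimizer u0 without any compactness. Since F_gamma >= F_0,
the same inequality reduces the convergence of (asymptotic) minimizers to limsup inf F_gamma <= m,
that is, to the recovery of u0 in energy by functions v with bounded gradient: on such v,
F_gamma(v) tends to its value at gamma = 0.

For the recovery, let zeta_i be a smooth partition of unity subordinate to a cover of the closure of
Omega by balls in which translation by t e_i moves Omega into itself with a margin c_i t, and put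
v = rho_eps * (sum_i (zeta_i u)(. + t e_i)) with eps < c_i t. Testing grad v with its own sign phi
and moving all operations to the other side gives
  int_Omega |grad v| = - int u div Psi + sum_i int u grad zeta_i . (rho_eps * phi)(. - t e_i),
where Psi = sum_i zeta_i (rho_eps * phi)(. - t e_i) is an admissible field for |Du|(Omega), and the
last sum tends to 0 with t because sum_i grad zeta_i = 0 on Omega.
*)

theory Submission
  imports Defs
begin

section \<open>Smooth functions\<close>

text \<open>The obstacle in the recovery is the boundary: extended by zero, u jumps across the
  frontier, and plain mollification would count that jump as variation. The inward translation
  avoids this on both sides of the duality. For x in Omega, v averages u over points near x + t e_i,
  all of them in Omega, so the jump never enters; dually, Psi has compact support in Omega, although
  the sign field phi is cut off abruptly at the frontier. The margin c_i t leaves room for the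
  mollification radius. A bounded gradient matters because t log t grows faster than t, so a bound
  on the total variation does not control the logarithmic term. For a fixed smooth v that term is at
  most gamma times a constant depending on v. This dictates the order of choices: the energy
  tolerance, then v and its constant, and only then gamma. Convolution and translation live on the
  whole space with Lebesgue-Borel measure, whereas the function spaces use the completed measure on
  Omega. Borel representatives vanishing off Omega connect the two.\<close>

definition C_inf :: "('a::euclidean_space \<Rightarrow> 'b::real_normed_vector) \<Rightarrow> bool" where
  "C_inf f \<longleftrightarrow> (\<forall>k. Ck k f)"

abbreviation partial :: "'a::euclidean_space \<Rightarrow> ('a \<Rightarrow> 'b::real_normed_vector) \<Rightarrow> 'a \<Rightarrow> 'b" where
  "partial b f \<equiv> \<lambda>x. frechet_derivative f (at x) b"

lemma frechet_derivative_eq: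
  "(f has_derivative f') (at x) \<Longrightarrow> frechet_derivative f (at x) = f'"
  using frechet_derivative_at by metis

text \<open>Avoids explicit formulas for higher derivatives: it is enough to exhibit a class of
  differentiable functions that is closed under partial derivatives. The classes used below are the
  \<open>flat\<close> functions of an affine argument, the convolutions with a fixed
  \<open>G\<close>, and the reflections of smooth functions.\<close>

lemma C_inf_coinduct:
  assumes "f \<in> S"
    and diff: "\<And>f x. f \<in> S \<Longrightarrow> f differentiable (at x)"
    and closed: "\<And>f b. f \<in> S \<Longrightarrow> b \<in> Basis \<Longrightarrow> partial b f \<in> S"
  shows "C_inf f"
proof -
  have "Ck k g" if "g \<in> S" for g k
    using that
  proof (induction k arbitrary: g)
    case 0
    then show ?case
      by (auto intro!: continuous_at_imp_continuous_on differentiable_imp_continuous_within diff)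
  next
    case (Suc k)
    then show ?case using diff closed by auto
  qed
  then show ?thesis using assms(1) by (auto simp: C_inf_def)
qed

lemma Ck_SucD: "Ck (Suc k) f \<Longrightarrow> Ck k f"
proof (induction k arbitrary: f)
  case 0
  then show ?case
    by (auto intro!: continuous_at_imp_continuous_on differentiable_imp_continuous_within)
next
  case (Suc k)
  then show ?case by (metis Ck.simps(2))
qed

lemma C_inf_differentiable: "C_inf f \<Longrightarrow> f differentiable (at x)"
  unfolding C_inf_def using Ck.simps(2) by blast

lemma C_inf_has_derivative: "C_inf f \<Longrightarrow> (f has_derivative frechet_derivative f (at x)) (at x)"
  using C_inf_differentiable frechet_derivative_works by blast

lemma C_inf_continuous: "C_inf f \<Longrightarrow> continuous_on S f"
  unfolding C_inf_def using Ck.simps(1) continuous_on_subset by blast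

lemma C_inf_measurable: "C_inf f \<Longrightarrow> f \<in> borel_measurable borel"
  by (intro borel_measurable_continuous_onI C_inf_continuous)

lemma C_inf_partial: "C_inf f \<Longrightarrow> b \<in> Basis \<Longrightarrow> C_inf (partial b f)"
  unfolding C_inf_def using Ck.simps(2) by blast

lemma frechet_derivative_eq_sum_partial:
  assumes "C_inf f"
  shows "frechet_derivative f (at x) h = (\<Sum>b\<in>Basis. (h \<bullet> b) *\<^sub>R partial b f x)"
proof -
  interpret bounded_linear "frechet_derivative f (at x)"
    using C_inf_has_derivative[OF assms] has_derivative_bounded_linear by blast
  have "frechet_derivative f (at x) h = frechet_derivative f (at x) (\<Sum>b\<in>Basis. (h \<bullet> b) *\<^sub>R b)"
    by (simp add: euclidean_representation)
  then show ?thesis by (simp add: sum scaleR)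
qed

section \<open>Closure properties of smooth functions\<close>

lemma Ck_const: "Ck k (\<lambda>x. c)"
  by (induction k arbitrary: c) auto

lemma Ck_add: "Ck k f \<Longrightarrow> Ck k g \<Longrightarrow> Ck k (\<lambda>x. f x + g x)"
proof (induction k arbitrary: f g)
  case 0
  then show ?case by (auto intro: continuous_intros)
next
  case (Suc k)
  then have "frechet_derivative (\<lambda>x. f x + g x) (at x) =
      (\<lambda>h. frechet_derivative f (at x) h + frechet_derivative g (at x) h)" for x
    by (intro frechet_derivative_eq has_derivative_add) (auto simp: frechet_derivative_works)
  then show ?case using Suc by auto
qed

lemma Ck_scaleR:
  fixes f :: "'a::euclidean_space \<Rightarrow> real"
  shows "Ck k f \<Longrightarrow> Ck k g \<Longrightarrow> Ck k (\<lambda>x. f x *\<^sub>R g x)"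
proof (induction k arbitrary: f g)
  case 0
  then show ?case by (auto intro: continuous_intros)
next
  case (Suc k)
  then have "frechet_derivative (\<lambda>x. f x *\<^sub>R g x) (at x) =
      (\<lambda>h. f x *\<^sub>R frechet_derivative g (at x) h + frechet_derivative f (at x) h *\<^sub>R g x)" for x
    by (intro frechet_derivative_eq has_derivative_scaleR) (auto simp: frechet_derivative_works)
  moreover have "Ck k f" "Ck k g" using Suc Ck_SucD by blast+
  ultimately show ?case using Suc by (auto intro!: Ck_add)
qed

lemma Ck_bounded_linear:
  assumes "bounded_linear L"
  shows "Ck k f \<Longrightarrow> Ck k (\<lambda>x. L (f x))"
proof (induction k arbitrary: f)
  case 0
  then show ?case using bounded_linear.continuous_on[OF assms] by auto
next
  case (Suc k)
  then have *: "((\<lambda>x. L (f x)) has_derivative (\<lambda>h. L (frechet_derivative f (at x) h))) (at x)" for x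
    by (intro bounded_linear.has_derivative[OF assms]) (auto simp: frechet_derivative_works)
  have "Ck k (\<lambda>x. L (partial b f x))" if "b \<in> Basis" for b
    using Suc.IH[of "partial b f"] Suc.prems that by simp
  then show ?case using * frechet_derivative_eq[OF *]
    by (auto simp: differentiable_def)
qed

lemma has_derivative_translate:
  assumes "(f has_derivative f') (at (x + a))"
  shows "((\<lambda>x. f (x + a)) has_derivative f') (at x)"
  by (rule has_derivative_compose[of "\<lambda>x. x + a" "\<lambda>h. h" x UNIV f, simplified])
    (auto simp: assms intro!: derivative_eq_intros)

lemma Ck_translate: "Ck k f \<Longrightarrow> Ck k (\<lambda>x. f (x + a))"
proof (induction k arbitrary: f)
  case 0
  then show ?case by (auto intro!: continuous_on_compose2[of UNIV f] continuous_intros)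
next
  case (Suc k)
  have *: "((\<lambda>x. f (x + a)) has_derivative frechet_derivative f (at (x + a))) (at x)" for x
    using Suc by (intro has_derivative_translate) (auto simp: frechet_derivative_works)
  have "Ck k (\<lambda>x. partial b f (x + a))" if "b \<in> Basis" for b
    using Suc.IH[of "partial b f"] Suc.prems that by simp
  then show ?case using * frechet_derivative_eq[OF *]
    by (auto simp: differentiable_def)
qed

lemma C_inf_scaleR:
  fixes f :: "'a::euclidean_space \<Rightarrow> real"
  shows "C_inf f \<Longrightarrow> C_inf g \<Longrightarrow> C_inf (\<lambda>x. f x *\<^sub>R g x)"
  by (simp add: C_inf_def Ck_scaleR)

lemma C_inf_sum: "(\<And>i. i \<in> I \<Longrightarrow> C_inf (f i)) \<Longrightarrow> C_inf (\<lambda>x. \<Sum>i\<in>I. f i x)"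
  by (induction I rule: infinite_finite_induct) (auto simp: C_inf_def Ck_const Ck_add)

lemma C_inf_prod:
  fixes f :: "_ \<Rightarrow> 'a::euclidean_space \<Rightarrow> real"
  shows "(\<And>i. i \<in> I \<Longrightarrow> C_inf (f i)) \<Longrightarrow> C_inf (\<lambda>x. \<Prod>i\<in>I. f i x)"
  by (induction I rule: infinite_finite_induct)
    (auto simp: C_inf_def Ck_const intro!: Ck_scaleR[where 'b=real, simplified real_scaleR_def])

lemma C_inf_bounded_linear: "bounded_linear L \<Longrightarrow> C_inf f \<Longrightarrow> C_inf (\<lambda>x. L (f x))"
  by (simp add: C_inf_def Ck_bounded_linear)

lemma C_inf_translate: "C_inf f \<Longrightarrow> C_inf (\<lambda>x. f (x + a))"
  by (simp add: C_inf_def Ck_translate)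

section \<open>Mollifiers\<close>

text \<open>For \<open>p = 1\<close> this is the classical flat function exp(-1/t). The polynomial
  in 1/t makes the family closed under differentiation, so all orders are treated at once.\<close>

definition flat :: "real poly \<Rightarrow> real \<Rightarrow> real" where
  "flat p t = (if t > 0 then poly p (1 / t) * exp (- (1 / t)) else 0)"

lemma poly_div_exp_tendsto_0: "((\<lambda>s::real. poly p s * exp (- s)) \<longlongrightarrow> 0) at_top"
proof (induction p)
  case 0
  then show ?case by simp
next
  case (pCons a p)
  have "poly (pCons a p) s * exp (- s) = (\<Sum>i\<le>degree (pCons a p). coeff (pCons a p) i * (s ^ i / exp s))" for s
    unfolding poly_altdef exp_minus sum_distrib_right by (intro sum.cong) (auto simp: divide_inverse)
  moreover have "((\<lambda>s. \<Sum>i\<le>degree (pCons a p). coeff (pCons a p) i * (s ^ i / exp s)) \<longlongrightarrow> (\<Sum>i\<le>degree (pCons a p). 0)) at_top"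
    by (intro tendsto_sum tendsto_mult_right_zero tendsto_power_div_exp_0)
  ultimately show ?case by (simp del: poly_pCons)
qed

lemma flat_tendsto_0: "(flat p \<longlongrightarrow> 0) (at 0)"
proof -
  have "(flat p \<longlongrightarrow> 0) (at_left 0)"
  proof (rule Lim_transform_eventually[OF tendsto_const])
    show "\<forall>\<^sub>F x in at_left 0. 0 = flat p x"
      by (auto simp: flat_def eventually_at_filter)
  qed
  moreover have "(flat p \<longlongrightarrow> 0) (at_right 0)"
  proof (rule Lim_transform_eventually)
    show "((\<lambda>t. poly p (inverse t) * exp (- inverse t)) \<longlongrightarrow> 0) (at_right 0)"
      using filterlim_compose[OF poly_div_exp_tendsto_0 filterlim_inverse_at_top_right] .
    show "\<forall>\<^sub>F t in at_right 0. poly p (inverse t) * exp (- inverse t) = flat p t"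
      by (auto simp: flat_def eventually_at_filter inverse_eq_divide)
  qed
  ultimately show ?thesis using filterlim_split_at by blast
qed

text \<open>With s = 1/t, the derivative of p(s) exp(-s) in t is s^2 (p(s) - p'(s)) exp(-s); the two
  \<open>pCons 0\<close> are the factor s^2.\<close>

lemma flat_has_derivative:
  "(flat p has_real_derivative flat (pCons 0 (pCons 0 (p - pderiv p))) t) (at t)"
proof -
  consider "t > 0" | "t < 0" | "t = 0" by linarith
  then show ?thesis
  proof cases
    case 1
    have "((\<lambda>t. poly p (1 / t) * exp (- (1 / t))) has_real_derivative
        flat (pCons 0 (pCons 0 (p - pderiv p))) t) (at t)"
      using 1 by (auto intro!: derivative_eq_intros poly_DERIV[THEN DERIV_chain2]
          simp: flat_def field_simps power2_eq_square)
    then show ?thesis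
      by (rule has_field_derivative_transform_within_open[of _ _ _ "{0<..}"])
        (use 1 in \<open>auto simp: flat_def\<close>)
  next
    case 2
    have "((\<lambda>t. 0) has_real_derivative 0) (at t)" by simp
    then have "(flat p has_real_derivative 0) (at t)"
      by (rule has_field_derivative_transform_within_open[of _ _ _ "{..<0}"])
        (use 2 in \<open>auto simp: flat_def\<close>)
    then show ?thesis using 2 by (simp add: flat_def)
  next
    case 3
    \<comment> \<open>Dividing by h only multiplies the polynomial by 1/h, so the difference
      quotient at 0 is again a flat function and tends to 0.\<close>
    have "\<forall>\<^sub>F h in at 0. flat (pCons 0 p) h = (flat p (0 + h) - flat p 0) / h"
      by (auto simp: flat_def eventually_at_filter)
    then have "((\<lambda>h. (flat p (0 + h) - flat p 0) / h) \<longlongrightarrow> 0) (at 0)"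
      by (rule Lim_transform_eventually[OF flat_tendsto_0])
    then show ?thesis using 3 by (simp add: DERIV_def flat_def)
  qed
qed

text \<open>The chain rule produces a constant factor, which \<open>smult\<close> absorbs into the
  polynomial; hence these functions, with d fixed, form a class closed under partial
  derivatives.\<close>

lemma C_inf_flat_affine:
  "C_inf (\<lambda>x::'a::euclidean_space. flat p (a + c * (x \<bullet> d)))"
proof (rule C_inf_coinduct[where S = "{\<lambda>x. flat p (a + c * (x \<bullet> d)) | p a c. True}"])
  have D: "((\<lambda>x. flat p (a + c * (x \<bullet> d))) has_derivative
      (\<lambda>h. flat (smult (c * (h \<bullet> d)) (pCons 0 (pCons 0 (p - pderiv p)))) (a + c * (x \<bullet> d)))) (at x)"
    for p a c and x :: 'a
  proof -
    have "((\<lambda>x. a + c * (x \<bullet> d)) has_derivative (\<lambda>h. c * (h \<bullet> d))) (at x)"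
      by (auto intro!: derivative_eq_intros)
    note has_derivative_compose[OF this flat_has_derivative[of p "a + c * (x \<bullet> d)", unfolded has_field_derivative_def]]
    moreover have "flat (smult k q) t = flat q t * k" for k q t
      by (simp add: flat_def)
    ultimately show ?thesis by (simp only:)
  qed
  then show "f differentiable at x"
    if "f \<in> {\<lambda>x. flat p (a + c * (x \<bullet> d)) | p a c. True}" for f x
    using that D unfolding differentiable_def by blast
  show "partial b f \<in> {\<lambda>x. flat p (a + c * (x \<bullet> d)) | p a c. True}"
    if "f \<in> {\<lambda>x. flat p (a + c * (x \<bullet> d)) | p a c. True}" for f b
    using that unfolding mem_Collect_eq by (elim exE conjE) (simp only: frechet_derivative_eq[OF D], blast)
qed auto

text \<open>Evenness turns convolution into an average over translates and makes it its own adjoint;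
  both facts are used repeatedly.\<close>

definition mollifier :: "real \<Rightarrow> ('a::euclidean_space \<Rightarrow> real) \<Rightarrow> bool" where
  "mollifier e r \<longleftrightarrow> C_inf r \<and> (\<forall>x. 0 \<le> r x) \<and> (\<forall>x. r (- x) = r x) \<and>
     (\<forall>x. r x \<noteq> 0 \<longrightarrow> norm x < e) \<and> integrable lborel r \<and> integral\<^sup>L lborel r = 1"

lemma integrable_lborel_continuous_bounded_support:
  fixes k :: "'a::euclidean_space \<Rightarrow> 'b::euclidean_space"
  assumes "continuous_on UNIV k" and supp: "\<And>x. k x \<noteq> 0 \<Longrightarrow> norm x \<le> R"
  shows "integrable lborel k"
proof -
  have "integrable lborel (\<lambda>x. indicator (cball 0 R) x *\<^sub>R k x)"
    using borel_integrable_compact[OF compact_cball continuous_on_subset[OF assms(1)]] by simp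
  moreover have "(\<lambda>x. indicator (cball 0 R) x *\<^sub>R k x) = k"
    using supp by (fastforce simp: indicator_def)
  ultimately show ?thesis by simp
qed

text \<open>A product over the coordinates of flat functions of d + x_b and d - x_b is smooth, even
  and supported in a cube; it remains to normalize its integral.\<close>

lemma mollifier_exists:
  assumes "e > 0"
  shows "\<exists>r::'a::euclidean_space \<Rightarrow> real. mollifier e r"
proof -
  \<comment> \<open>The norm is at most the sum of the absolute coordinates, so the cube of
    half-width e / DIM lies in the ball of radius e.\<close>
  define d where "d = e / DIM('a)"
  have d: "d > 0" using assms by (simp add: d_def)
  define h where "h x = (\<Prod>b\<in>Basis. flat 1 (d + 1 * (x \<bullet> b)) * flat 1 (d + (-1) * (x \<bullet> b)))" for x :: 'a
  have h: "C_inf h"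
    unfolding h_def
    by (intro C_inf_prod C_inf_scaleR[where 'b=real, simplified real_scaleR_def] C_inf_flat_affine)
  have flat_nn: "flat 1 t \<ge> 0" for t by (simp add: flat_def)
  have h_nn: "h x \<ge> 0" for x unfolding h_def by (intro prod_nonneg ballI mult_nonneg_nonneg flat_nn)
  have h_even: "h (- x) = h x" for x unfolding h_def by (intro prod.cong) (auto simp: mult_ac)
  have supp: "norm x < e" if "h x \<noteq> 0" for x
  proof -
    have "\<bar>x \<bullet> b\<bar> < d" if "b \<in> Basis" for b
    proof -
      have "flat 1 (d + 1 * (x \<bullet> b)) * flat 1 (d + (-1) * (x \<bullet> b)) \<noteq> 0"
        using \<open>h x \<noteq> 0\<close> that unfolding h_def by (simp add: prod_zero_iff)
      then show ?thesis by (auto simp: flat_def split: if_splits)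
    qed
    then have "(\<Sum>b\<in>Basis. \<bar>x \<bullet> b\<bar>) < (\<Sum>b\<in>(Basis::'a set). d)"
      by (intro sum_strict_mono) auto
    then show ?thesis using norm_le_l1[of x] by (simp add: d_def)
  qed
  have int: "integrable lborel h"
    by (rule integrable_lborel_continuous_bounded_support[of h e])
      (use supp C_inf_continuous[OF h] in \<open>auto simp: less_imp_le\<close>)
  \<comment> \<open>A continuous function that vanishes almost everywhere vanishes everywhere, but
    \<open>h 0\<close> is positive.\<close>
  have "integral\<^sup>L lborel h \<noteq> 0"
  proof
    assume "integral\<^sup>L lborel h = 0"
    then have "AE x in lborel. h x = 0"
      using integral_nonneg_eq_0_iff_AE[OF int] h_nn by auto
    then have "AE x in lborel. x \<in> {x. h x = 0}" by simp
    moreover have "closed {x. h x = 0}"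
      using C_inf_continuous[OF h] by (intro closed_Collect_eq) auto
    ultimately have "{x. h x = 0} = UNIV"
      using mem_closed_if_AE_lebesgue[of "{x. h x = 0}"] AE_completion by blast
    then have "h 0 = 0" by auto
    then show False using d by (simp add: h_def flat_def)
  qed
  moreover have "integral\<^sup>L lborel h \<ge> 0" using h_nn by simp
  ultimately have pos: "integral\<^sup>L lborel h > 0" by linarith
  have "mollifier e (\<lambda>x. (1 / integral\<^sup>L lborel h) *\<^sub>R h x)"
    unfolding mollifier_def
    using pos h_nn h_even supp int
      C_inf_scaleR[OF _ h, of "\<lambda>x. 1 / integral\<^sup>L lborel h"] by (auto simp: C_inf_def Ck_const)
  then show ?thesis by blast
qed

section \<open>Translations and reflections of integrals\<close>

lemma lborel_distr_reflect: "distr lborel borel ((-) (a::'a::euclidean_space)) = lborel"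
  by (subst (2) lborel_affine[of "-1" a]) (auto simp: density_1 cong: distr_cong)

lemma lborel_distr_translate: "distr lborel borel (\<lambda>x. x + (a::'a::euclidean_space)) = lborel"
  using lborel_distr_plus[of a] by (simp add: add.commute[of a] cong: distr_cong)

lemma integral_translate:
  fixes a :: "'a::euclidean_space" and f :: "'a \<Rightarrow> 'b::{banach, second_countable_topology}"
  assumes "f \<in> borel_measurable borel"
  shows "(LINT x|lborel. f (x + a)) = integral\<^sup>L lborel f"
  using integral_distr[of "\<lambda>x. x + a" lborel borel f] assms by (simp add: lborel_distr_translate)

lemma integrable_translate:
  fixes a :: "'a::euclidean_space" and f :: "'a \<Rightarrow> 'b::{banach, second_countable_topology}"
  assumes "integrable lborel f"
  shows "integrable lborel (\<lambda>x. f (x + a))"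
  using integrable_distr[of "\<lambda>x. x + a" lborel borel f] assms by (simp add: lborel_distr_translate)

lemma integral_reflect:
  fixes a :: "'a::euclidean_space" and f :: "'a \<Rightarrow> 'b::{banach, second_countable_topology}"
  assumes "f \<in> borel_measurable borel"
  shows "(LINT x|lborel. f (a - x)) = integral\<^sup>L lborel f"
  using integral_distr[of "(-) a" lborel borel f] assms by (simp add: lborel_distr_reflect)

lemma integrable_reflect:
  fixes a :: "'a::euclidean_space" and f :: "'a \<Rightarrow> 'b::{banach, second_countable_topology}"
  assumes "integrable lborel f"
  shows "integrable lborel (\<lambda>x. f (a - x))"
  using integrable_distr[of "(-) a" lborel borel f] assms by (simp add: lborel_distr_reflect)

section \<open>Convolution\<close>

definition conv :: "('a::euclidean_space \<Rightarrow> real) \<Rightarrow> ('a \<Rightarrow> 'b::euclidean_space) \<Rightarrow> 'a \<Rightarrow> 'b" where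
  "conv k G z = (LINT x|lborel. k (z - x) *\<^sub>R G x)"

definition bump :: "('a::euclidean_space \<Rightarrow> 'b::euclidean_space) \<Rightarrow> bool" where
  "bump k \<longleftrightarrow> C_inf k \<and> (\<exists>R. \<forall>x. k x \<noteq> 0 \<longrightarrow> norm x \<le> R)"

lemma mollifier_bump: "mollifier e r \<Longrightarrow> bump r"
  unfolding mollifier_def bump_def by (meson less_imp_le)

lemma bump_bounded: "bump k \<Longrightarrow> \<exists>B\<ge>0. \<forall>x. norm (k x) \<le> B"
proof -
  assume k: "bump k"
  then obtain R where R: "\<And>x. k x \<noteq> 0 \<Longrightarrow> norm x \<le> R" by (auto simp: bump_def)
  have "compact (k ` cball 0 R)"
    using k by (intro compact_continuous_image C_inf_continuous) (auto simp: bump_def)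
  then obtain B where B: "\<And>x. x \<in> cball 0 R \<Longrightarrow> norm (k x) \<le> B"
    by (meson bounded_iff compact_imp_bounded imageI)
  have "norm (k x) \<le> max 0 B" for x
    using B[of x] R[of x] by (cases "k x = 0") auto
  then show ?thesis by (intro exI[of _ "max 0 B"]) auto
qed

lemma bump_measurable: "bump k \<Longrightarrow> k \<in> borel_measurable borel"
  by (simp add: bump_def C_inf_measurable)

lemma bump_integrable: "bump k \<Longrightarrow> integrable lborel k"
  unfolding bump_def using integrable_lborel_continuous_bounded_support C_inf_continuous by blast

lemma frechet_derivative_zero_outside:
  assumes "open S" "x \<in> S" "\<And>y. y \<in> S \<Longrightarrow> f y = 0"
  shows "frechet_derivative f (at x) = (\<lambda>h. 0)"
proof (rule frechet_derivative_eq)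
  have "((\<lambda>y. 0) has_derivative (\<lambda>h. 0)) (at x)" by simp
  then show "(f has_derivative (\<lambda>h. 0)) (at x)"
    by (rule has_derivative_transform_within_open[OF _ assms(1,2)]) (simp add: assms(3))
qed

text \<open>Differentiation does not enlarge the support. The function \<open>g\<close> stands for
  any first-order expression in \<open>f\<close>: a partial derivative, the gradient or the
  divergence.\<close>

lemma bump_if_derivative_zero:
  assumes "bump f" "C_inf g"
    and zero: "\<And>x. frechet_derivative f (at x) = (\<lambda>h. 0) \<Longrightarrow> g x = 0"
  shows "bump g"
proof -
  obtain R where R: "\<And>x. f x \<noteq> 0 \<Longrightarrow> norm x \<le> R" using assms by (auto simp: bump_def)
  have "g x = 0" if "norm x > R" for x
    by (rule zero, rule frechet_derivative_zero_outside[of "- cball 0 R"]) (use that R in \<open>force+\<close>)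
  then have "\<forall>x. g x \<noteq> 0 \<longrightarrow> norm x \<le> R" by force
  then show ?thesis using assms by (auto simp: bump_def)
qed

lemma bump_partial:
  assumes "bump k" "b \<in> Basis"
  shows "bump (partial b k)"
  by (rule bump_if_derivative_zero[OF assms(1)]) (use assms C_inf_partial in \<open>auto simp: bump_def\<close>)

section \<open>Integrability, smoothness and adjoint of convolutions\<close>

lemma integrable_bounded_mult:
  fixes k :: "'a::euclidean_space \<Rightarrow> real" and G :: "'a \<Rightarrow> 'b::euclidean_space"
  assumes "k \<in> borel_measurable borel" "\<And>x. \<bar>k x\<bar> \<le> B" "integrable lborel G"
  shows "integrable lborel (\<lambda>x. k x *\<^sub>R G x)"
proof (rule Bochner_Integration.integrable_bound[of _ "\<lambda>x. B * norm (G x)"])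
  show "AE x in lborel. norm (k x *\<^sub>R G x) \<le> norm (B * norm (G x))"
    using abs_ge_self[of B] by (auto intro!: AE_I2 mult_right_mono simp: abs_mult intro: order_trans[OF assms(2)])
qed (use assms in auto)

lemma integrable_conv:
  fixes k :: "'a::euclidean_space \<Rightarrow> real" and G :: "'a \<Rightarrow> 'b::euclidean_space"
  assumes "bump k" "integrable lborel G"
  shows "integrable lborel (\<lambda>x. k (z - x) *\<^sub>R G x)"
proof -
  obtain B where "\<And>x. \<bar>k x\<bar> \<le> B" using bump_bounded[OF assms(1)] by auto
  then show ?thesis
    using bump_measurable[OF assms(1)] assms(2)
    by (intro integrable_bounded_mult[where k = "\<lambda>x. k (z - x)"]) auto
qed

text \<open>One constant for the increments and for the derivative, so that the difference quotients
  of a convolution have an integrable majorant.\<close>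

lemma bump_lipschitz:
  assumes "bump k"
  obtains L where "L \<ge> 0" "\<And>x y. norm (k y - k x) \<le> L * norm (y - x)"
    "\<And>x h. norm (frechet_derivative k (at x) h) \<le> L * norm h"
proof -
  have "\<exists>B\<ge>0. \<forall>x. norm (partial b k x) \<le> B" if "b \<in> Basis" for b
    using bump_bounded[OF bump_partial[OF assms that]] .
  then obtain B where B: "\<And>b. b \<in> Basis \<Longrightarrow> B b \<ge> 0" "\<And>b x. b \<in> Basis \<Longrightarrow> norm (partial b k x) \<le> B b"
    by metis
  define L where "L = (\<Sum>b\<in>Basis. B b)"
  have k: "C_inf k" using assms by (simp add: bump_def)
  have *: "norm (frechet_derivative k (at x) h) \<le> L * norm h" for x h
  proof -
    have "norm (frechet_derivative k (at x) h) \<le> (\<Sum>b\<in>Basis. norm ((h \<bullet> b) *\<^sub>R partial b k x))"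
      by (subst frechet_derivative_eq_sum_partial[OF k]) (rule norm_sum)
    also have "\<dots> \<le> (\<Sum>b\<in>Basis. norm h * B b)"
      using B Basis_le_norm by (intro sum_mono) (auto intro!: mult_mono)
    finally show ?thesis by (simp add: L_def sum_distrib_left mult.commute)
  qed
  moreover have "norm (k y - k x) \<le> L * norm (y - x)" for x y
    using differentiable_bound[of UNIV k "\<lambda>x. frechet_derivative k (at x)" L y x]
      C_inf_has_derivative[OF k] * by (auto intro!: onorm_le)
  moreover have "L \<ge> 0" using B by (auto simp: L_def intro: sum_nonneg)
  ultimately show ?thesis using that by blast
qed

text \<open>All regularity comes from the kernel; \<open>G\<close> is merely integrable. The
  remainder of the difference quotient, weighted by \<open>G\<close>, tends to 0 by dominated
  convergence along every sequence of increments.\<close>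

lemma conv_has_derivative:
  fixes k :: "'a::euclidean_space \<Rightarrow> real" and G :: "'a \<Rightarrow> 'b::euclidean_space"
  assumes k: "bump k" and G: "integrable lborel G"
  shows "(conv k G has_derivative (\<lambda>h. \<Sum>b\<in>Basis. (h \<bullet> b) *\<^sub>R conv (partial b k) G z)) (at z)"
proof -
  define D where "D h = (\<Sum>b\<in>Basis. (h \<bullet> b) *\<^sub>R conv (partial b k) G z)" for h
  have kC: "C_inf k" using k by (simp add: bump_def)
  have [measurable]: "k \<in> borel_measurable borel" using k bump_measurable by auto
  have pm: "(\<lambda>x. partial b k (z - x)) \<in> borel_measurable borel" if "b \<in> Basis" for b
    using measurable_compose[OF _ bump_measurable[OF bump_partial[OF k that]], of "\<lambda>x. z - x" borel] by simp
  have [measurable]: "G \<in> borel_measurable borel" using G by auto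
  have Dk: "(\<lambda>x. frechet_derivative k (at (z - x)) h) = (\<lambda>x. \<Sum>b\<in>Basis. (h \<bullet> b) *\<^sub>R partial b k (z - x))" for h
    by (intro ext frechet_derivative_eq_sum_partial[OF kC])
  have [measurable]: "(\<lambda>x. frechet_derivative k (at (z - x)) h) \<in> borel_measurable borel" for h
    by (subst Dk) (intro borel_measurable_sum borel_measurable_scaleR borel_measurable_const pm)
  obtain L where L: "L \<ge> 0" "\<And>x y. norm (k y - k x) \<le> L * norm (y - x)"
      "\<And>x h. norm (frechet_derivative k (at x) h) \<le> L * norm h"
    using bump_lipschitz[OF k] by metis
  have Dh: "D h = (LINT x|lborel. frechet_derivative k (at (z - x)) h *\<^sub>R G x)"
    and Dint: "integrable lborel (\<lambda>x. frechet_derivative k (at (z - x)) h *\<^sub>R G x)" for h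
  proof -
    have *: "frechet_derivative k (at (z - x)) h *\<^sub>R G x = (\<Sum>b\<in>Basis. (h \<bullet> b) *\<^sub>R (partial b k (z - x) *\<^sub>R G x))" for x
      by (simp add: frechet_derivative_eq_sum_partial[OF kC, of _ h] scaleR_sum_left)
    have i: "integrable lborel (\<lambda>x. partial b k (z - x) *\<^sub>R G x)" if "b \<in> Basis" for b
      using integrable_conv[OF bump_partial[OF k that] G] .
    show "D h = (LINT x|lborel. frechet_derivative k (at (z - x)) h *\<^sub>R G x)"
      unfolding * D_def conv_def using i
      by (subst Bochner_Integration.integral_sum) (auto simp del: scaleR_scaleR)
    show "integrable lborel (\<lambda>x. frechet_derivative k (at (z - x)) h *\<^sub>R G x)"
      unfolding * by (intro Bochner_Integration.integrable_sum integrable_scaleR_right i)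
  qed
  define q where "q h x = ((k (z + h - x) - k (z - x) - frechet_derivative k (at (z - x)) h) / norm h) *\<^sub>R G x" for h x
  have q_int: "(conv k G (z + h) - conv k G z - D h) /\<^sub>R norm h = (LINT x|lborel. q h x)" for h
    unfolding conv_def Dh q_def
    using integrable_conv[OF k G, of "z + h"] integrable_conv[OF k G, of z] Dint[of h]
    by (simp add: divide_inverse mult.commute[of _ "inverse (norm h)"] flip: scaleR_scaleR)
      (simp add: scaleR_diff_left)
  have "((\<lambda>h. LINT x|lborel. q h x) \<longlongrightarrow> integral\<^sup>L (lborel :: 'a measure) (\<lambda>x. 0 :: 'b)) (at 0)"
    unfolding tendsto_at_iff_sequentially comp_def
  proof (intro allI impI)
    fix X :: "nat \<Rightarrow> 'a" assume X: "\<forall>i. X i \<in> UNIV - {0}" "X \<longlonglongrightarrow> 0"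
    then have X0: "filterlim X (at 0) sequentially" by (simp add: filterlim_at)
    show "(\<lambda>n. LINT x|lborel. q (X n) x) \<longlonglongrightarrow> integral\<^sup>L (lborel :: 'a measure) (\<lambda>x. 0 :: 'b)"
    \<comment> \<open>The increment of \<open>k\<close> and its linear part are each at most
      \<open>L\<close> times the norm of the increment, hence the factor 2.\<close>
    proof (rule integral_dominated_convergence[where w = "\<lambda>x. (2 * L) * norm (G x)"])
      show "integrable lborel (\<lambda>x. 2 * L * norm (G x))" using G by auto
      show "(\<lambda>x. q (X n) x) \<in> borel_measurable lborel" for n
        unfolding q_def by measurable
      show "AE x in lborel. (\<lambda>n. q (X n) x) \<longlonglongrightarrow> 0"
      proof (rule AE_I2)
        fix x
        have "((\<lambda>h. norm (k (z - x + h) - k (z - x) - frechet_derivative k (at (z - x)) h) / norm h) \<longlongrightarrow> 0) (at 0)"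
          using C_inf_has_derivative[OF kC, of "z - x"] unfolding has_derivative_at by blast
        then have "((\<lambda>h. (k (z + h - x) - k (z - x) - frechet_derivative k (at (z - x)) h) / norm h) \<longlongrightarrow> 0) (at 0)"
          by (intro tendsto_norm_zero_cancel[where f = "\<lambda>h. _ h / norm h"]) (simp add: add_diff_eq diff_add_eq)
        then have "((\<lambda>h. q h x) \<longlongrightarrow> 0 *\<^sub>R G x) (at 0)"
          unfolding q_def by (intro tendsto_scaleR tendsto_const)
        then show "(\<lambda>n. q (X n) x) \<longlonglongrightarrow> 0"
          using filterlim_compose[OF _ X0] by fastforce
      qed
      show "AE x in lborel. norm (q (X n) x) \<le> 2 * L * norm (G x)" for n
      proof (rule AE_I2)
        fix x
        have "\<bar>k (z + X n - x) - k (z - x) - frechet_derivative k (at (z - x)) (X n)\<bar> \<le> 2 * L * norm (X n)"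
          using L(2)[of "z + X n - x" "z - x"] L(3)[of "z - x" "X n"] by auto
        then have "\<bar>k (z + X n - x) - k (z - x) - frechet_derivative k (at (z - x)) (X n)\<bar> / norm (X n) \<le> 2 * L"
          using X(1) by (simp add: divide_le_eq)
        then show "norm (q (X n) x) \<le> 2 * L * norm (G x)"
          using mult_right_mono[OF _ norm_ge_zero[of "G x"]] by (fastforce simp: q_def)
      qed
    qed auto
  qed
  then have "((\<lambda>h. (conv k G (z + h) - conv k G z - D h) /\<^sub>R norm h) \<longlongrightarrow> 0) (at 0)"
    by (simp add: q_int)
  then have "((\<lambda>h. norm (conv k G (z + h) - conv k G z - D h) / norm h) \<longlongrightarrow> 0) (at 0)"
    using tendsto_norm_zero by (fastforce simp: divide_inverse mult.commute)
  moreover have "bounded_linear D"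
    unfolding D_def by (intro bounded_linear_intros)
  ultimately have "(conv k G has_derivative D) (at z)" by (simp add: has_derivative_at)
  then show ?thesis by (simp only: D_def[abs_def])
qed

lemma sum_Basis_inner_scaleR:
  fixes F :: "'a::euclidean_space \<Rightarrow> 'b::real_vector"
  assumes "b \<in> Basis"
  shows "(\<Sum>c\<in>Basis. (b \<bullet> c) *\<^sub>R F c) = F b"
proof -
  have "(\<Sum>c\<in>Basis. (b \<bullet> c) *\<^sub>R F c) = (\<Sum>c\<in>Basis. if b = c then F c else 0)"
    using assms by (intro sum.cong) (auto simp: inner_Basis)
  then show ?thesis using assms by simp
qed

lemma partial_conv:
  assumes "bump k" "integrable lborel G" "b \<in> Basis"
  shows "partial b (conv k G) = conv (partial b k) G"
  using assms(3) frechet_derivative_eq[OF conv_has_derivative[OF assms(1,2)]]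
  by (intro ext) (simp only: sum_Basis_inner_scaleR)

lemma C_inf_conv:
  assumes "bump k" "integrable lborel G"
  shows "C_inf (conv k G)"
proof (rule C_inf_coinduct[where S = "{conv k G | k. bump k}"])
  show "f differentiable at x" if "f \<in> {conv k G | k. bump k}" for f x
    using that conv_has_derivative[OF _ assms(2)] unfolding differentiable_def by blast
  show "partial b f \<in> {conv k G | k. bump k}" if "f \<in> {conv k G | k. bump k}" "b \<in> Basis" for f b
    using that partial_conv[OF _ assms(2)] bump_partial by blast
qed (use assms in auto)

lemma conv_nonzero:
  assumes "conv k G z \<noteq> 0"
  obtains x where "G x \<noteq> 0" "k (z - x) \<noteq> 0"
proof -
  have "\<exists>x. k (z - x) *\<^sub>R G x \<noteq> 0"
  proof (rule ccontr)
    assume "\<nexists>x. k (z - x) *\<^sub>R G x \<noteq> 0"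
    then have "(\<lambda>x. k (z - x) *\<^sub>R G x) = (\<lambda>x. 0)" by auto
    then show False using assms by (simp add: conv_def)
  qed
  then show ?thesis using that by auto
qed

text \<open>A mollifier is a probability density, so averaging preserves the pointwise unit bound
  imposed on the fields in the total variation.\<close>

lemma norm_conv_le_1:
  assumes r: "mollifier e r" and [measurable]: "G \<in> borel_measurable borel" and "\<And>x. norm (G x) \<le> 1"
  shows "norm (conv r G z) \<le> 1"
proof -
  have [measurable]: "r \<in> borel_measurable borel" using r mollifier_bump bump_measurable by blast
  have i: "integrable lborel (\<lambda>x. r (z - x))" 
    using r by (intro integrable_reflect) (auto simp: mollifier_def)
  have le: "norm (r (z - x) *\<^sub>R G x) \<le> r (z - x)" for x
    using r assms(3)[of x] by (auto simp: mollifier_def intro: mult_left_le)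
  have "integrable lborel (\<lambda>x. r (z - x) *\<^sub>R G x)"
    by (rule Bochner_Integration.integrable_bound[OF i]) (use le in \<open>auto intro!: AE_I2 intro: order_trans[OF _ abs_ge_self]\<close>)
  then have "(LINT x|lborel. norm (r (z - x) *\<^sub>R G x)) \<le> (LINT x|lborel. r (z - x))"
    by (intro integral_mono integrable_norm i le)
  then have "norm (conv r G z) \<le> (LINT x|lborel. r (z - x))"
    unfolding conv_def by (rule order_trans[OF integral_norm_bound])
  also have "\<dots> = 1" using integral_reflect[of r z] r by (auto simp: mollifier_def)
  finally show ?thesis .
qed

text \<open>For a mollifier, which is even, the translated form of the convolution integral needs no
  reflection.\<close>

lemma conv_eq_average:
  assumes r: "mollifier e r" and [measurable]: "H \<in> borel_measurable borel"
  shows "conv r H x = (LINT w|lborel. r w *\<^sub>R H (x + w))"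
proof -
  have [measurable]: "r \<in> borel_measurable borel" using r mollifier_bump bump_measurable by blast
  have "conv r H x = (LINT w|lborel. r (x - (w + x)) *\<^sub>R H (w + x))"
    unfolding conv_def by (rule integral_translate[symmetric]) simp
  then show ?thesis using r by (simp add: mollifier_def add.commute)
qed

text \<open>Fubini applies because the kernel is bounded, which dominates the double integrand by a
  multiple of the product of two integrable functions.\<close>

lemma conv_adjoint:
  fixes H s :: "'a::euclidean_space \<Rightarrow> real"
  assumes k: "bump k" and H: "integrable lborel H" and s: "integrable lborel s"
  shows "(LINT x|lborel. conv k H x * s x) = (LINT y|lborel. H y * conv (\<lambda>z. k (- z)) s y)"
proof -
  have [measurable]: "k \<in> borel_measurable borel" "H \<in> borel_measurable borel" "s \<in> borel_measurable borel"
    using bump_measurable[OF k] H s by auto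
  obtain B where B: "B \<ge> 0" "\<And>x. \<bar>k x\<bar> \<le> B" using bump_bounded[OF k] by auto
  have i1: "integrable (lborel \<Otimes>\<^sub>M lborel) (\<lambda>(x, y). s x * H y)"
    by (rule lborel_pair.Fubini_integrable) (use H s in \<open>auto simp: abs_mult\<close>)
  have "integrable (lborel \<Otimes>\<^sub>M lborel) (\<lambda>(x, y). k (x - y) * H y * s x)"
  proof (rule Bochner_Integration.integrable_bound)
    show "integrable (lborel \<Otimes>\<^sub>M lborel) (\<lambda>p. B * (case p of (x, y) \<Rightarrow> s x * H y))"
      using i1 by simp
    show "AE p in lborel \<Otimes>\<^sub>M lborel. norm (case p of (x, y) \<Rightarrow> k (x - y) * H y * s x)
        \<le> norm (B * (case p of (x, y) \<Rightarrow> s x * H y))"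
    proof (rule AE_I2, clarify)
      fix x y
      have "norm (k (x - y) * H y * s x) = \<bar>k (x - y)\<bar> * norm (s x * H y)"
        by (simp add: abs_mult)
      also have "\<dots> \<le> B * norm (s x * H y)"
        using B(2) by (rule mult_right_mono) simp
      finally show "norm (k (x - y) * H y * s x) \<le> norm (B * (s x * H y))"
        using B(1) by (simp add: abs_mult)
    qed
  qed measurable
  from lborel_pair.Fubini_integral[OF this]
  have "(LINT y|lborel. LINT x|lborel. k (x - y) * H y * s x) = (LINT x|lborel. LINT y|lborel. k (x - y) * H y * s x)"
    by simp
  then show ?thesis by (simp add: conv_def mult_ac flip: integral_mult_right_zero integral_mult_left_zero)
qed


section \<open>Continuity of translations\<close>

definition translation_continuous :: "('a::euclidean_space \<Rightarrow> 'b::euclidean_space) \<Rightarrow> bool" where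
  "translation_continuous f \<longleftrightarrow>
     (\<forall>e>0. \<exists>d>0. \<forall>h. norm h < d \<longrightarrow> (LINT x|lborel. norm (f (x + h) - f x)) < e)"

lemma translation_continuousD:
  "translation_continuous f \<Longrightarrow> e > 0 \<Longrightarrow>
    \<exists>d>0. \<forall>h. norm h < d \<longrightarrow> (LINT x|lborel. norm (f (x + h) - f x)) < e"
  by (simp add: translation_continuous_def)

text \<open>Translation invariance makes the approximation error the same before and after the
  shift, so three errors of e / 3 suffice.\<close>

lemma translation_continuous_limit:
  fixes f :: "'a::euclidean_space \<Rightarrow> 'b::euclidean_space"
  assumes f: "integrable lborel f"
    and approx: "\<And>e. e > 0 \<Longrightarrow>
      \<exists>g. integrable lborel g \<and> translation_continuous g \<and> (LINT x|lborel. norm (f x - g x)) < e"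
  shows "translation_continuous f"
  unfolding translation_continuous_def
proof (intro allI impI)
  fix e :: real assume "e > 0"
  then have "e / 3 > 0" by simp
  from approx[OF this] obtain g where g: "integrable lborel g" "translation_continuous g"
      "(LINT x|lborel. norm (f x - g x)) < e / 3"
    by auto
  then obtain d where d: "d > 0" "\<And>h. norm h < d \<Longrightarrow> (LINT x|lborel. norm (g (x + h) - g x)) < e / 3"
    unfolding translation_continuous_def using \<open>e / 3 > 0\<close> by meson
  have "(LINT x|lborel. norm (f (x + h) - f x)) < e" if h: "norm h < d" for h
  proof -
    have i: "integrable lborel (\<lambda>x. f (x + h))" "integrable lborel (\<lambda>x. g (x + h))"
      using f g integrable_translate by auto
    have "(LINT x|lborel. norm (f (x + h) - f x)) \<le>
      (LINT x|lborel. norm (f (x + h) - g (x + h)) + norm (g (x + h) - g x) + norm (f x - g x))"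
    proof (intro integral_mono)
      fix x
      have "norm (a - b) \<le> norm (a - c) + norm (c - d) + norm (b - d)" for a b c d :: 'b
        using norm_triangle_ineq[of "a - c" "c - b"] norm_triangle_ineq4[of "c - d" "b - d"] by simp
      then show "norm (f (x + h) - f x) \<le> norm (f (x + h) - g (x + h)) + norm (g (x + h) - g x) + norm (f x - g x)" .
    qed (use i f g in auto)
    also have "\<dots> = (LINT x|lborel. norm (f (x + h) - g (x + h))) + (LINT x|lborel. norm (g (x + h) - g x))
        + (LINT x|lborel. norm (f x - g x))"
      using i f g by simp
    also have "(LINT x|lborel. norm (f (x + h) - g (x + h))) = (LINT x|lborel. norm (f x - g x))"
      using f g by (intro integral_translate[of "\<lambda>x. norm (f x - g x)"]) auto
    finally show ?thesis using g d(2)[OF h] by auto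
  qed
  then show "\<exists>d>0. \<forall>h. norm h < d \<longrightarrow> (LINT x|lborel. norm (f (x + h) - f x)) < e"
    using d(1) by blast
qed

text \<open>For open \<open>U\<close>, the indicator of \<open>U\<close> is lower semicontinuous, so the overlap of \<open>U\<close> with its
  translates tends to the measure of \<open>U\<close> by dominated convergence.\<close>

lemma translation_continuous_open:
  fixes U :: "'a::euclidean_space set" and c :: "'b::euclidean_space"
  assumes "open U" and fin: "emeasure lborel U < \<infinity>"
  shows "translation_continuous (\<lambda>x. indicator U x *\<^sub>R c)"
proof -
  have [measurable]: "U \<in> sets borel" using \<open>open U\<close> by simp
  define I where "I h = (LINT x|lborel. indicator U x * indicator U (x + h) :: real)" for h
  have iU: "integrable lborel (indicator U :: 'a \<Rightarrow> real)"
    using fin by (simp add: integrable_indicator_iff)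
  have i: "integrable lborel (\<lambda>x. indicator U (x + h) :: real)" for h
    using integrable_translate[OF iU] .
  have ii: "integrable lborel (\<lambda>x. indicator U x * indicator U (x + h) :: real)" for h
    by (rule Bochner_Integration.integrable_bound[OF iU]) (auto simp: indicator_def)
  have "(I \<longlongrightarrow> (LINT x|lborel. indicator U x)) (at 0)"
    unfolding tendsto_at_iff_sequentially comp_def I_def
  proof (intro allI impI)
    fix X :: "nat \<Rightarrow> 'a" assume X: "X \<longlonglongrightarrow> 0"
    show "(\<lambda>n. LINT x|lborel. indicator U x * indicator U (x + X n) :: real) \<longlonglongrightarrow> (LINT x|lborel. indicator U x)"
    proof (rule integral_dominated_convergence[where w = "indicator U"])
      show "AE x in lborel. (\<lambda>n. indicator U x * indicator U (x + X n) :: real) \<longlonglongrightarrow> indicator U x"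
      proof (rule AE_I2)
        fix x
        show "(\<lambda>n. indicator U x * indicator U (x + X n) :: real) \<longlonglongrightarrow> indicator U x"
        proof (cases "x \<in> U")
          case True
          have "(\<lambda>n. x + X n) \<longlonglongrightarrow> x" using tendsto_add[OF tendsto_const X, of x] by simp
          then have "\<forall>\<^sub>F n in sequentially. x + X n \<in> U"
            using \<open>open U\<close> True topological_tendstoD by blast
          then show ?thesis using True
            by (intro tendsto_eventually) (auto elim: eventually_mono)
        qed simp
      qed
    qed (use iU in \<open>auto simp: indicator_def\<close>)
  qed
  \<comment> \<open>For indicator values a and b, |a - b| = a + b - 2ab. Both single integrals are
    the measure of \<open>U\<close>, so the distance is twice the part of \<open>U\<close> lost in
    the overlap.\<close>
  moreover have "(LINT x|lborel. norm (indicator U (x + h) *\<^sub>R c - indicator U x *\<^sub>R c)) =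
      (2 * (LINT x|lborel. indicator U x) - 2 * I h) * norm c" for h
  proof -
    have "norm (indicator U (x + h) *\<^sub>R c - indicator U x *\<^sub>R c) =
      (indicator U (x + h) + indicator U x - 2 * (indicator U x * indicator U (x + h))) * norm c" for x
      by (auto simp: indicator_def)
    then show ?thesis
      using i ii iU integral_translate[of "indicator U :: 'a \<Rightarrow> real" h] by (simp add: I_def)
  qed
  ultimately have "((\<lambda>h. LINT x|lborel. norm (indicator U (x + h) *\<^sub>R c - indicator U x *\<^sub>R c)) \<longlongrightarrow>
      (2 * (LINT x|lborel. indicator U x) - 2 * (LINT x|lborel. indicator U x)) * norm c) (at 0)"
    by (simp only:) (intro tendsto_intros)
  then have lim: "((\<lambda>h. LINT x|lborel. norm (indicator U (x + h) *\<^sub>R c - indicator U x *\<^sub>R c)) \<longlongrightarrow> 0) (at 0)"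
    by simp
  show ?thesis
    unfolding translation_continuous_def
  proof (intro allI impI)
    fix e :: real assume "e > 0"
    from LIM_D[OF lim this] obtain d where "d > 0"
      and d: "\<forall>h. h \<noteq> 0 \<and> norm (h - 0) < d \<longrightarrow>
        norm ((LINT x|lborel. norm (indicator U (x + h) *\<^sub>R c - indicator U x *\<^sub>R c)) - 0) < e"
      by blast
    have "(LINT x|lborel. norm (indicator U (x + h) *\<^sub>R c - indicator U x *\<^sub>R c)) < e" if "norm h < d" for h
      using d[rule_format, of h] that \<open>e > 0\<close> by (cases "h = 0") (simp_all add: abs_less_iff)
    then show "\<exists>d>0. \<forall>h. norm h < d \<longrightarrow> (LINT x|lborel. norm (indicator U (x + h) *\<^sub>R c - indicator U x *\<^sub>R c)) < e"
      using \<open>d > 0\<close> by blast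
  qed
qed

text \<open>Outer regularity approximates the set from outside by an open set in measure, which
  reduces the claim to open sets.\<close>

lemma translation_continuous_indicator:
  fixes A :: "'a::euclidean_space set" and c :: "'b::euclidean_space"
  assumes A: "A \<in> sets borel" and fin: "emeasure lborel A < \<infinity>"
  shows "translation_continuous (\<lambda>x. indicator A x *\<^sub>R c)"
proof (rule translation_continuous_limit)
  show "integrable lborel (\<lambda>x. indicator A x *\<^sub>R c)"
    using A fin by simp
  fix e :: real assume "e > 0"
  \<comment> \<open>Adding 1 to the denominator covers the case c = 0.\<close>
  define e' where "e' = e / (norm c + 1)"
  have "e' > 0" using \<open>e > 0\<close> by (simp add: e'_def add_nonneg_pos)
  then obtain U where U: "open U" "A \<subseteq> U" "emeasure lborel (U - A) < ennreal e'"
    using outer_regular_lborel[OF A, of e'] by auto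
  have [measurable]: "U \<in> sets borel" "A \<in> sets borel" using U A by auto
  have "emeasure lborel U = emeasure lborel A + emeasure lborel (U - A)"
    using U by (subst plus_emeasure) (auto simp: Un_absorb1)
  then have finU: "emeasure lborel U < \<infinity>" 
    using U(3) fin by (metis ennreal_add_eq_top ennreal_less_top infinity_ennreal_def order_less_trans top.not_eq_extremum)
  have "(LINT x|lborel. norm (indicator A x *\<^sub>R c - indicator U x *\<^sub>R c)) = (LINT x|lborel. indicator (U - A) x * norm c)"
    using U(2) by (intro Bochner_Integration.integral_cong) (auto simp: indicator_def)
  also have "\<dots> = measure lborel (U - A) * norm c" by simp
  also have "\<dots> \<le> e' * norm c"
    using U(3) \<open>e' > 0\<close> by (intro mult_right_mono) (auto simp: measure_def enn2real_leI less_imp_le)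
  also have "\<dots> < e"
  proof -
    have "norm c + 1 > 0" using norm_ge_zero[of c] by linarith
    then show ?thesis using \<open>e > 0\<close> unfolding e'_def by (simp add: divide_less_eq)
  qed
  finally show "\<exists>g. integrable lborel g \<and> translation_continuous g \<and>
      (LINT x|lborel. norm (indicator A x *\<^sub>R c - g x)) < e"
    using translation_continuous_open[OF U(1) finU, of c] finU
    by (intro exI[of _ "\<lambda>x. indicator U x *\<^sub>R c"]) auto
qed

text \<open>The property holds for indicators and survives sums and L^1 limits, which are the three
  cases of induction over integrable functions.\<close>

lemma integrable_translation_continuous:
  fixes f :: "'a::euclidean_space \<Rightarrow> 'b::euclidean_space"
  assumes "integrable lborel f"
  shows "translation_continuous f"
  using assms
proof (induction rule: integrable_induct)
  case (base A c)
  then show ?case using translation_continuous_indicator by auto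
next
  case (add f g)
  show ?case
    unfolding translation_continuous_def
  proof (intro allI impI)
    fix e :: real assume "e > 0"
    then have "e / 2 > 0" by simp
    obtain d1 where d1: "d1 > 0" "\<And>h. norm h < d1 \<Longrightarrow> (LINT x|lborel. norm (f (x + h) - f x)) < e / 2"
      using translation_continuousD[OF _ \<open>e / 2 > 0\<close>, of f] add by blast
    obtain d2 where d2: "d2 > 0" "\<And>h. norm h < d2 \<Longrightarrow> (LINT x|lborel. norm (g (x + h) - g x)) < e / 2"
      using translation_continuousD[OF _ \<open>e / 2 > 0\<close>, of g] add by blast
    have "(LINT x|lborel. norm (f (x + h) + g (x + h) - (f x + g x))) < e" if "norm h < min d1 d2" for h
    proof -
      have i: "integrable lborel (\<lambda>x. f (x + h))" "integrable lborel (\<lambda>x. g (x + h))"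
        using add integrable_translate by auto
      have "(LINT x|lborel. norm (f (x + h) + g (x + h) - (f x + g x))) \<le>
        (LINT x|lborel. norm (f (x + h) - f x) + norm (g (x + h) - g x))"
        using i add by (intro integral_mono) (auto simp: norm_diff_triangle_ineq)
      also have "\<dots> = (LINT x|lborel. norm (f (x + h) - f x)) + (LINT x|lborel. norm (g (x + h) - g x))"
        using i add by simp
      finally show ?thesis using d1(2)[of h] d2(2)[of h] that by auto
    qed
    then show "\<exists>d>0. \<forall>h. norm h < d \<longrightarrow> (LINT x|lborel. norm (f (x + h) + g (x + h) - (f x + g x))) < e"
      using d1(1) d2(1) by (intro exI[of _ "min d1 d2"]) auto
  qed
next
  case (lim f s)
  show ?case
  proof (rule translation_continuous_limit[OF lim(4)])
    fix e :: real assume "e > 0"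
    have "(\<lambda>n. LINT x|lborel. norm (f x - s n x)) \<longlonglongrightarrow> integral\<^sup>L (lborel :: 'a measure) (\<lambda>x. 0 :: real)"
    \<comment> \<open>The approximants satisfy \<open>norm (s n x) \<le> 2 * norm (f x)\<close>, so
      the difference is at most three times the norm of \<open>f x\<close>.\<close>
    proof (rule integral_dominated_convergence[where w = "\<lambda>x. 3 * norm (f x)"])
      show "AE x in lborel. (\<lambda>n. norm (f x - s n x)) \<longlonglongrightarrow> 0"
      proof (rule AE_I2)
        fix x :: 'a
        have "(\<lambda>n. norm (f x - s n x)) \<longlonglongrightarrow> norm (f x - f x)"
          using lim(2)[of x] by (intro tendsto_intros) auto
        then show "(\<lambda>n. norm (f x - s n x)) \<longlonglongrightarrow> 0" by simp
      qed
      show "AE x in lborel. norm (norm (f x - s n x)) \<le> 3 * norm (f x)" for n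
      proof (rule AE_I2)
        fix x :: 'a
        show "norm (norm (f x - s n x)) \<le> 3 * norm (f x)"
          using lim(3)[of x n] norm_triangle_ineq4[of "f x" "s n x"] by simp
      qed
    qed (use lim in \<open>auto\<close>)
    then have "\<forall>\<^sub>F n in sequentially. (LINT x|lborel. norm (f x - s n x)) < e"
      using \<open>e > 0\<close> by (intro order_tendstoD) auto
    then obtain n where "(LINT x|lborel. norm (f x - s n x)) < e"
      by (meson eventually_sequentially order_refl)
    then show "\<exists>g. integrable lborel g \<and> translation_continuous g \<and> (LINT x|lborel. norm (f x - g x)) < e"
      using lim by blast
  qed
qed

section \<open>Translations in L^2\<close>

text \<open>Transfers continuity of translations from L^1 to L^2: the signed square a |a| maps L^2
  into L^1, and its inverse is Hoelder continuous of exponent 1/2. The constant 2 is attained at b =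
  -a.\<close>

lemma square_diff_le: "(a - b)\<^sup>2 \<le> 2 * \<bar>a * \<bar>a\<bar> - b * \<bar>b\<bar>\<bar>" for a b :: real
proof -
  have *: "(a - b)\<^sup>2 \<le> 2 * (a\<^sup>2 - b\<^sup>2)" if "0 \<le> b" "b \<le> a" for a b :: real
  proof -
    have "2 * (a\<^sup>2 - b\<^sup>2) - (a - b)\<^sup>2 = (a - b) * (a + 3 * b)"
      by (simp add: power2_eq_square algebra_simps)
    moreover have "(a - b) * (a + 3 * b) \<ge> 0" using that by simp
    ultimately show ?thesis by linarith
  qed
  have **: "(a - b)\<^sup>2 \<le> 2 * (a\<^sup>2 + b\<^sup>2)" for a b :: real
    using zero_le_power2[of "a + b"] by (simp add: power2_eq_square algebra_simps)
  have pos: "x * \<bar>x\<bar> = x\<^sup>2" if "x \<ge> 0" for x :: real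
    using that by (simp add: power2_eq_square)
  have neg: "x * \<bar>x\<bar> = - x\<^sup>2" if "x \<le> 0" for x :: real
    using that by (simp add: power2_eq_square)
  have main: "(a - b)\<^sup>2 \<le> 2 * (a * \<bar>a\<bar> - b * \<bar>b\<bar>)" if "b \<le> a" for a b :: real
  proof -
    consider "0 \<le> b" | "b \<le> 0" "0 \<le> a" | "a \<le> 0" by linarith
    then show ?thesis
    proof cases
      case 1
      then show ?thesis using *[of b a] that pos[of a] pos[of b] by simp
    next
      case 2
      then show ?thesis using **[of a b] pos[of a] neg[of b] by simp
    next
      case 3
      have "(- b - - a)\<^sup>2 = (a - b)\<^sup>2" by simp
      then show ?thesis using *[of "- a" "- b"] that 3 neg[of a] neg[of b] by simp
    qed
  qed
  \<comment> \<open>The signed square is increasing, so for b at most a the difference is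
    nonnegative; the remaining case follows by exchanging a and b.\<close>
  have le: "(a - b)\<^sup>2 \<le> 2 * \<bar>a * \<bar>a\<bar> - b * \<bar>b\<bar>\<bar>" if "b \<le> a" for a b :: real
    by (rule order_trans[OF main[OF that] mult_left_mono[OF abs_ge_self]]) simp
  show ?thesis
    using le[of b a] le[of a b] by (cases "b \<le> a") (auto simp: power2_commute abs_minus_commute)
qed

lemma integrable_square_diff:
  fixes a b :: "'a \<Rightarrow> real"
  assumes [measurable]: "a \<in> borel_measurable M" "b \<in> borel_measurable M"
    and "integrable M (\<lambda>x. (a x)\<^sup>2)" "integrable M (\<lambda>x. (b x)\<^sup>2)"
  shows "integrable M (\<lambda>x. (a x - b x)\<^sup>2)"
proof (rule Bochner_Integration.integrable_bound)
  show "integrable M (\<lambda>x. 2 * (a x)\<^sup>2 + 2 * (b x)\<^sup>2)" using assms by simp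
  have "(s - t)\<^sup>2 \<le> 2 * s\<^sup>2 + 2 * t\<^sup>2" for s t :: real
    using zero_le_power2[of "s + t"] by (simp add: power2_eq_square algebra_simps)
  then show "AE x in M. norm ((a x - b x)\<^sup>2) \<le> norm (2 * (a x)\<^sup>2 + 2 * (b x)\<^sup>2)"
    by (intro AE_I2) simp
qed simp

text \<open>Applies continuity in L^1 to \<open>G x * \<bar>G x\<bar>\<close>. The plain square
  would lose the sign of \<open>G\<close> and could not control the difference.\<close>

lemma L2_translation_continuity:
  fixes G :: "'a::euclidean_space \<Rightarrow> real"
  assumes [measurable]: "G \<in> borel_measurable borel" and G: "integrable lborel (\<lambda>x. (G x)\<^sup>2)" and "e > 0"
  shows "\<exists>d>0. \<forall>h. norm h < d \<longrightarrow> (\<integral>\<^sup>+x. ennreal ((G (x + h) - G x)\<^sup>2) \<partial>lborel) \<le> ennreal e"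
proof -
  have Q: "integrable lborel (\<lambda>x. G x * \<bar>G x\<bar>)"
    by (rule Bochner_Integration.integrable_bound[OF G]) (auto simp: abs_mult power2_eq_square)
  from translation_continuousD[OF integrable_translation_continuous[OF this], of "e / 2"]
  obtain d where d: "d > 0"
    "\<And>h. norm h < d \<Longrightarrow> (LINT x|lborel. norm (G (x + h) * \<bar>G (x + h)\<bar> - G x * \<bar>G x\<bar>)) < e / 2"
    using \<open>e > 0\<close> by auto
  have "(\<integral>\<^sup>+x. ennreal ((G (x + h) - G x)\<^sup>2) \<partial>lborel) \<le> ennreal e" if h: "norm h < d" for h
  proof -
    have i: "integrable lborel (\<lambda>x. norm (G (x + h) * \<bar>G (x + h)\<bar> - G x * \<bar>G x\<bar>))"
      using Q integrable_translate[OF Q, of h] by simp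
    have "(\<integral>\<^sup>+x. ennreal ((G (x + h) - G x)\<^sup>2) \<partial>lborel) \<le>
      (\<integral>\<^sup>+x. ennreal (2 * norm (G (x + h) * \<bar>G (x + h)\<bar> - G x * \<bar>G x\<bar>)) \<partial>lborel)"
      using square_diff_le by (intro nn_integral_mono ennreal_leI) auto
    also have "\<dots> = ennreal (2 * (LINT x|lborel. norm (G (x + h) * \<bar>G (x + h)\<bar> - G x * \<bar>G x\<bar>)))"
      using i by (subst nn_integral_eq_integral) auto
    also have "\<dots> \<le> ennreal e" using d(2)[OF h] by (intro ennreal_leI) auto
    finally show ?thesis .
  qed
  then show ?thesis using d(1) by blast
qed

section \<open>Errors of mollification\<close>

text \<open>Tonelli exchanges the two averages: an error bound valid for every single shift
  \<open>w\<close> in the support of the mollifier passes to the mollification, since the weights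
  have total mass 1.\<close>

lemma mollifier_average_bound:
  fixes q :: "'a::euclidean_space \<times> 'a \<Rightarrow> ennreal"
  assumes r: "mollifier e r" and [measurable]: "q \<in> borel_measurable (borel \<Otimes>\<^sub>M borel)"
    and F: "\<And>x. F x \<le> (\<integral>\<^sup>+w. ennreal (r w) * q (x, w) \<partial>lborel)"
    and C: "\<And>w. norm w < e \<Longrightarrow> (\<integral>\<^sup>+x. q (x, w) \<partial>lborel) \<le> C"
  shows "(\<integral>\<^sup>+x. F x \<partial>lborel) \<le> C"
proof -
  have [measurable]: "r \<in> borel_measurable borel" using r mollifier_bump bump_measurable by blast
  have "(\<integral>\<^sup>+x. F x \<partial>lborel) \<le> (\<integral>\<^sup>+x. (\<integral>\<^sup>+w. ennreal (r w) * q (x, w) \<partial>lborel) \<partial>lborel)"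
    using F by (intro nn_integral_mono)
  also have "\<dots> = (\<integral>\<^sup>+w. (\<integral>\<^sup>+x. ennreal (r w) * q (x, w) \<partial>lborel) \<partial>lborel)"
    by (rule lborel_pair.Fubini') measurable
  also have "\<dots> = (\<integral>\<^sup>+w. ennreal (r w) * (\<integral>\<^sup>+x. q (x, w) \<partial>lborel) \<partial>lborel)"
    by (intro nn_integral_cong nn_integral_cmult) measurable
  also have "\<dots> \<le> (\<integral>\<^sup>+w. ennreal (r w) * C \<partial>lborel)"
  proof (rule nn_integral_mono)
    fix w show "ennreal (r w) * (\<integral>\<^sup>+x. q (x, w) \<partial>lborel) \<le> ennreal (r w) * C"
      using r C[of w] by (cases "r w = 0") (auto simp: mollifier_def intro: mult_left_mono)
  qed
  also have "\<dots> = C"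
    using r by (subst nn_integral_multc) (auto simp: mollifier_def nn_integral_eq_integral)
  finally show ?thesis .
qed

lemma mollifier_integrable_mult:
  assumes r: "mollifier e r" and "integrable lborel f"
  shows "integrable lborel (\<lambda>w. r w * f w :: real)"
proof -
  obtain B where "\<And>x. \<bar>r x\<bar> \<le> B" using bump_bounded[OF mollifier_bump[OF r]] by auto
  then show ?thesis
    using integrable_bounded_mult[of r B f] assms bump_measurable[OF mollifier_bump[OF r]] by auto
qed

lemma conv_diff_eq_average:
  fixes H :: "'a::euclidean_space \<Rightarrow> real"
  assumes r: "mollifier e r" and H: "integrable lborel H"
  shows "integrable lborel (\<lambda>w. r w * (H (x + w) - c))"
    and "conv r H x - c = (LINT w|lborel. r w * (H (x + w) - c))"
proof -
  have i: "integrable lborel (\<lambda>w. r w * H (x + w))" "integrable lborel (\<lambda>w. r w * c)"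
    using mollifier_integrable_mult[OF r integrable_translate[OF H, of x]] r
    by (auto simp: mollifier_def add.commute)
  then show "integrable lborel (\<lambda>w. r w * (H (x + w) - c))" by (simp add: right_diff_distrib)
  have [measurable]: "H \<in> borel_measurable borel" using H by auto
  show "conv r H x - c = (LINT w|lborel. r w * (H (x + w) - c))"
    using i r by (simp add: conv_eq_average[OF r] right_diff_distrib) (simp add: mollifier_def)
qed

lemma conv_L1_le:
  fixes H G :: "'a::euclidean_space \<Rightarrow> real"
  assumes r: "mollifier e r" and H: "integrable lborel H" and [measurable]: "G \<in> borel_measurable borel"
    and C: "\<And>w. norm w < e \<Longrightarrow> (\<integral>\<^sup>+x. ennreal \<bar>H (x + w) - G x\<bar> \<partial>lborel) \<le> C"
  shows "(\<integral>\<^sup>+x. ennreal \<bar>conv r H x - G x\<bar> \<partial>lborel) \<le> C"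
proof (rule mollifier_average_bound[OF r, where q = "\<lambda>(x, w). ennreal \<bar>H (x + w) - G x\<bar>"])
  have [measurable]: "H \<in> borel_measurable borel" using H by auto
  show "(\<lambda>(x, w). ennreal \<bar>H (x + w) - G x\<bar>) \<in> borel_measurable (borel \<Otimes>\<^sub>M borel)" by measurable
  fix x
  note i = conv_diff_eq_average[OF r H, of x "G x"]
  have "\<bar>conv r H x - G x\<bar> \<le> (LINT w|lborel. \<bar>r w * (H (x + w) - G x)\<bar>)"
    unfolding i(2) by (rule integral_abs_bound)
  then have "ennreal \<bar>conv r H x - G x\<bar> \<le> ennreal (LINT w|lborel. \<bar>r w * (H (x + w) - G x)\<bar>)"
    by (rule ennreal_leI)
  also have "\<dots> = (\<integral>\<^sup>+w. ennreal \<bar>r w * (H (x + w) - G x)\<bar> \<partial>lborel)"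
    using i(1) by (subst nn_integral_eq_integral) auto
  also have "\<dots> = (\<integral>\<^sup>+w. ennreal (r w) * ennreal \<bar>H (x + w) - G x\<bar> \<partial>lborel)"
    using r by (intro nn_integral_cong) (auto simp: abs_mult mollifier_def ennreal_mult)
  finally show "ennreal \<bar>conv r H x - G x\<bar> \<le>
      (\<integral>\<^sup>+w. ennreal (r w) * (case (x, w) of (x, w) \<Rightarrow> ennreal \<bar>H (x + w) - G x\<bar>) \<partial>lborel)"
    by simp
qed (use C in auto)

text \<open>Comparison with a second function \<open>G\<close> handles mollification and the
  preceding translation in one estimate: later \<open>H\<close> is the sum of the translated pieces
  and \<open>G\<close> the original function.\<close>

lemma conv_L2_le:
  fixes H G :: "'a::euclidean_space \<Rightarrow> real"
  assumes r: "mollifier e r" and H: "integrable lborel H" and H2: "integrable lborel (\<lambda>x. (H x)\<^sup>2)"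
    and [measurable]: "G \<in> borel_measurable borel"
    and C: "\<And>w. norm w < e \<Longrightarrow> (\<integral>\<^sup>+x. ennreal ((H (x + w) - G x)\<^sup>2) \<partial>lborel) \<le> C"
  shows "(\<integral>\<^sup>+x. ennreal ((conv r H x - G x)\<^sup>2) \<partial>lborel) \<le> C"
proof (rule mollifier_average_bound[OF r, where q = "\<lambda>(x, w). ennreal ((H (x + w) - G x)\<^sup>2)"])
  have [measurable]: "H \<in> borel_measurable borel" using H by auto
  show "(\<lambda>(x, w). ennreal ((H (x + w) - G x)\<^sup>2)) \<in> borel_measurable (borel \<Otimes>\<^sub>M borel)" by measurable
  fix x
  note i = conv_diff_eq_average[OF r H, of x "G x"]
  define m where "m = (LINT w|lborel. r w * (H (x + w) - G x))"
  have r1: "integrable lborel r" "integral\<^sup>L lborel r = 1" "\<And>w. r w \<ge> 0"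
    using r by (auto simp: mollifier_def)
  have i2: "integrable lborel (\<lambda>w. r w * (H (x + w) - G x)\<^sup>2)"
  proof -
    have "integrable lborel (\<lambda>w. r w * (H (x + w))\<^sup>2)"
      using mollifier_integrable_mult[OF r integrable_translate[OF H2, of x]] by (simp add: add.commute)
    moreover have "integrable lborel (\<lambda>w. r w * H (x + w))"
      using mollifier_integrable_mult[OF r integrable_translate[OF H, of x]] by (simp add: add.commute)
    moreover have "r w * (H (x + w) - G x)\<^sup>2 = r w * (H (x + w))\<^sup>2 - 2 * G x * (r w * H (x + w)) + (G x)\<^sup>2 * r w" for w
      by (simp add: power2_eq_square algebra_simps)
    ultimately show ?thesis using r1 by simp
  qed
  \<comment> \<open>Jensen's inequality for the square, from the nonnegativity of the variance\<close>
  have "0 \<le> (LINT w|lborel. r w * (H (x + w) - G x - m)\<^sup>2)"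
    using r1 by (intro integral_nonneg_AE AE_I2) simp
  also have "(\<lambda>w. r w * (H (x + w) - G x - m)\<^sup>2) =
      (\<lambda>w. r w * (H (x + w) - G x)\<^sup>2 - 2 * m * (r w * (H (x + w) - G x)) + m\<^sup>2 * r w)"
    by (auto simp: power2_eq_square algebra_simps)
  also have "(LINT w|lborel. r w * (H (x + w) - G x)\<^sup>2 - 2 * m * (r w * (H (x + w) - G x)) + m\<^sup>2 * r w) =
      (LINT w|lborel. r w * (H (x + w) - G x)\<^sup>2) - 2 * m * m + m\<^sup>2"
    using i(1) i2 r1 by (simp add: m_def)
  finally have "(conv r H x - G x)\<^sup>2 \<le> (LINT w|lborel. r w * (H (x + w) - G x)\<^sup>2)"
    unfolding i(2) m_def[symmetric] by (simp add: power2_eq_square)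
  then have "ennreal ((conv r H x - G x)\<^sup>2) \<le> ennreal (LINT w|lborel. r w * (H (x + w) - G x)\<^sup>2)"
    by (rule ennreal_leI)
  also have "\<dots> = (\<integral>\<^sup>+w. ennreal (r w * (H (x + w) - G x)\<^sup>2) \<partial>lborel)"
    using i2 r1 by (subst nn_integral_eq_integral) auto
  also have "\<dots> = (\<integral>\<^sup>+w. ennreal (r w) * ennreal ((H (x + w) - G x)\<^sup>2) \<partial>lborel)"
    using r1 by (intro nn_integral_cong) (auto simp: ennreal_mult)
  finally show "ennreal ((conv r H x - G x)\<^sup>2) \<le>
      (\<integral>\<^sup>+w. ennreal (r w) * (case (x, w) of (x, w) \<Rightarrow> ennreal ((H (x + w) - G x)\<^sup>2)) \<partial>lborel)"
    by simp
qed (use C in auto)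

section \<open>Inward translations and partitions of unity\<close>

lemma finite_positive_lower_bound:
  fixes D :: "nat \<Rightarrow> real"
  assumes "\<And>i. i < N \<Longrightarrow> 0 < D i"
  shows "\<exists>d>0. \<forall>i<N. d \<le> D i"
  using assms
proof (induction N)
  case 0
  then show ?case by (intro exI[of _ 1]) auto
next
  case (Suc N)
  then obtain d where d: "d > 0" "\<And>i. i < N \<Longrightarrow> d \<le> D i" by auto
  show ?case
    by (rule exI[of _ "min d (D N)"]) (use d Suc.prems in \<open>force simp: less_Suc_eq min_le_iff_disj\<close>)
qed

text \<open>A quantitative cone condition: around x + t e a ball of radius c t, as far as it lies in
  the chart ball, stays in \<Omega>. The bound \<open>norm e \<le> 1\<close> rather than equality
  admits e = 0 for interior points, where no translation is required.\<close>

definition inward :: "'a::euclidean_space set \<Rightarrow> 'a \<Rightarrow> 'a \<Rightarrow> real \<Rightarrow> real \<Rightarrow> bool" where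
  "inward \<Omega> p e r c \<longleftrightarrow> norm e \<le> 1 \<and> 0 < r \<and> 0 < c \<and> c \<le> 1 \<and>
     (\<forall>t x y. 0 < t \<longrightarrow> t < r \<longrightarrow> x \<in> \<Omega> \<longrightarrow> y \<in> ball p r \<longrightarrow> norm (y - (x + t *\<^sub>R e)) \<le> c * t \<longrightarrow> y \<in> \<Omega>)"

text \<open>Moving by t e raises the height by t and leaves the base point fixed. A further
  displacement w costs at most its norm in height and raises the graph by at most 2 L times its
  norm.\<close>

lemma lipschitz_boundary_inward:
  fixes \<Omega> :: "'a::euclidean_space set"
  assumes "open \<Omega>" "lipschitz_boundary \<Omega>" "p \<in> closure \<Omega>"
  shows "\<exists>e r c. inward \<Omega> p e r c"
proof (cases "p \<in> \<Omega>")
  case True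
  then obtain r where "r > 0" "ball p r \<subseteq> \<Omega>" using \<open>open \<Omega>\<close> openE by blast
  then have "inward \<Omega> p 0 r 1" by (auto simp: inward_def)
  then show ?thesis by blast
next
  case False
  then have "p \<in> frontier \<Omega>" using assms by (simp add: frontier_def interior_open)
  then obtain R e g L where R: "R > 0" and e: "norm e = 1" and g: "L-lipschitz_on {y. y \<bullet> e = 0} g"
    and \<Omega>: "\<Omega> \<inter> ball p R = {x \<in> ball p R. x \<bullet> e > g (x - (x \<bullet> e) *\<^sub>R e)}"
    using assms(2)[unfolded lipschitz_boundary_def, rule_format, OF \<open>p \<in> frontier \<Omega>\<close>]
    by (elim exE conjE) blast
  have L: "L \<ge> 0" using g lipschitz_on_nonneg by blast
  define P where "P x = x - (x \<bullet> e) *\<^sub>R e" for x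
  have ee: "e \<bullet> e = 1" using e by (simp add: norm_eq_1)
  have P: "P x \<bullet> e = 0" for x by (simp add: P_def inner_diff_left ee)
  \<comment> \<open>The total loss (1 + 2 L) |w| must not exceed the gain t. The 2 comes from the
    crude bound of the projection of w by twice its norm.\<close>
  define c where "c = 1 / (1 + 2 * L)"
  have c: "0 < c" "c \<le> 1" using L by (auto simp: c_def)
  \<comment> \<open>The distances from p to y, along t e, and along w are each less than R / 3, so x
    also lies in the chart ball of radius R.\<close>
  have "y \<in> \<Omega>" if "0 < t" "t < R / 3" "x \<in> \<Omega>" "y \<in> ball p (R / 3)" "norm (y - (x + t *\<^sub>R e)) \<le> c * t" for t x y
  proof -
    define w where "w = y - (x + t *\<^sub>R e)"
    have y: "y = x + t *\<^sub>R e + w" by (simp add: w_def)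
    have w: "norm w \<le> c * t" using that by (simp add: w_def)
    then have "norm w \<le> t" using c that by (smt (verit) mult_left_le_one_le)
    moreover have "norm (p - x) \<le> norm (p - y) + norm (t *\<^sub>R e) + norm w"
      using norm_triangle_ineq[of "p - y" "t *\<^sub>R e + w"] norm_triangle_ineq[of "t *\<^sub>R e" w] by (simp add: y)
    ultimately have "x \<in> ball p R" using that e by (simp add: dist_norm)
    then have 1: "x \<bullet> e > g (P x)" using \<Omega> \<open>x \<in> \<Omega>\<close> unfolding P_def by blast
    have "P y - P x = w - (w \<bullet> e) *\<^sub>R e" by (simp add: P_def y inner_add_left ee algebra_simps)
    then have "norm (P y - P x) \<le> norm w + \<bar>w \<bullet> e\<bar>"
      using norm_triangle_ineq4[of w "(w \<bullet> e) *\<^sub>R e"] e by simp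
    moreover have we: "\<bar>w \<bullet> e\<bar> \<le> norm w" using Cauchy_Schwarz_ineq2[of w e] e by simp
    ultimately have "L * norm (P y - P x) \<le> L * (2 * norm w)" using L by (intro mult_left_mono) auto
    moreover have "\<bar>g (P y) - g (P x)\<bar> \<le> L * norm (P y - P x)"
      using lipschitz_onD[OF g, of "P y" "P x"] P by (simp add: dist_norm)
    ultimately have 2: "g (P y) \<le> g (P x) + L * (2 * norm w)" by linarith
    have "(1 + 2 * L) * norm w \<le> t"
      using w L by (simp add: c_def field_simps)
    then have "norm w + L * (2 * norm w) \<le> t" by (simp add: algebra_simps)
    moreover have "y \<bullet> e = x \<bullet> e + t + w \<bullet> e" by (simp add: y inner_add_left ee)
    ultimately have "y \<bullet> e > g (P y)" using 1 2 we by linarith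
    moreover have "y \<in> ball p R" using that R by auto
    ultimately show ?thesis using \<Omega> unfolding P_def by blast
  qed
  then have "inward \<Omega> p e (R / 3) c" using e R c by (simp add: inward_def)
  then show ?thesis by blast
qed

text \<open>Mollifying the indicators of a measurable partition yields a smooth partition of unity.\<close>

lemma smooth_partition_of_unity:
  fixes K :: "'a::euclidean_space set"
  assumes "compact K" and r: "\<forall>p\<in>K. 0 < r p"
  shows "\<exists>N p \<zeta>. (\<forall>i<N::nat. p i \<in> K \<and> bump (\<zeta> i :: 'a \<Rightarrow> real) \<and> (\<forall>x. 0 \<le> \<zeta> i x) \<and>
      (\<forall>x. \<zeta> i x \<noteq> 0 \<longrightarrow> dist (p i) x \<le> 3 / 4 * r (p i))) \<and>
    (\<forall>x. (\<Sum>i<N. \<zeta> i x) \<le> 1) \<and> (\<forall>x\<in>K. (\<Sum>i<N. \<zeta> i x) = 1)"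
proof -
  have "K \<subseteq> (\<Union>p\<in>K. ball p (r p / 2))" using r by force
  then obtain I where I: "I \<subseteq> K" "finite I" "K \<subseteq> (\<Union>p\<in>I. ball p (r p / 2))"
    using compactE_image[OF \<open>compact K\<close>, of K "\<lambda>p. ball p (r p / 2)"] by auto
  obtain N and p :: "nat \<Rightarrow> 'a" where Np: "I = p ` {i. i < N}"
    using finite_imp_nat_seg_image_inj_on[OF I(2)] by blast
  \<comment> \<open>Half of each radius goes to the cover and a quarter to the mollification; the
    last quarter is left for taking the closure of a support.\<close>
  define B where "B i = ball (p i) (r (p i) / 2)" for i
  define A where "A = disjointed B"
  have pK: "p i \<in> K" if "i < N" for i using I(1) Np that by auto
  have AB: "A i \<subseteq> B i" for i using disjointed_subset[of B i] by (simp add: A_def)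
  have A_sets: "A i \<in> sets borel" for i
    using sets.range_disjointed_sets[of B borel] by (force simp: A_def B_def)
  define W where "W = (\<Union>i<N. B i)"
  have W: "open W" "K \<subseteq> W" using I Np by (auto simp: W_def B_def)
  have WA: "W = (\<Union>i<N. A i)"
    using finite_UN_disjointed_eq[of B N] by (simp add: W_def A_def atLeast0LessThan)
  \<comment> \<open>A neighbourhood of \<open>K\<close> of this width lies in \<open>W\<close>, so
    mollifying the indicator of \<open>W\<close> at a smaller radius gives exactly 1 on
    \<open>K\<close>. Exactness is what lets the gradients of the partition cancel.\<close>
  obtain d1 where d1: "d1 > 0" and "(\<Union>x\<in>K. ball x d1) \<subseteq> W"
    using compact_subset_open_imp_ball_epsilon_subset[OF \<open>compact K\<close> W] .
  then have ball_W: "ball x d1 \<subseteq> W" if "x \<in> K" for x using that by blast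
  obtain d2 where d2: "d2 > 0" "\<And>i. i < N \<Longrightarrow> d2 \<le> r (p i) / 4"
    using finite_positive_lower_bound[of N "\<lambda>i. r (p i) / 4"] r pK by auto
  define d where "d = min d1 d2"
  have "d > 0" using d1 d2 by (simp add: d_def)
  then obtain m :: "'a \<Rightarrow> real" where m: "mollifier d m" using mollifier_exists by blast
  define \<zeta> where "\<zeta> i = conv m (indicator (A i) :: 'a \<Rightarrow> real)" for i
  have m_meas[measurable]: "m \<in> borel_measurable borel" using m mollifier_bump bump_measurable by blast
  have int: "integrable lborel (indicator (A i) :: 'a \<Rightarrow> real)" for i
  proof -
    have "bounded (A i)" using AB[of i] bounded_ball bounded_subset unfolding B_def by blast
    then show ?thesis using A_sets emeasure_bounded_finite by (simp add: integrable_indicator_iff)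
  qed
  have near: "dist (p i) x \<le> 3 / 4 * r (p i)" if i: "i < N" and nz: "\<zeta> i x \<noteq> 0" for i x
  proof -
    obtain y where y: "y \<in> A i" "m (x - y) \<noteq> 0"
      using conv_nonzero[OF nz[unfolded \<zeta>_def]] by (metis indicator_simps(2))
    then have "dist (p i) y < r (p i) / 2" using AB[of i] by (auto simp: B_def)
    moreover have "dist y x < d" using m y(2) by (auto simp: mollifier_def dist_norm norm_minus_commute)
    ultimately show ?thesis using d2(2)[OF i] dist_triangle[of "p i" x y] by (simp add: d_def)
  qed
  have bump: "bump (\<zeta> i)" if "i < N" for i
  proof -
    have "norm x \<le> norm (p i) + 3 / 4 * r (p i)" if "\<zeta> i x \<noteq> 0" for x
      using near[OF \<open>i < N\<close> that] norm_triangle_ineq3[of x "p i"] by (simp add: dist_norm norm_minus_commute)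
    then show ?thesis
      unfolding bump_def using C_inf_conv[OF mollifier_bump[OF m] int[of i]] unfolding \<zeta>_def by blast
  qed
  have nonneg: "0 \<le> \<zeta> i x" for i x
    unfolding \<zeta>_def conv_def using m by (intro integral_nonneg_AE AE_I2) (auto simp: mollifier_def)
  have sum_eq: "(\<Sum>i<N. \<zeta> i x) = conv m (indicator W :: 'a \<Rightarrow> real) x" for x
  proof -
    have "disjoint_family A" by (simp add: A_def disjoint_family_disjointed)
    then have "disjoint_family_on A {..<N}" by (auto simp: disjoint_family_on_def)
    then have "indicator W y = (\<Sum>i<N. indicator (A i) y :: real)" for y
      unfolding WA by (intro indicator_UN_disjoint) auto
    then have "conv m (indicator W :: 'a \<Rightarrow> real) x = (LINT y|lborel. (\<Sum>i<N. m (x - y) *\<^sub>R indicator (A i) y))"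
      by (simp add: conv_def sum_distrib_left)
    also have "\<dots> = (\<Sum>i<N. \<zeta> i x)"
      unfolding \<zeta>_def conv_def
      using integrable_conv[OF mollifier_bump[OF m] int, of x] by (intro Bochner_Integration.integral_sum) auto
    finally show ?thesis by simp
  qed
  have le: "(\<Sum>i<N. \<zeta> i x) \<le> 1" for x
  proof -
    have "norm (conv m (indicator W :: 'a \<Rightarrow> real) x) \<le> 1"
      using W by (intro norm_conv_le_1[OF m]) (auto simp: indicator_def)
    then show ?thesis using sum_eq[of x] by simp
  qed
  have one: "(\<Sum>i<N. \<zeta> i x) = 1" if "x \<in> K" for x
  proof -
    have "m (x - y) *\<^sub>R indicator W y = m (x - y)" for y
    proof (cases "m (x - y) = 0")
      case False
      then have "dist x y < d1" using m by (auto simp: mollifier_def dist_norm d_def)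
      then show ?thesis using ball_W[OF that] by (auto simp: indicator_def)
    qed simp
    then have "conv m (indicator W) x = (LINT y|lborel. m (x - y))"
      unfolding conv_def by (intro Bochner_Integration.integral_cong) auto
    also have "\<dots> = 1" using integral_reflect[of m x] m by (auto simp: mollifier_def)
    finally show ?thesis using sum_eq by simp
  qed
  show ?thesis
    by (intro exI[of _ N] exI[of _ p] exI[of _ \<zeta>]) (use pK bump nonneg near le one in auto)
qed

section \<open>Recovery of the total variation by smooth functions\<close>

definition gradient :: "('a::euclidean_space \<Rightarrow> real) \<Rightarrow> 'a \<Rightarrow> 'a" where
  "gradient f x = (\<Sum>b\<in>Basis. partial b f x *\<^sub>R b)"

lemma bump_gradient:
  assumes "bump f"
  shows "bump (gradient f)"
proof (rule bump_if_derivative_zero[OF assms])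
  show "C_inf (gradient f)"
    unfolding gradient_def
    using assms by (intro C_inf_sum C_inf_bounded_linear[OF bounded_linear_scaleR_left] C_inf_partial) (auto simp: bump_def)
qed (simp add: gradient_def)

lemma integrable_scaleR_bounded:
  fixes k :: "'a::euclidean_space \<Rightarrow> 'b::euclidean_space"
  assumes "integrable lborel U" "k \<in> borel_measurable borel" "\<And>x. norm (k x) \<le> B"
  shows "integrable lborel (\<lambda>x. U x *\<^sub>R k x)"
proof (rule Bochner_Integration.integrable_bound[of _ "\<lambda>x. B * norm (U x)"])
  have "norm (U x *\<^sub>R k x) \<le> B * norm (U x)" for x
    using mult_left_mono[OF assms(3)[of x] norm_ge_zero[of "U x"]] by (simp add: mult.commute)
  then show "AE x in lborel. norm (U x *\<^sub>R k x) \<le> norm (B * norm (U x))"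
    by (intro AE_I2) (auto intro: order_trans[OF _ abs_ge_self])
qed (use assms in auto)

lemma integrable_inner_bounded:
  fixes W k :: "'a::euclidean_space \<Rightarrow> 'b::euclidean_space"
  assumes "integrable lborel W" "k \<in> borel_measurable borel" "\<And>x. norm (k x) \<le> B"
  shows "integrable lborel (\<lambda>x. W x \<bullet> k x)"
proof (rule Bochner_Integration.integrable_bound[of _ "\<lambda>x. B * norm (W x)"])
  have "norm (W x \<bullet> k x) \<le> B * norm (W x)" for x
    using mult_left_mono[OF assms(3)[of x] norm_ge_zero[of "W x"]] Cauchy_Schwarz_ineq2[of "W x" "k x"]
    by (simp add: mult.commute)
  then show "AE x in lborel. norm (W x \<bullet> k x) \<le> norm (B * norm (W x))"
    by (intro AE_I2) (auto intro: order_trans[OF _ abs_ge_self])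
qed (use assms in auto)

lemma conv_bounded:
  assumes k: "bump k" and G: "integrable lborel G"
  shows "\<exists>B\<ge>0. \<forall>z. norm (conv k G z) \<le> B"
proof -
  obtain B where B: "B \<ge> 0" "\<And>x. \<bar>k x\<bar> \<le> B" using bump_bounded[OF k] by auto
  have "norm (conv k G z) \<le> B * (LINT x|lborel. norm (G x))" for z
  proof -
    have "norm (conv k G z) \<le> (LINT x|lborel. norm (k (z - x) *\<^sub>R G x))"
      unfolding conv_def by (rule integral_norm_bound)
    also have "\<dots> \<le> (LINT x|lborel. B * norm (G x))"
      using B G integrable_norm[OF integrable_conv[OF k G]]
      by (intro integral_mono) (auto intro!: mult_right_mono)
    finally show ?thesis by simp
  qed
  moreover have "B * (LINT x|lborel. norm (G x)) \<ge> 0" using B by simp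
  ultimately show ?thesis by blast
qed

lemma bump_reflect:
  assumes "bump (v :: 'a::euclidean_space \<Rightarrow> real)"
  shows "bump (\<lambda>x. v (- x))"
    and "partial b (\<lambda>x. v (- x)) x = - partial b v (- x)"
proof -
  have D: "((\<lambda>x. f (- x)) has_derivative (\<lambda>h. - frechet_derivative f (at (- x)) h)) (at x)"
    if f: "C_inf f" for f :: "'a \<Rightarrow> real" and x
  proof -
    have "((\<lambda>x. f (- x)) has_derivative (\<lambda>h. frechet_derivative f (at (- x)) (- h))) (at x)"
      by (rule has_derivative_compose[of uminus uminus x UNIV f, simplified])
        (auto intro!: derivative_eq_intros C_inf_has_derivative[OF f])
    moreover have "frechet_derivative f (at (- x)) (- h) = - frechet_derivative f (at (- x)) h" for h
      using C_inf_has_derivative[OF f, of "- x"]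
      by (intro linear_neg bounded_linear.linear has_derivative_bounded_linear)
    ultimately show ?thesis by simp
  qed
  have v: "C_inf v" using assms by (simp add: bump_def)
  have "C_inf (\<lambda>x. v (- x))"
  proof (rule C_inf_coinduct[where S = "{\<lambda>x. f (- x) | f. C_inf f}"])
    show "(\<lambda>x. v (- x)) \<in> {\<lambda>x. f (- x) | f. C_inf f}" using v by blast
    show "f differentiable at x" if "f \<in> {\<lambda>x. f (- x) | f. C_inf f}" for f :: "'a \<Rightarrow> real" and x
      using that D unfolding differentiable_def by blast
    show "partial b f \<in> {\<lambda>x. f (- x) | f. C_inf f}" if f: "f \<in> {\<lambda>x. f (- x) | f. C_inf f}" and b: "b \<in> Basis"
      for f :: "'a \<Rightarrow> real" and b
    proof -
      obtain f' where f': "f = (\<lambda>x. f' (- x))" "C_inf f'" using f by blast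
      have "C_inf (\<lambda>x. - partial b f' x)"
        by (intro C_inf_bounded_linear[OF bounded_linear_minus[OF bounded_linear_ident]] C_inf_partial f' b)
      moreover have "partial b f = (\<lambda>x. - partial b f' (- x))"
        using frechet_derivative_eq[OF D[OF f'(2)]] f'(1) by auto
      ultimately show ?thesis
        by (intro CollectI exI[of _ "\<lambda>x. - partial b f' x"] conjI)
    qed
  qed
  moreover obtain R where "\<And>x. v x \<noteq> 0 \<Longrightarrow> norm x \<le> R" using assms by (auto simp: bump_def)
  then have "\<And>x. v (- x) \<noteq> 0 \<Longrightarrow> norm x \<le> R" by fastforce
  ultimately show "bump (\<lambda>x. v (- x))" by (auto simp: bump_def)
  show "partial b (\<lambda>x. v (- x)) x = - partial b v (- x)"
    using frechet_derivative_eq[OF D[OF v]] by simp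
qed

lemma inner_sgn_self: "x \<bullet> sgn x = norm x"
  by (cases "x = 0") (simp_all add: sgn_div_norm dot_square_norm power2_eq_square)

lemma gradient_inner: "gradient f x \<bullet> h = (\<Sum>b\<in>Basis. partial b f x * (h \<bullet> b))"
  by (simp add: gradient_def inner_sum_left) (simp add: inner_commute)

section \<open>Duality for the gradient of the recovery function\<close>

text \<open>The scale, the partition and the mollifier are frozen here, so that the final estimate
  carries an explicit error term. The radius \<epsilon> lies strictly below every margin c i * t;
  the difference provides compact support.\<close>

locale recovery =
  fixes \<Omega> :: "'a::euclidean_space set" and U m :: "'a \<Rightarrow> real" and N :: nat
    and p e :: "nat \<Rightarrow> 'a" and r c :: "nat \<Rightarrow> real" and \<zeta> :: "nat \<Rightarrow> 'a \<Rightarrow> real" and t \<epsilon> :: real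
  assumes \<Omega>: "open \<Omega>" "bounded \<Omega>"
    and U_int: "integrable lborel U" and U_zero: "\<And>x. x \<notin> \<Omega> \<Longrightarrow> U x = 0"
    and inw: "\<And>i. i < N \<Longrightarrow> inward \<Omega> (p i) (e i) (r i) (c i)"
    and \<zeta>_bump: "\<And>i. i < N \<Longrightarrow> bump (\<zeta> i)" and \<zeta>_nonneg: "\<And>i x. i < N \<Longrightarrow> 0 \<le> \<zeta> i x"
    and \<zeta>_near: "\<And>i x. i < N \<Longrightarrow> \<zeta> i x \<noteq> 0 \<Longrightarrow> dist (p i) x \<le> 3 / 4 * r i"
    and \<zeta>_le: "\<And>x. (\<Sum>i<N. \<zeta> i x) \<le> 1" and \<zeta>_one: "\<And>x. x \<in> \<Omega> \<Longrightarrow> (\<Sum>i<N. \<zeta> i x) = 1"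
    and t: "0 < t" "\<And>i. i < N \<Longrightarrow> t < r i" and \<epsilon>: "\<And>i. i < N \<Longrightarrow> \<epsilon> < c i * t"
    and m: "mollifier \<epsilon> m"
begin

text \<open>The recovery function is \<open>conv m V\<close>. The field \<open>\<phi>\<close> is the
  direction of its gradient, cut off to \<Omega>; \<open>\<Psi>\<close> is the adjoint of the map
  from \<open>U\<close> to \<open>conv m V\<close>, applied to \<open>\<phi>\<close>; and
  \<open>W\<close> is what remains when the divergence of \<open>\<Psi>\<close> hits the cut-off
  functions.\<close>

definition "V y = (\<Sum>i<N. \<zeta> i (y + t *\<^sub>R e i) * U (y + t *\<^sub>R e i))"
definition "\<phi> x = indicator \<Omega> x *\<^sub>R sgn (gradient (conv m V) x)"
definition "\<Psi> y = (\<Sum>i<N. \<zeta> i y *\<^sub>R conv m \<phi> (y - t *\<^sub>R e i))"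
definition "W i y = U y *\<^sub>R gradient (\<zeta> i) y"

lemma m_bump: "bump m"
  using m mollifier_bump by blast

lemma \<zeta>U_int: "i < N \<Longrightarrow> integrable lborel (\<lambda>y. \<zeta> i y * U y)"
  using bump_bounded[OF \<zeta>_bump[of i]] integrable_bounded_mult[OF bump_measurable[OF \<zeta>_bump[of i]] _ U_int]
  by auto

lemma V_int: "integrable lborel V"
  unfolding V_def
  by (intro Bochner_Integration.integrable_sum integrable_translate[of "\<lambda>y. \<zeta> i y * U y" for i] \<zeta>U_int) auto

lemma W_int: "i < N \<Longrightarrow> integrable lborel (W i)"
  unfolding W_def
  using bump_bounded[OF bump_gradient[OF \<zeta>_bump[of i]]] bump_measurable[OF bump_gradient[OF \<zeta>_bump[of i]]]
  by (auto intro: integrable_scaleR_bounded[OF U_int])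

lemma C_inf_v: "C_inf (conv m V)"
  using C_inf_conv[OF m_bump V_int] .

lemma gradient_v_measurable: "gradient (conv m V) \<in> borel_measurable borel"
proof -
  have "C_inf (gradient (conv m V))"
    unfolding gradient_def
    by (intro C_inf_sum C_inf_bounded_linear[OF bounded_linear_scaleR_left] C_inf_partial C_inf_v)
  then show ?thesis by (rule C_inf_measurable)
qed

lemma \<phi>_measurable: "\<phi> \<in> borel_measurable borel"
proof -
  note [measurable] = gradient_v_measurable
  have [measurable]: "\<Omega> \<in> sets borel" using \<Omega> by simp
  have "(\<lambda>x. indicator \<Omega> x *\<^sub>R (gradient (conv m V) x /\<^sub>R norm (gradient (conv m V) x))) \<in> borel_measurable borel"
    by measurable
  then show ?thesis by (simp add: \<phi>_def[abs_def] sgn_div_norm)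
qed

lemma \<phi>_norm: "norm (\<phi> x) \<le> indicator \<Omega> x"
  by (auto simp: \<phi>_def indicator_def norm_sgn)

lemma \<phi>_int: "integrable lborel \<phi>"
proof (rule Bochner_Integration.integrable_bound)
  show "integrable lborel (indicator \<Omega> :: 'a \<Rightarrow> real)"
    using \<Omega> emeasure_bounded_finite by (simp add: integrable_indicator_iff)
  show "AE x in lborel. norm (\<phi> x) \<le> norm (indicator \<Omega> x :: real)"
    using \<phi>_norm by (auto intro: order_trans[OF _ abs_ge_self])
qed (use \<phi>_measurable in auto)

lemma C_inf_mollified_\<phi>: "C_inf (conv m \<phi>)"
  using C_inf_conv[OF m_bump \<phi>_int] .

lemma mollified_\<phi>_norm: "norm (conv m \<phi> x) \<le> 1"
  by (rule norm_conv_le_1[OF m \<phi>_measurable])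
    (use \<phi>_norm in \<open>auto intro: order_trans[OF _ indicator_le_1]\<close>)

lemma \<Psi>_norm: "norm (\<Psi> x) \<le> 1"
proof -
  have "norm (\<Psi> x) \<le> (\<Sum>i<N. norm (\<zeta> i x *\<^sub>R conv m \<phi> (x - t *\<^sub>R e i)))"
    unfolding \<Psi>_def by (rule norm_sum)
  also have "\<dots> \<le> (\<Sum>i<N. \<zeta> i x)"
    using \<zeta>_nonneg mollified_\<phi>_norm by (intro sum_mono) (auto intro: mult_left_le)
  finally show ?thesis using \<zeta>_le[of x] by simp
qed

text \<open>A point where the i-th summand is nonzero lies within \<epsilon> of x + t e_i for some x
  in \<Omega>, and near p_i, so the inward condition puts it in \<Omega>. A finite union handles the
  sum.\<close>

lemma \<Psi>_test: "\<Psi> \<in> test_functions \<Omega>"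
proof -
  define T where "T i = {y. \<zeta> i y \<noteq> 0 \<and> conv m \<phi> (y - t *\<^sub>R e i) \<noteq> 0}" for i
  have sub: "{y. \<Psi> y \<noteq> 0} \<subseteq> (\<Union>i<N. T i)"
  proof clarify
    fix y assume "\<Psi> y \<noteq> 0"
    then obtain i where "i \<in> {..<N}" "\<zeta> i y *\<^sub>R conv m \<phi> (y - t *\<^sub>R e i) \<noteq> 0"
      unfolding \<Psi>_def by (rule sum.not_neutral_contains_not_neutral)
    then show "y \<in> (\<Union>i<N. T i)" by (auto simp: T_def)
  qed
  have clT: "closure (T i) \<subseteq> \<Omega>" if i: "i < N" for i
  proof
    fix y assume "y \<in> closure (T i)"
    \<comment> \<open>The slack in both constraints: a limit point this close to the support still
      satisfies the hypotheses of the inward condition. Hence the closure, and not just the support,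
      lies in \<Omega>.\<close>
    moreover have pos: "min (r i / 4) (c i * t - \<epsilon>) > 0"
      using inw[OF i] \<epsilon>[OF i] by (simp add: inward_def)
    ultimately obtain y' where y': "y' \<in> T i" "dist y' y < min (r i / 4) (c i * t - \<epsilon>)"
      by (meson closure_approachable)
    then obtain x where x: "\<phi> x \<noteq> 0" "m (y' - t *\<^sub>R e i - x) \<noteq> 0"
      using conv_nonzero[of m \<phi> "y' - t *\<^sub>R e i"] by (auto simp: T_def)
    have "x \<in> \<Omega>" using x(1) by (auto simp: \<phi>_def indicator_def split: if_splits)
    have "norm (y' - t *\<^sub>R e i - x) < \<epsilon>" using m x(2) by (simp add: mollifier_def)
    moreover have "norm (y - (x + t *\<^sub>R e i)) \<le> norm (y - y') + norm (y' - t *\<^sub>R e i - x)"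
      using norm_triangle_ineq[of "y - y'" "y' - t *\<^sub>R e i - x"] by (simp add: algebra_simps)
    moreover have "norm (y - y') < c i * t - \<epsilon>" using y'(2) by (simp add: dist_norm norm_minus_commute)
    ultimately have "norm (y - (x + t *\<^sub>R e i)) \<le> c i * t" by linarith
    moreover have "y \<in> ball (p i) (r i)"
      using \<zeta>_near[OF i, of y'] y' dist_triangle[of "p i" y y'] by (simp add: T_def)
    ultimately show "y \<in> \<Omega>" using inw[OF i] t(1) t(2)[OF i] \<open>x \<in> \<Omega>\<close> by (auto simp: inward_def)
  qed
  have "closure {y. \<Psi> y \<noteq> 0} \<subseteq> closure (\<Union>i<N. T i)" using sub by (rule closure_mono)
  also have "\<dots> \<subseteq> (\<Union>i<N. closure (T i))"
    by (intro closure_minimal closed_UN) (use closure_subset in auto)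
  also have "\<dots> \<subseteq> \<Omega>" using clT by blast
  finally have cl: "closure {y. \<Psi> y \<noteq> 0} \<subseteq> \<Omega>" .
  then have "bounded (closure {y. \<Psi> y \<noteq> 0})" using \<Omega> bounded_subset by blast
  then have "compact (closure {y. \<Psi> y \<noteq> 0})" by (simp add: compact_eq_bounded_closed)
  moreover have "C_inf \<Psi>"
    unfolding \<Psi>_def
    using \<zeta>_bump C_inf_translate[OF C_inf_mollified_\<phi>, of "- (t *\<^sub>R e i)" for i]
    by (intro C_inf_sum C_inf_scaleR) (auto simp: bump_def)
  ultimately show ?thesis using cl by (simp add: test_functions_def C_inf_def)
qed

lemma divergence_\<Psi>:
  "divergence \<Psi> y = (\<Sum>i<N. \<zeta> i y * divergence (conv m \<phi>) (y - t *\<^sub>R e i)) +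
     (\<Sum>i<N. gradient (\<zeta> i) y \<bullet> conv m \<phi> (y - t *\<^sub>R e i))"
proof -
  let ?f = "conv m \<phi>"
  have "(\<Psi> has_derivative (\<lambda>h. \<Sum>i<N. \<zeta> i y *\<^sub>R frechet_derivative ?f (at (y - t *\<^sub>R e i)) h +
      frechet_derivative (\<zeta> i) (at y) h *\<^sub>R ?f (y - t *\<^sub>R e i))) (at y)"
    unfolding \<Psi>_def
    using \<zeta>_bump has_derivative_translate[where x = y and a = "- (t *\<^sub>R e i)" for i, OF C_inf_has_derivative[OF C_inf_mollified_\<phi>]]
    by (intro has_derivative_sum has_derivative_scaleR C_inf_has_derivative) (auto simp: bump_def)
  from frechet_derivative_eq[OF this]
  have "divergence \<Psi> y = (\<Sum>b\<in>Basis. \<Sum>i<N. \<zeta> i y * (partial b ?f (y - t *\<^sub>R e i) \<bullet> b) +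
      partial b (\<zeta> i) y * (?f (y - t *\<^sub>R e i) \<bullet> b))"
    by (simp add: divergence_def inner_sum_left inner_add_left)
  also have "\<dots> = (\<Sum>i<N. \<Sum>b\<in>Basis. \<zeta> i y * (partial b ?f (y - t *\<^sub>R e i) \<bullet> b) +
      partial b (\<zeta> i) y * (?f (y - t *\<^sub>R e i) \<bullet> b))"
    by (rule sum.swap)
  also have "\<dots> = (\<Sum>i<N. \<zeta> i y * divergence ?f (y - t *\<^sub>R e i)) + (\<Sum>i<N. gradient (\<zeta> i) y \<bullet> ?f (y - t *\<^sub>R e i))"
    by (simp add: sum.distrib divergence_def sum_distrib_left gradient_inner)
  finally show ?thesis .
qed

lemma sum_W: "(\<Sum>i<N. W i x) = 0"
proof (cases "x \<in> \<Omega>")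
  case True
  have "((\<lambda>x. \<Sum>i<N. \<zeta> i x) has_derivative (\<lambda>h. \<Sum>i<N. frechet_derivative (\<zeta> i) (at x) h)) (at x)"
    using \<zeta>_bump by (intro has_derivative_sum C_inf_has_derivative) (auto simp: bump_def)
  moreover have "((\<lambda>x. \<Sum>i<N. \<zeta> i x) has_derivative (\<lambda>h. 0)) (at x)"
    by (rule has_derivative_transform_within_open[OF has_derivative_const[of 1] \<Omega>(1) True])
      (simp add: \<zeta>_one)
  ultimately have 0: "(\<Sum>i<N. frechet_derivative (\<zeta> i) (at x) h) = 0" for h
    using has_derivative_unique by (metis (no_types, lifting))
  have "(\<Sum>i<N. W i x) = U x *\<^sub>R (\<Sum>b\<in>Basis. (\<Sum>i<N. partial b (\<zeta> i) x) *\<^sub>R b)"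
    unfolding W_def gradient_def scaleR_sum_right[symmetric] scaleR_sum_left
    by (subst sum.swap) simp
  then show ?thesis by (simp add: 0)
next
  case False
  then show ?thesis by (simp add: W_def U_zero)
qed

lemma div_mollified_bounded: "\<exists>B. \<forall>y. \<bar>divergence (conv m \<phi>) y\<bar> \<le> B"
proof -
  have "\<exists>B\<ge>0. \<forall>y. norm (partial b (conv m \<phi>) y) \<le> B" if "b \<in> Basis" for b
    using conv_bounded[OF bump_partial[OF m_bump that] \<phi>_int] fun_cong[OF partial_conv[OF m_bump \<phi>_int that]] by simp
  then obtain B where B: "\<And>b y. b \<in> Basis \<Longrightarrow> norm (partial b (conv m \<phi>) y) \<le> B b" by metis
  have "\<bar>divergence (conv m \<phi>) y\<bar> \<le> (\<Sum>b\<in>Basis. B b)" for y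
    unfolding divergence_def
  proof (rule order_trans[OF sum_abs sum_mono])
    fix b :: 'a assume b: "b \<in> Basis"
    show "\<bar>partial b (conv m \<phi>) y \<bullet> b\<bar> \<le> B b"
      using Basis_le_norm[OF b, of "partial b (conv m \<phi>) y"] B[OF b, of y] by linarith
  qed
  then show ?thesis by blast
qed

lemma div_mollified_measurable: "divergence (conv m \<phi>) \<in> borel_measurable borel"
proof -
  have "C_inf (divergence (conv m \<phi>))"
    unfolding divergence_def
    by (intro C_inf_sum C_inf_bounded_linear[OF bounded_linear_inner_left] C_inf_partial C_inf_mollified_\<phi>)
  then show ?thesis by (rule C_inf_measurable)
qed

lemma integrable_mult_div:
  assumes "integrable lborel G"
  shows "integrable lborel (\<lambda>y. G y * divergence (conv m \<phi>) (y + a) :: real)"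
proof -
  obtain B where B: "\<And>y. \<bar>divergence (conv m \<phi>) y\<bar> \<le> B" using div_mollified_bounded by blast
  show ?thesis
    using integrable_scaleR_bounded[OF assms, of "\<lambda>y. divergence (conv m \<phi>) (y + a)" B] B
      measurable_compose[OF _ div_mollified_measurable, of "\<lambda>y. y + a"] by simp
qed

text \<open>Paired with its own direction the gradient gives its norm; derivative and mollifier then
  pass from \<open>V\<close> to \<open>\<phi>\<close> by adjointness, component by
  component.\<close>

lemma integral_norm_gradient_eq:
  "integrable lborel (\<lambda>x. indicator \<Omega> x * norm (gradient (conv m V) x))"
  "(LINT x|lborel. indicator \<Omega> x * norm (gradient (conv m V) x)) =
     - (LINT y|lborel. V y * divergence (conv m \<phi>) y)"
proof -
  \<comment> \<open>The partial derivatives of an even function are odd; this is the source of the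
    minus sign in the duality.\<close>
  have even: "partial b m (- z) = - partial b m z" for b z
    using bump_reflect(2)[OF m_bump, where b = b and x = z] m by (simp add: mollifier_def)
  have pw: "indicator \<Omega> x * norm (gradient (conv m V) x) =
      (\<Sum>b\<in>Basis. conv (partial b m) V x * (\<phi> x \<bullet> b))" for x
  proof -
    have "indicator \<Omega> x * norm (gradient (conv m V) x) = gradient (conv m V) x \<bullet> \<phi> x"
      by (simp add: \<phi>_def inner_sgn_self)
    also have "\<dots> = (\<Sum>b\<in>Basis. conv (partial b m) V x * (\<phi> x \<bullet> b))"
      unfolding gradient_inner by (intro sum.cong) (simp_all add: fun_cong[OF partial_conv[OF m_bump V_int]])
    finally show ?thesis .
  qed
  have \<phi>b_int: "integrable lborel (\<lambda>x. \<phi> x \<bullet> b)" for b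
    using \<phi>_int by simp
  have i: "integrable lborel (\<lambda>x. conv (partial b m) V x * (\<phi> x \<bullet> b))" if b: "b \<in> Basis" for b
  proof -
    have bp: "bump (partial b m)" using bump_partial[OF m_bump b] .
    obtain B where "\<And>x. \<bar>conv (partial b m) V x\<bar> \<le> B" using conv_bounded[OF bp V_int] by auto
    then show ?thesis
      using integrable_bounded_mult[OF C_inf_measurable[OF C_inf_conv[OF bp V_int]] _ \<phi>b_int[of b]] by auto
  qed
  show "integrable lborel (\<lambda>x. indicator \<Omega> x * norm (gradient (conv m V) x))"
    unfolding pw using i by auto
  have adj: "(LINT x|lborel. conv (partial b m) V x * (\<phi> x \<bullet> b)) =
      - (LINT y|lborel. V y * (partial b (conv m \<phi>) y \<bullet> b))" if b: "b \<in> Basis" for b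
  proof -
    have bp: "bump (partial b m)" using bump_partial[OF m_bump b] .
    have "conv (\<lambda>z. partial b m (- z)) (\<lambda>x. \<phi> x \<bullet> b) y = - (partial b (conv m \<phi>) y \<bullet> b)" for y
    proof -
      have "partial b (conv m \<phi>) y \<bullet> b = (LINT x|lborel. (partial b m (y - x) *\<^sub>R \<phi> x) \<bullet> b)"
        unfolding fun_cong[OF partial_conv[OF m_bump \<phi>_int b]] conv_def
        by (rule integral_inner_left[symmetric]) (rule integrable_conv[OF bp \<phi>_int])
      moreover have "conv (\<lambda>z. partial b m (- z)) (\<lambda>x. \<phi> x \<bullet> b) y =
          (LINT x|lborel. - ((partial b m (y - x) *\<^sub>R \<phi> x) \<bullet> b))"
        unfolding conv_def even by simp
      ultimately show ?thesis by simp
    qed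
    then show ?thesis using conv_adjoint[OF bp V_int \<phi>b_int[of b]] by simp
  qed
  have i2: "integrable lborel (\<lambda>y. V y * (partial b (conv m \<phi>) y \<bullet> b))" if b: "b \<in> Basis" for b
  proof -
    have bp: "bump (partial b m)" using bump_partial[OF m_bump b] .
    obtain B where B: "\<And>x. norm (conv (partial b m) \<phi> x) \<le> B" using conv_bounded[OF bp \<phi>_int] by auto
    have "\<bar>conv (partial b m) \<phi> x \<bullet> b\<bar> \<le> B" for x
      using Basis_le_norm[OF b, of "conv (partial b m) \<phi> x"] B[of x] by linarith
    then show ?thesis
      using integrable_scaleR_bounded[OF V_int, of "\<lambda>x. conv (partial b m) \<phi> x \<bullet> b" B]
        C_inf_measurable[OF C_inf_conv[OF bp \<phi>_int]]
      by (simp add: fun_cong[OF partial_conv[OF m_bump \<phi>_int b]])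
  qed
  have "(LINT x|lborel. indicator \<Omega> x * norm (gradient (conv m V) x)) =
      (\<Sum>b\<in>Basis. LINT x|lborel. conv (partial b m) V x * (\<phi> x \<bullet> b))"
    unfolding pw using i by (intro Bochner_Integration.integral_sum)
  also have "\<dots> = - (\<Sum>b\<in>Basis. LINT y|lborel. V y * (partial b (conv m \<phi>) y \<bullet> b))"
    by (simp add: adj sum_negf)
  also have "\<dots> = - (LINT y|lborel. V y * divergence (conv m \<phi>) y)"
    unfolding divergence_def sum_distrib_left using i2 by (subst Bochner_Integration.integral_sum) auto
  finally show "(LINT x|lborel. indicator \<Omega> x * norm (gradient (conv m V) x)) =
     - (LINT y|lborel. V y * divergence (conv m \<phi>) y)" .
qed

text \<open>Each summand is translated back by its own t e_i, which moves the shift onto the field.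
  The product rule then assembles the divergence of \<open>\<Psi>\<close> up to the terms with
  \<open>W\<close>, which are translated forward again.\<close>

lemma integral_V_div:
  "(LINT y|lborel. V y * divergence (conv m \<phi>) y) =
     (LINT y|lborel. U y * divergence \<Psi> y) - (\<Sum>i<N. LINT y|lborel. W i (y + t *\<^sub>R e i) \<bullet> conv m \<phi> y)"
proof -
  let ?D = "divergence (conv m \<phi>)"
  have i1: "integrable lborel (\<lambda>y. (\<zeta> i (y + t *\<^sub>R e i) * U (y + t *\<^sub>R e i)) * ?D y)" if "i < N" for i
    using integrable_mult_div[OF integrable_translate[OF \<zeta>U_int[OF that], of "t *\<^sub>R e i"], of 0] by simp
  have i2: "integrable lborel (\<lambda>y. \<zeta> i y * U y * ?D (y - t *\<^sub>R e i))" if "i < N" for i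
    using integrable_mult_div[OF \<zeta>U_int[OF that], of "- (t *\<^sub>R e i)"] by simp
  have f_meas: "conv m \<phi> \<in> borel_measurable borel" using C_inf_mollified_\<phi> C_inf_measurable by blast
  have i3: "integrable lborel (\<lambda>y. W i y \<bullet> conv m \<phi> (y - t *\<^sub>R e i))" if "i < N" for i
    using measurable_compose[OF _ f_meas, of "\<lambda>y. y - t *\<^sub>R e i"]
    by (intro integrable_inner_bounded[OF W_int[OF that] _ mollified_\<phi>_norm]) auto
  have "(LINT y|lborel. V y * ?D y) = (LINT y|lborel. (\<Sum>i<N. \<zeta> i (y + t *\<^sub>R e i) * U (y + t *\<^sub>R e i) * ?D y))"
    unfolding V_def sum_distrib_right ..
  also have "\<dots> = (\<Sum>i<N. LINT y|lborel. \<zeta> i (y + t *\<^sub>R e i) * U (y + t *\<^sub>R e i) * ?D y)"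
    using i1 by (intro Bochner_Integration.integral_sum) auto
  also have "\<dots> = (\<Sum>i<N. LINT y|lborel. \<zeta> i y * U y * ?D (y - t *\<^sub>R e i))"
  proof (intro sum.cong refl)
    fix i assume "i \<in> {..<N}"
    then show "(LINT y|lborel. \<zeta> i (y + t *\<^sub>R e i) * U (y + t *\<^sub>R e i) * ?D y) =
        (LINT y|lborel. \<zeta> i y * U y * ?D (y - t *\<^sub>R e i))"
      using integral_translate[of "\<lambda>y. \<zeta> i y * U y * ?D (y - t *\<^sub>R e i)" "t *\<^sub>R e i"]
        borel_measurable_integrable[OF i2[of i]] by simp
  qed
  also have "\<dots> = (LINT y|lborel. (\<Sum>i<N. \<zeta> i y * U y * ?D (y - t *\<^sub>R e i)))"
    using i2 by (intro Bochner_Integration.integral_sum[symmetric]) auto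
  also have "\<dots> = (LINT y|lborel. U y * divergence \<Psi> y - (\<Sum>i<N. W i y \<bullet> conv m \<phi> (y - t *\<^sub>R e i)))"
    unfolding divergence_\<Psi> W_def
    by (intro Bochner_Integration.integral_cong) (auto simp: distrib_left sum_distrib_left mult_ac)
  also have "\<dots> = (LINT y|lborel. U y * divergence \<Psi> y) - (LINT y|lborel. (\<Sum>i<N. W i y \<bullet> conv m \<phi> (y - t *\<^sub>R e i)))"
  proof (rule Bochner_Integration.integral_diff)
    have "U y * divergence \<Psi> y = (\<Sum>i<N. \<zeta> i y * U y * ?D (y - t *\<^sub>R e i)) + (\<Sum>i<N. W i y \<bullet> conv m \<phi> (y - t *\<^sub>R e i))" for y
      unfolding divergence_\<Psi> W_def by (auto simp: distrib_left sum_distrib_left mult_ac)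
    then show "integrable lborel (\<lambda>y. U y * divergence \<Psi> y)" 
      by (simp only:) (use i2 i3 in \<open>intro Bochner_Integration.integrable_add Bochner_Integration.integrable_sum; simp\<close>)
  qed (use i3 in auto)
  also have "(LINT y|lborel. (\<Sum>i<N. W i y \<bullet> conv m \<phi> (y - t *\<^sub>R e i))) =
      (\<Sum>i<N. LINT y|lborel. W i y \<bullet> conv m \<phi> (y - t *\<^sub>R e i))"
    using i3 by (intro Bochner_Integration.integral_sum) auto
  also have "\<dots> = (\<Sum>i<N. LINT y|lborel. W i (y + t *\<^sub>R e i) \<bullet> conv m \<phi> y)"
  proof (intro sum.cong refl)
    fix i assume "i \<in> {..<N}"
    then show "(LINT y|lborel. W i y \<bullet> conv m \<phi> (y - t *\<^sub>R e i)) = (LINT y|lborel. W i (y + t *\<^sub>R e i) \<bullet> conv m \<phi> y)"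
      using integral_translate[of "\<lambda>y. W i y \<bullet> conv m \<phi> (y - t *\<^sub>R e i)" "t *\<^sub>R e i"]
        borel_measurable_integrable[OF i3[of i]] by simp
  qed
  finally show ?thesis .
qed

text \<open>The partition of unity makes the terms without translation cancel.\<close>

lemma sum_integral_W_le:
  "(\<Sum>i<N. LINT y|lborel. W i (y + t *\<^sub>R e i) \<bullet> conv m \<phi> y) \<le>
     (\<Sum>i<N. LINT y|lborel. norm (W i (y + t *\<^sub>R e i) - W i y))"
proof -
  have f_meas: "conv m \<phi> \<in> borel_measurable borel" using C_inf_mollified_\<phi> C_inf_measurable by blast
  have i1: "integrable lborel (\<lambda>y. W i (y + t *\<^sub>R e i))" if "i < N" for i
    using integrable_translate[OF W_int[OF that]] .
  note i2 = integrable_inner_bounded[OF i1 f_meas mollified_\<phi>_norm]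
    and i3 = integrable_inner_bounded[OF W_int f_meas mollified_\<phi>_norm]
  have "(\<Sum>i<N. LINT y|lborel. W i y \<bullet> conv m \<phi> y) = (LINT y|lborel. (\<Sum>i<N. W i y) \<bullet> conv m \<phi> y)"
    unfolding inner_sum_left using i3 by (intro Bochner_Integration.integral_sum[symmetric]) auto
  then have "(\<Sum>i<N. LINT y|lborel. W i y \<bullet> conv m \<phi> y) = 0" by (simp add: sum_W)
  then have "(\<Sum>i<N. LINT y|lborel. W i (y + t *\<^sub>R e i) \<bullet> conv m \<phi> y) =
    (\<Sum>i<N. (LINT y|lborel. W i (y + t *\<^sub>R e i) \<bullet> conv m \<phi> y) - (LINT y|lborel. W i y \<bullet> conv m \<phi> y))"
    by (simp add: sum_subtractf)
  also have "\<dots> \<le> (\<Sum>i<N. LINT y|lborel. norm (W i (y + t *\<^sub>R e i) - W i y))"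
  proof (rule sum_mono)
    fix i assume "i \<in> {..<N}"
    then have i: "i < N" by simp
    have "(LINT y|lborel. W i (y + t *\<^sub>R e i) \<bullet> conv m \<phi> y) - (LINT y|lborel. W i y \<bullet> conv m \<phi> y) =
        (LINT y|lborel. (W i (y + t *\<^sub>R e i) - W i y) \<bullet> conv m \<phi> y)"
      unfolding inner_diff_left using i2[OF i] i3[OF i] by simp
    also have "\<dots> \<le> (LINT y|lborel. norm (W i (y + t *\<^sub>R e i) - W i y))"
    proof (rule integral_mono)
      show "integrable lborel (\<lambda>y. (W i (y + t *\<^sub>R e i) - W i y) \<bullet> conv m \<phi> y)"
        unfolding inner_diff_left using i2[OF i] i3[OF i] by simp
      show "integrable lborel (\<lambda>y. norm (W i (y + t *\<^sub>R e i) - W i y))"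
        using i1[OF i] W_int[OF i] by simp
      fix y
      show "(W i (y + t *\<^sub>R e i) - W i y) \<bullet> conv m \<phi> y \<le> norm (W i (y + t *\<^sub>R e i) - W i y)"
        using norm_cauchy_schwarz[of "W i (y + t *\<^sub>R e i) - W i y" "conv m \<phi> y"]
          mult_left_le[OF mollified_\<phi>_norm[of y] norm_ge_zero[of "W i (y + t *\<^sub>R e i) - W i y"]] by linarith
    qed
    finally show "(LINT y|lborel. W i (y + t *\<^sub>R e i) \<bullet> conv m \<phi> y) - (LINT y|lborel. W i y \<bullet> conv m \<phi> y)
      \<le> (LINT y|lborel. norm (W i (y + t *\<^sub>R e i) - W i y))" .
  qed
  finally show ?thesis .
qed

text \<open>The constant \<open>C\<close> plays the role of the total variation of \<open>U\<close>,
  tested on the single field \<open>\<Psi>\<close>.\<close>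

lemma integral_norm_gradient_le:
  assumes "\<And>\<psi>. \<psi> \<in> test_functions \<Omega> \<Longrightarrow> (\<And>x. norm (\<psi> x) \<le> 1) \<Longrightarrow> - (LINT y|lborel. U y * divergence \<psi> y) \<le> C"
  shows "(LINT x|lborel. indicator \<Omega> x * norm (gradient (conv m V) x)) \<le>
    C + (\<Sum>i<N. LINT y|lborel. norm (W i (y + t *\<^sub>R e i) - W i y))"
  using assms[OF \<Psi>_test \<Psi>_norm] integral_norm_gradient_eq(2) integral_V_div sum_integral_W_le by linarith

end


section \<open>Choice of the scales in the recovery\<close>

theorem BV_smooth_recovery:
  fixes \<Omega> :: "'a::euclidean_space set" and U :: "'a \<Rightarrow> real"
  assumes dom: "bounded_lipschitz_domain \<Omega>"
    and U: "integrable lborel U" "integrable lborel (\<lambda>x. (U x)\<^sup>2)" "\<And>x. x \<notin> \<Omega> \<Longrightarrow> U x = 0"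
    and TV: "\<And>\<psi>. \<psi> \<in> test_functions \<Omega> \<Longrightarrow> (\<And>x. norm (\<psi> x) \<le> 1) \<Longrightarrow>
      - (LINT y|lborel. U y * divergence \<psi> y) \<le> C"
    and "\<delta> > 0"
  shows "\<exists>v. bump v \<and> integrable lborel (\<lambda>x. indicator \<Omega> x * norm (gradient v x)) \<and>
    (LINT x|lborel. indicator \<Omega> x * norm (gradient v x)) \<le> C + \<delta> \<and>
    (\<integral>\<^sup>+x. ennreal ((v x - U x)\<^sup>2) \<partial>lborel) \<le> ennreal \<delta>"
proof -
  have \<Omega>: "open \<Omega>" "bounded \<Omega>" "lipschitz_boundary \<Omega>"
    using dom by (auto simp: bounded_lipschitz_domain_def)
  have "\<forall>q\<in>closure \<Omega>. \<exists>e r c. inward \<Omega> q e r c"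
    using lipschitz_boundary_inward[OF \<Omega>(1,3)] by blast
  then obtain E R C' where inw: "\<And>q. q \<in> closure \<Omega> \<Longrightarrow> inward \<Omega> q (E q) (R q) (C' q)"
    by metis
  have cpt: "compact (closure \<Omega>)" using \<Omega>(2) by (rule compact_closure[THEN iffD2])
  have "\<forall>q\<in>closure \<Omega>. 0 < R q" using inw by (simp add: inward_def)
  from smooth_partition_of_unity[OF cpt, of R, OF this]
  obtain N :: nat and p \<zeta> where p: "\<And>i. i < N \<Longrightarrow> p i \<in> closure \<Omega>"
    and \<zeta>_bump: "\<And>i. i < N \<Longrightarrow> bump (\<zeta> i :: 'a \<Rightarrow> real)"
    and \<zeta>: "\<And>i x. i < N \<Longrightarrow> 0 \<le> \<zeta> i x"
      "\<And>i x. i < N \<Longrightarrow> \<zeta> i x \<noteq> 0 \<Longrightarrow> dist (p i) x \<le> 3 / 4 * R (p i)"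
      "\<And>x. (\<Sum>i<N. \<zeta> i x) \<le> 1" "\<And>x. x \<in> closure \<Omega> \<Longrightarrow> (\<Sum>i<N. \<zeta> i x) = 1"
    by (elim exE conjE) blast
  define e r c where "e i = E (p i)" and "r i = R (p i)" and "c i = C' (p i)" for i
  have inw_i: "inward \<Omega> (p i) (e i) (r i) (c i)" if "i < N" for i
    using inw[OF p[OF that]] by (simp add: e_def r_def c_def)
  have [measurable]: "U \<in> borel_measurable borel" using U(1) by auto
  define W where "W i y = U y *\<^sub>R gradient (\<zeta> i) y" for i y
  define G where "G i y = \<zeta> i y * U y" for i y
  have W_int: "integrable lborel (W i)" if i: "i < N" for i
  proof -
    note b = bump_gradient[OF \<zeta>_bump[OF i]]
    obtain B where "\<And>x. norm (gradient (\<zeta> i) x) \<le> B" using bump_bounded[OF b] by blast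
    then show ?thesis unfolding W_def by (rule integrable_scaleR_bounded[OF U(1) bump_measurable[OF b]])
  qed
  have \<zeta>_meas[measurable]: "\<zeta> i \<in> borel_measurable borel" if "i < N" for i
    using \<zeta>_bump[OF that] bump_measurable by blast
  have G_meas: "G i \<in> borel_measurable borel" if "i < N" for i
    using \<zeta>_meas[OF that] unfolding G_def by measurable
  have G2_int: "integrable lborel (\<lambda>x. (G i x)\<^sup>2)" if i: "i < N" for i
  proof -
    obtain B where B: "\<And>x. \<bar>\<zeta> i x\<bar> \<le> B" using bump_bounded[OF \<zeta>_bump[OF i]] by auto
    then have "\<bar>(\<zeta> i x)\<^sup>2\<bar> \<le> B\<^sup>2" for x
      using power_mono[OF B abs_ge_zero, of x 2] by simp
    then show ?thesis
      using integrable_bounded_mult[of "\<lambda>x. (\<zeta> i x)\<^sup>2" "B\<^sup>2" "\<lambda>x. (U x)\<^sup>2"] U(2) \<zeta>_meas[OF i]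
      by (simp add: G_def power_mult_distrib)
  qed
  \<comment> \<open>The variation error is a sum of N terms. The squared L^2 error is also a sum of
    N terms, with another factor N from squaring a sum. The square of N + 1 covers both and is
    nonzero for N = 0.\<close>
  define \<eta> where "\<eta> = \<delta> / (real N + 1)\<^sup>2"
  have \<eta>: "\<eta> > 0" "real N * \<eta> \<le> \<delta>" "real N * real N * \<eta> \<le> \<delta>"
  proof -
    have "real N \<le> (real N + 1)\<^sup>2" "real N * real N \<le> (real N + 1)\<^sup>2"
      by (simp_all add: power2_eq_square algebra_simps)
    then show "\<eta> > 0" "real N * \<eta> \<le> \<delta>" "real N * real N * \<eta> \<le> \<delta>"
      using \<open>\<delta> > 0\<close> by (auto simp: \<eta>_def divide_le_eq mult.commute[of _ \<delta>])
  qed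
  define Q where "Q i d \<longleftrightarrow> d > 0 \<and> (\<forall>h. norm h < d \<longrightarrow>
      (LINT x|lborel. norm (W i (x + h) - W i x)) < \<eta> \<and>
      (\<integral>\<^sup>+x. ennreal ((G i (x + h) - G i x)\<^sup>2) \<partial>lborel) \<le> ennreal \<eta>)" for i d
  have "\<exists>d. Q i d" if i: "i < N" for i
  proof -
    obtain d1 where d1: "d1 > 0" "\<And>h. norm h < d1 \<Longrightarrow> (LINT x|lborel. norm (W i (x + h) - W i x)) < \<eta>"
      using translation_continuousD[OF integrable_translation_continuous[OF W_int[OF i]] \<eta>(1)] by blast
    obtain d2 where d2: "d2 > 0"
      "\<And>h. norm h < d2 \<Longrightarrow> (\<integral>\<^sup>+x. ennreal ((G i (x + h) - G i x)\<^sup>2) \<partial>lborel) \<le> ennreal \<eta>"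
      using L2_translation_continuity[OF G_meas[OF i] G2_int[OF i] \<eta>(1)] by blast
    show ?thesis unfolding Q_def using d1 d2 by (intro exI[of _ "min d1 d2"]) auto
  qed
  then obtain D where Q: "\<And>i. i < N \<Longrightarrow> Q i (D i)" by metis
  have D: "D i > 0"
    "\<And>h. norm h < D i \<Longrightarrow> (LINT x|lborel. norm (W i (x + h) - W i x)) < \<eta>"
    "\<And>h. norm h < D i \<Longrightarrow> (\<integral>\<^sup>+x. ennreal ((G i (x + h) - G i x)\<^sup>2) \<partial>lborel) \<le> ennreal \<eta>"
    if "i < N" for i
    using Q[OF that] by (auto simp: Q_def)
  obtain d where d: "d > 0" "\<And>i. i < N \<Longrightarrow> d \<le> min (r i) (D i)"
    using finite_positive_lower_bound[of N "\<lambda>i. min (r i) (D i)"] D(1) inw_i by (auto simp: inward_def)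
  obtain c0 where c0: "c0 > 0" "\<And>i. i < N \<Longrightarrow> c0 \<le> c i"
    using finite_positive_lower_bound[of N c] inw_i by (auto simp: inward_def)
  \<comment> \<open>Both t and the full displacement, at most \<epsilon> + t and hence at most 2 t,
    stay below the thresholds \<open>r i\<close> and \<open>D i\<close> respectively.\<close>
  define t where "t = d / 3"
  \<comment> \<open>Half of \<open>c0\<close> makes \<epsilon> strictly less than every margin; the
    minimum with 1 gives \<epsilon> \<le> t.\<close>
  define \<epsilon> where "\<epsilon> = min (c0 / 2) 1 * t"
  have t: "t > 0" using d(1) by (simp add: t_def)
  have \<epsilon>: "0 < \<epsilon>" "\<epsilon> \<le> t" using c0(1) t by (auto simp: \<epsilon>_def intro: mult_left_le_one_le)
  have \<epsilon>_less: "\<epsilon> < c i * t" if "i < N" for i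
    unfolding \<epsilon>_def using c0(1) c0(2)[OF that] t by (intro mult_strict_right_mono) (auto simp: min_less_iff_disj)
  have t_less: "t < r i" "2 * t < D i" if "i < N" for i
    using d(1) d(2)[OF that] by (auto simp: t_def)
  obtain m :: "'a \<Rightarrow> real" where m: "mollifier \<epsilon> m" using mollifier_exists[OF \<epsilon>(1)] by blast
  interpret R: recovery \<Omega> U m N p e r c \<zeta> t \<epsilon>
  proof
    show "dist (p i) x \<le> 3 / 4 * r i" if "i < N" "\<zeta> i x \<noteq> 0" for i x
      using \<zeta>(2)[OF that] by (simp add: r_def)
    show "(\<Sum>i<N. \<zeta> i x) = 1" if "x \<in> \<Omega>" for x
      using \<zeta>(4) that closure_subset by blast
  qed (fact \<Omega> U inw_i \<zeta>_bump \<zeta> t t_less \<epsilon>_less m)+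
  have te: "norm (t *\<^sub>R e i) \<le> t" if "i < N" for i
    using inw_i[OF that] t by (simp add: inward_def mult_left_le)
  have V: "R.V y = (\<Sum>i<N. G i (y + t *\<^sub>R e i))" for y
    by (simp add: R.V_def G_def)
  obtain M where M: "\<And>x. x \<in> \<Omega> \<Longrightarrow> norm x \<le> M" using \<Omega>(2) bounded_iff by blast
  have "bump (conv m R.V)"
  proof -
    have "norm z \<le> M + t + \<epsilon>" if nz: "conv m R.V z \<noteq> 0" for z
    proof -
      obtain y where y: "R.V y \<noteq> 0" "m (z - y) \<noteq> 0" using conv_nonzero[OF nz] by blast
      then obtain i where i: "i \<in> {..<N}" "G i (y + t *\<^sub>R e i) \<noteq> 0"
        unfolding V by (blast elim: sum.not_neutral_contains_not_neutral)
      then have "y + t *\<^sub>R e i \<in> \<Omega>" using U(3) by (auto simp: G_def)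
      then have "norm y \<le> M + t"
        using M[of "y + t *\<^sub>R e i"] te[of i] i(1) norm_triangle_ineq4[of "y + t *\<^sub>R e i" "t *\<^sub>R e i"] by simp
      moreover have "norm (z - y) < \<epsilon>" using m y(2) by (simp add: mollifier_def)
      ultimately show ?thesis using norm_triangle_ineq[of y "z - y"] by simp
    qed
    then show ?thesis using R.C_inf_v by (auto simp: bump_def)
  qed
  moreover have "(LINT x|lborel. indicator \<Omega> x * norm (gradient (conv m R.V) x)) \<le> C + \<delta>"
  proof -
    have "(\<Sum>i<N. LINT y|lborel. norm (R.W i (y + t *\<^sub>R e i) - R.W i y)) \<le> (\<Sum>i<N. \<eta>)"
    proof (rule sum_mono)
      fix i assume "i \<in> {..<N}"
      then have i: "i < N" by simp
      have "norm (t *\<^sub>R e i) < D i" using te[OF i] t_less(2)[OF i] t by linarith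
      from D(2)[OF i this]
      show "(LINT y|lborel. norm (R.W i (y + t *\<^sub>R e i) - R.W i y)) \<le> \<eta>"
        by (simp add: W_def R.W_def)
    qed
    then show ?thesis using R.integral_norm_gradient_le[OF TV] \<eta>(2) by fastforce
  qed
  moreover have "(\<integral>\<^sup>+x. ennreal ((conv m R.V x - U x)\<^sup>2) \<partial>lborel) \<le> ennreal \<delta>"
  proof (rule conv_L2_le[OF m R.V_int])
    have V_meas: "R.V \<in> borel_measurable borel" using R.V_int by auto
    show "integrable lborel (\<lambda>x. (R.V x)\<^sup>2)"
    proof (rule Bochner_Integration.integrable_bound)
      show "integrable lborel (\<lambda>x. (\<Sum>i<N. (G i (x + t *\<^sub>R e i))\<^sup>2) * real N)"
        using integrable_translate[OF G2_int] by auto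
      show "AE x in lborel. norm ((R.V x)\<^sup>2) \<le> norm ((\<Sum>i<N. (G i (x + t *\<^sub>R e i))\<^sup>2) * real N)"
        using sum_squared_le_sum_of_squares[of "\<lambda>i. G i (_ + t *\<^sub>R e i)" "{..<N}"]
        by (auto simp: V sum_nonneg)
    qed (use V_meas in auto)
    fix w :: 'a assume w: "norm w < \<epsilon>"
    have sumG: "(\<Sum>i<N. G i x) = U x" for x
    proof (cases "x \<in> \<Omega>")
      case True
      then show ?thesis using R.\<zeta>_one[OF True] by (simp add: G_def flip: sum_distrib_right)
    qed (simp add: G_def U(3))
    have "(\<integral>\<^sup>+x. ennreal ((R.V (x + w) - U x)\<^sup>2) \<partial>lborel) \<le>
      (\<integral>\<^sup>+x. (\<Sum>i<N. ennreal (real N) * ennreal ((G i (x + (w + t *\<^sub>R e i)) - G i x)\<^sup>2)) \<partial>lborel)"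
    proof (rule nn_integral_mono)
      fix x
      \<comment> \<open>The pieces \<open>G i\<close> add up to \<open>U\<close>, so the error
        splits into translation errors of the pieces; the mollifier shift w and the inward shift
        merge into one translation.\<close>
      have "R.V (x + w) - U x = (\<Sum>i<N. G i (x + (w + t *\<^sub>R e i)) - G i x)"
        by (simp add: V sum_subtractf sumG add.assoc)
      then have "(R.V (x + w) - U x)\<^sup>2 \<le> (\<Sum>i<N. (G i (x + (w + t *\<^sub>R e i)) - G i x)\<^sup>2) * real N"
        using sum_squared_le_sum_of_squares[of "\<lambda>i. G i (x + (w + t *\<^sub>R e i)) - G i x" "{..<N}"] by simp
      then have "ennreal ((R.V (x + w) - U x)\<^sup>2) \<le> ennreal (\<Sum>i<N. real N * (G i (x + (w + t *\<^sub>R e i)) - G i x)\<^sup>2)"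
        by (intro ennreal_leI) (simp add: sum_distrib_left mult.commute)
      also have "\<dots> = (\<Sum>i<N. ennreal (real N) * ennreal ((G i (x + (w + t *\<^sub>R e i)) - G i x)\<^sup>2))"
        by (subst sum_ennreal[symmetric]) (auto simp: ennreal_mult)
      finally show "ennreal ((R.V (x + w) - U x)\<^sup>2) \<le>
        (\<Sum>i<N. ennreal (real N) * ennreal ((G i (x + (w + t *\<^sub>R e i)) - G i x)\<^sup>2))" .
    qed
    also have "\<dots> = (\<Sum>i<N. ennreal (real N) * (\<integral>\<^sup>+x. ennreal ((G i (x + (w + t *\<^sub>R e i)) - G i x)\<^sup>2) \<partial>lborel))"
    proof -
      have gm: "(\<lambda>x. ennreal ((G i (x + (w + t *\<^sub>R e i)) - G i x)\<^sup>2)) \<in> borel_measurable lborel" if "i < N" for i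
        using G_meas[OF that] measurable_compose[OF _ G_meas[OF that], of "\<lambda>x. x + (w + t *\<^sub>R e i)" borel] by simp
      then show ?thesis
        by (subst nn_integral_sum) (auto intro!: sum.cong nn_integral_cmult)
    qed
    also have "\<dots> \<le> (\<Sum>i<N. ennreal (real N) * ennreal \<eta>)"
    proof (intro sum_mono mult_left_mono)
      fix i assume "i \<in> {..<N}"
      then have i: "i < N" by simp
      have "norm (w + t *\<^sub>R e i) < D i"
        using norm_triangle_ineq[of w "t *\<^sub>R e i"] w \<epsilon>(2) te[OF i] t_less(2)[OF i] by linarith
      from D(3)[OF i this]
      show "(\<integral>\<^sup>+x. ennreal ((G i (x + (w + t *\<^sub>R e i)) - G i x)\<^sup>2) \<partial>lborel) \<le> ennreal \<eta>" .
    qed simp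
    also have "\<dots> = ennreal (real N * real N * \<eta>)"
      using \<eta>(1) by (simp add: ennreal_mult ennreal_of_nat_eq_real_of_nat mult.assoc)
    also have "\<dots> \<le> ennreal \<delta>" using \<eta>(3) by (rule ennreal_leI)
    finally show "(\<integral>\<^sup>+x. ennreal ((R.V (x + w) - U x)\<^sup>2) \<partial>lborel) \<le> ennreal \<delta>" .
  qed simp
  ultimately show ?thesis using R.integral_norm_gradient_eq(1) by blast
qed

section \<open>Weak gradients\<close>

text \<open>Passes from a function measurable for the completed measure on \<Omega> to a Borel
  function on the whole space, as convolution and Fubini demand; the zero extension makes integrals
  over \<Omega> integrals over the whole space.\<close>

lemma borel_representative:
  fixes u :: "'a::euclidean_space \<Rightarrow> real"
  assumes "open \<Omega>" "u \<in> borel_measurable (lebesgue_on \<Omega>)"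
  obtains U where "U \<in> borel_measurable borel" "\<And>x. x \<notin> \<Omega> \<Longrightarrow> U x = 0"
    "AE x in lebesgue_on \<Omega>. U x = u x"
proof -
  have \<Omega>: "\<Omega> \<inter> space lebesgue \<in> sets lebesgue" using assms(1) by simp
  have "(\<lambda>x. indicator \<Omega> x *\<^sub>R u x) \<in> borel_measurable lebesgue"
    using assms(2) borel_measurable_restrict_space_iff[OF \<Omega>, of u] by simp
  then obtain g where g: "g \<in> borel_measurable lborel" "AE x in lborel. indicator \<Omega> x *\<^sub>R u x = g x"
    using completion_ex_borel_measurable_real by blast
  have [measurable]: "\<Omega> \<in> sets borel" "g \<in> borel_measurable borel" using assms(1) g(1) by auto
  show thesis
  proof
    show "(\<lambda>x. indicator \<Omega> x * g x) \<in> borel_measurable borel" by measurable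
    have "AE x in lborel. x \<in> \<Omega> \<longrightarrow> indicator \<Omega> x * g x = u x" using g(2) by eventually_elim auto
    then show "AE x in lebesgue_on \<Omega>. indicator \<Omega> x * g x = u x"
      using AE_restrict_space_iff[OF \<Omega>] AE_completion_iff by blast
  qed simp
qed

lemma borel_measurable_lebesgue_on:
  "k \<in> borel_measurable borel \<Longrightarrow> k \<in> borel_measurable (lebesgue_on \<Omega>)"
  by (intro measurable_restrict_space1 measurable_completion) simp

lemma AE_lebesgue_on_iff:
  "open \<Omega> \<Longrightarrow> (AE x in lebesgue_on \<Omega>. P x) \<longleftrightarrow> (AE x in lborel. x \<in> \<Omega> \<longrightarrow> P x)"
  by (simp add: AE_restrict_space_iff AE_completion_iff)

lemma integral_lebesgue_on_eq_lborel:
  fixes H :: "'a::euclidean_space \<Rightarrow> 'b::euclidean_space"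
  assumes "open \<Omega>" "H \<in> borel_measurable borel" "\<And>x. x \<notin> \<Omega> \<Longrightarrow> H x = 0"
  shows "integral\<^sup>L (lebesgue_on \<Omega>) H = integral\<^sup>L lborel H"
    and "integrable (lebesgue_on \<Omega>) H \<longleftrightarrow> integrable lborel H"
proof -
  have eq: "(\<lambda>x. indicator \<Omega> x *\<^sub>R H x) = H" using assms(3) by (auto simp: indicator_def)
  show "integral\<^sup>L (lebesgue_on \<Omega>) H = integral\<^sup>L lborel H"
    using assms by (simp add: integral_restrict_space eq integral_completion)
  show "integrable (lebesgue_on \<Omega>) H \<longleftrightarrow> integrable lborel H"
    using assms by (simp add: integrable_restrict_space eq integrable_completion)
qed

lemma integrable_lborel_imp_lebesgue_on:
  fixes H :: "'a::euclidean_space \<Rightarrow> 'b::euclidean_space"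
  assumes "open \<Omega>" "integrable lborel H"
  shows "integrable (lebesgue_on \<Omega>) H"
proof -
  have "integrable lebesgue H" using assms(2) by (simp add: integrable_completion)
  then show ?thesis
    using assms(1) integrable_mult_indicator[of \<Omega> lebesgue H] by (simp add: integrable_restrict_space)
qed

lemma nn_integral_lebesgue_on_le_lborel:
  assumes "open \<Omega>"
  shows "(\<integral>\<^sup>+x. f x \<partial>lebesgue_on \<Omega>) \<le> (\<integral>\<^sup>+x. f x \<partial>lborel)"
proof -
  have "(\<integral>\<^sup>+x. f x \<partial>lebesgue_on \<Omega>) = (\<integral>\<^sup>+x. f x * indicator \<Omega> x \<partial>lborel)"
    using assms by (simp add: nn_integral_restrict_space nn_integral_completion)
  also have "\<dots> \<le> (\<integral>\<^sup>+x. f x \<partial>lborel)"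
    by (intro nn_integral_mono) (auto simp: indicator_def)
  finally show ?thesis .
qed

lemma test_function_bump:
  fixes \<phi> :: "'a::euclidean_space \<Rightarrow> 'b::euclidean_space"
  assumes "\<phi> \<in> test_functions \<Omega>"
  shows "bump \<phi>"
proof -
  have "bounded (closure {x. \<phi> x \<noteq> 0})"
    using assms by (simp add: test_functions_def compact_imp_bounded)
  then obtain R where R: "\<And>x. x \<in> closure {x. \<phi> x \<noteq> 0} \<Longrightarrow> norm x \<le> R"
    unfolding bounded_iff by metis
  have "norm x \<le> R" if "\<phi> x \<noteq> 0" for x
    using R[of x] that closure_subset[of "{x. \<phi> x \<noteq> 0}"] by blast
  then show ?thesis using assms by (auto simp: bump_def test_functions_def C_inf_def)
qed

lemma test_function_outside:
  assumes "\<phi> \<in> test_functions \<Omega>" "x \<notin> \<Omega>"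
  shows "\<phi> x = 0" "frechet_derivative \<phi> (at x) h = 0"
proof -
  let ?S = "- closure {x. \<phi> x \<noteq> 0}"
  have x: "x \<in> ?S" using assms by (auto simp: test_functions_def)
  have 0: "\<phi> y = 0" if "y \<in> ?S" for y using that closure_subset[of "{x. \<phi> x \<noteq> 0}"] by blast
  then show "\<phi> x = 0" using x .
  show "frechet_derivative \<phi> (at x) h = 0"
    by (subst frechet_derivative_zero_outside[of ?S]) (use x 0 in \<open>simp_all only: open_Compl closed_closure\<close>)
qed

lemma integrable_mult_bump:
  fixes h k :: "'a::euclidean_space \<Rightarrow> real"
  assumes "open \<Omega>" "integrable (lebesgue_on \<Omega>) h" "bump k"
  shows "integrable (lebesgue_on \<Omega>) (\<lambda>x. h x * k x)"
proof -
  obtain B where B: "\<And>x. norm (k x) \<le> B" using bump_bounded[OF assms(3)] by blast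
  have k: "k \<in> borel_measurable (lebesgue_on \<Omega>)"
    by (rule borel_measurable_lebesgue_on[OF bump_measurable[OF assms(3)]])
  show ?thesis
  proof (rule Bochner_Integration.integrable_bound)
    show "integrable (lebesgue_on \<Omega>) (\<lambda>x. B * norm (h x))" using assms(2) by simp
    show "AE x in lebesgue_on \<Omega>. norm (h x * k x) \<le> norm (B * norm (h x))"
    proof (rule AE_I2)
      fix x
      have "norm (h x * k x) \<le> norm (h x) * B" using mult_left_mono[OF B[of x] norm_ge_zero[of "h x"]] by (simp add: abs_mult)
      then show "norm (h x * k x) \<le> norm (B * norm (h x))" by (simp add: mult.commute)
    qed
  qed (use k assms(2) in auto)
qed

text \<open>The fundamental lemma of the calculus of variations: test with the mollified sign of \<open>h\<close> on
  a compact set.\<close>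

lemma test_functions_separate:
  fixes h :: "'a::euclidean_space \<Rightarrow> real"
  assumes \<Omega>: "open \<Omega>" and h: "integrable (lebesgue_on \<Omega>) h"
    and test: "\<And>\<phi>. \<phi> \<in> test_functions \<Omega> \<Longrightarrow> (LINT x|lebesgue_on \<Omega>. h x * \<phi> x) = 0"
  shows "AE x in lebesgue_on \<Omega>. h x = 0"
proof -
  obtain H where H_meas[measurable]: "H \<in> borel_measurable borel" and H0: "\<And>x. x \<notin> \<Omega> \<Longrightarrow> H x = 0"
    and Hh: "AE x in lebesgue_on \<Omega>. H x = h x"
    by (rule borel_representative[OF \<Omega> borel_measurable_integrable[OF h]], rule that)
  have "integrable (lebesgue_on \<Omega>) H"
    using h integrable_cong_AE[OF borel_measurable_lebesgue_on[OF H_meas] borel_measurable_integrable[OF h] Hh] by simp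
  then have H: "integrable lborel H" using integral_lebesgue_on_eq_lborel(2)[OF \<Omega> H_meas H0] by simp
  have testH: "(LINT x|lborel. H x * \<phi> x) = 0" if \<phi>: "\<phi> \<in> test_functions \<Omega>" for \<phi>
  proof -
    have [measurable]: "\<phi> \<in> borel_measurable borel" using bump_measurable[OF test_function_bump[OF \<phi>]] .
    have "(LINT x|lborel. H x * \<phi> x) = (LINT x|lebesgue_on \<Omega>. H x * \<phi> x)"
      using H0 by (intro integral_lebesgue_on_eq_lborel(1)[symmetric] \<Omega>) auto
    also have "\<dots> = (LINT x|lebesgue_on \<Omega>. h x * \<phi> x)"
      using Hh borel_measurable_lebesgue_on[of H] borel_measurable_lebesgue_on[of \<phi>] borel_measurable_integrable[OF h]
      by (intro integral_cong_AE) auto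
    finally show ?thesis using test[OF \<phi>] by simp
  qed
  have K: "AE x in lborel. x \<in> K \<longrightarrow> H x = 0" if K: "compact K" "K \<subseteq> \<Omega>" for K
  proof -
    have K_meas[measurable]: "K \<in> sets borel" using compact_imp_closed[OF K(1)] by simp
    define s where "s x = indicator K x * sgn (H x)" for x
    have [measurable]: "s \<in> borel_measurable borel" unfolding s_def by measurable
    have iK: "integrable lborel (indicator K :: 'a \<Rightarrow> real)"
      using emeasure_bounded_finite[OF compact_imp_bounded[OF K(1)]] by (simp add: integrable_indicator_iff)
    have s_le: "\<bar>s x\<bar> \<le> 1" for x by (auto simp: s_def indicator_def sgn_if)
    have s: "integrable lborel s"
      by (rule Bochner_Integration.integrable_bound[OF iK]) (auto simp: s_def indicator_def sgn_if)
    obtain d1 where d1: "d1 > 0" and nb: "(\<Union>x\<in>K. ball x d1) \<subseteq> \<Omega>"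
      using compact_subset_open_imp_ball_epsilon_subset[OF K(1) \<Omega> K(2)] .
    have iH: "integrable lborel (\<lambda>x. indicator K x * \<bar>H x\<bar>)"
      using integrable_mult_indicator[OF _ integrable_norm[OF H], of K] by simp
    \<comment> \<open>The integral of |H| over \<open>K\<close> is that of \<open>H * s\<close>.
      Testing with \<open>conv m s\<close> gives 0 for \<open>conv m H\<close> in place of
      \<open>H\<close>, so the integral is at most the L^1 mollification error of
      \<open>H\<close>.\<close>
    have le: "(LINT x|lborel. indicator K x * \<bar>H x\<bar>) \<le> \<eta>" if \<eta>: "\<eta> > 0" for \<eta>
    proof -
      obtain d2 where d2: "d2 > 0" "\<And>w. norm w < d2 \<Longrightarrow> (LINT x|lborel. norm (H (x + w) - H x)) < \<eta>"
        using translation_continuousD[OF integrable_translation_continuous[OF H] \<eta>] by blast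
      \<comment> \<open>The radius d1 / 2 leaves another d1 / 2 for the closure of the support; d2
        makes the mollification error at most \<eta>.\<close>
      obtain m :: "'a \<Rightarrow> real" where m: "mollifier (min (d1 / 2) d2) m"
        using mollifier_exists[of "min (d1 / 2) d2"] d1 d2 by auto
      have m_bump: "bump m" using m mollifier_bump by blast
      have "conv m s \<in> test_functions \<Omega>"
      proof -
        have "closure {x. conv m s x \<noteq> 0} \<subseteq> (\<Union>x\<in>K. ball x d1)"
        proof
          fix y assume "y \<in> closure {x. conv m s x \<noteq> 0}"
          then obtain y' where y': "conv m s y' \<noteq> 0" "dist y' y < d1 / 2"
            using d1 by (metis (mono_tags, lifting) closure_approachable half_gt_zero mem_Collect_eq)
          obtain x where x: "s x \<noteq> 0" "m (y' - x) \<noteq> 0" using conv_nonzero[OF y'(1)] by blast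
          have "x \<in> K" using x(1) by (auto simp: s_def indicator_def split: if_splits)
          moreover have "dist x y' < d1 / 2"
            using m x(2) by (auto simp: mollifier_def dist_norm norm_minus_commute)
          then have "dist x y < d1" using y'(2) dist_triangle[of x y y'] by simp
          ultimately show "y \<in> (\<Union>x\<in>K. ball x d1)" by auto
        qed
        moreover have "bounded (\<Union>x\<in>K. ball x d1)"
        proof -
          obtain M where M: "\<And>x. x \<in> K \<Longrightarrow> norm x \<le> M" using compact_imp_bounded[OF K(1)] bounded_iff by blast
          have "norm y \<le> M + d1" if y: "y \<in> (\<Union>x\<in>K. ball x d1)" for y
          proof -
            obtain x where "x \<in> K" "dist x y < d1" using y by auto
            then show ?thesis
              using M[of x] norm_triangle_ineq2[of y x] by (simp add: dist_norm norm_minus_commute)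
          qed
          then show ?thesis by (meson boundedI)
        qed
        ultimately have "compact (closure {x. conv m s x \<noteq> 0})" "closure {x. conv m s x \<noteq> 0} \<subseteq> \<Omega>"
          using nb bounded_subset by (auto simp: compact_eq_bounded_closed)
        then show ?thesis
          using C_inf_conv[OF m_bump s] by (simp add: test_functions_def C_inf_def)
      qed
      from testH[OF this] have 0: "(LINT x|lborel. conv m H x * s x) = 0"
        using conv_adjoint[OF m_bump H s] m by (simp add: mollifier_def)
      have "(\<integral>\<^sup>+x. ennreal \<bar>conv m H x - H x\<bar> \<partial>lborel) \<le> ennreal \<eta>"
      proof (rule conv_L1_le[OF m H H_meas])
        fix w :: 'a assume w: "norm w < min (d1 / 2) d2"
        have "integrable lborel (\<lambda>x. \<bar>H (x + w) - H x\<bar>)"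
          using H integrable_translate[OF H, of w] by simp
        then show "(\<integral>\<^sup>+x. ennreal \<bar>H (x + w) - H x\<bar> \<partial>lborel) \<le> ennreal \<eta>"
          using d2(2)[of w] w by (subst nn_integral_eq_integral) (auto intro!: ennreal_leI)
      qed
      note nn = this
      have [measurable]: "conv m H \<in> borel_measurable borel" using C_inf_measurable[OF C_inf_conv[OF m_bump H]] .
      have i: "integrable lborel (\<lambda>x. \<bar>conv m H x - H x\<bar>)"
        using nn by (intro integrableI_bounded) (auto intro: order.strict_trans1)
      have i2: "integrable lborel (\<lambda>x. (conv m H x - H x) * s x)"
        by (rule Bochner_Integration.integrable_bound[OF i]) (use s_le in \<open>auto simp: abs_mult intro!: AE_I2 mult_left_le\<close>)
      have i3: "integrable lborel (\<lambda>x. H x * s x)"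
        by (rule Bochner_Integration.integrable_bound[OF H]) (use s_le in \<open>auto simp: abs_mult intro!: AE_I2 mult_left_le\<close>)
      have "(LINT x|lborel. conv m H x * s x) = (LINT x|lborel. (conv m H x - H x) * s x + H x * s x)"
        by (simp add: left_diff_distrib)
      also have "\<dots> = (LINT x|lborel. (conv m H x - H x) * s x) + (LINT x|lborel. H x * s x)"
        using i2 i3 by simp
      finally have "(LINT x|lborel. H x * s x) = - (LINT x|lborel. (conv m H x - H x) * s x)" using 0 by simp
      also have "\<dots> \<le> (LINT x|lborel. \<bar>conv m H x - H x\<bar>)"
        unfolding Bochner_Integration.integral_minus[symmetric]
      proof (rule integral_mono)
        fix x
        have "\<bar>(conv m H x - H x) * s x\<bar> \<le> \<bar>conv m H x - H x\<bar>"
          using s_le[of x] by (simp add: abs_mult mult_left_le)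
        then show "- ((conv m H x - H x) * s x) \<le> \<bar>conv m H x - H x\<bar>" by linarith
      qed (use i i2 in auto)
      also have "\<dots> \<le> \<eta>"
        using nn nn_integral_eq_integral[OF i] \<eta> by (simp add: ennreal_le_iff)
      finally show ?thesis by (simp add: s_def mult.left_commute[of _ "indicator K _"] flip: linordered_idom_class.abs_sgn)
    qed
    have "(LINT x|lborel. indicator K x * \<bar>H x\<bar>) = 0"
      by (rule antisym[OF field_le_epsilon]) (use le in auto)
    then have "AE x in lborel. indicator K x * \<bar>H x\<bar> = 0"
      using integral_nonneg_eq_0_iff_AE[OF iH] by auto
    then show ?thesis by eventually_elim (auto simp: indicator_def)
  qed
  \<comment> \<open>Countably many compact sets exhaust \<Omega>, so the exceptional null sets
    combine into one.\<close>
  obtain C where C: "\<And>n::nat. compact (C n)" "\<And>n. C n \<subseteq> \<Omega>" "\<Union>(range C) = \<Omega>"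
    by (rule open_Union_compact_subsets[OF \<Omega>], rule that)
  have "AE x in lborel. \<forall>n. x \<in> C n \<longrightarrow> H x = 0"
    unfolding AE_all_countable by (intro allI K C)
  then have "AE x in lebesgue_on \<Omega>. H x = 0"
    unfolding AE_lebesgue_on_iff[OF \<Omega>] by eventually_elim (use C(3) in auto)
  then show ?thesis using Hh by eventually_elim simp
qed

lemma integrable_inner_test_function:
  assumes "open \<Omega>" "g \<in> L1_space \<Omega>" "\<phi> \<in> test_functions \<Omega>"
  shows "integrable (lebesgue_on \<Omega>) (\<lambda>x. (g x \<bullet> b) * \<phi> x :: real)"
  using assms test_function_bump by (intro integrable_mult_bump) (auto simp: L1_space_def)

lemma has_weak_gradientD:
  "has_weak_gradient \<Omega> u g \<Longrightarrow> \<phi> \<in> test_functions \<Omega> \<Longrightarrow> b \<in> Basis \<Longrightarrow>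
    (LINT x|lebesgue_on \<Omega>. u x * partial b \<phi> x) = - (LINT x|lebesgue_on \<Omega>. (g x \<bullet> b) * \<phi> x)"
  by (simp add: has_weak_gradient_def)

text \<open>The representative \<open>weak_gradient\<close> comes from an arbitrary choice;
  uniqueness identifies it almost everywhere with the classical gradient of a smooth
  function.\<close>

lemma weak_gradient_unique:
  fixes \<Omega> :: "'a::euclidean_space set"
  assumes \<Omega>: "open \<Omega>" and g1: "has_weak_gradient \<Omega> u g1" and g2: "has_weak_gradient \<Omega> u g2"
  shows "AE x in lebesgue_on \<Omega>. g1 x = g2 x"
proof -
  have int: "g1 \<in> L1_space \<Omega>" "g2 \<in> L1_space \<Omega>" using g1 g2 by (auto simp: has_weak_gradient_def)
  have "AE x in lebesgue_on \<Omega>. (g1 x - g2 x) \<bullet> b = 0" if b: "b \<in> Basis" for b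
  proof (rule test_functions_separate[OF \<Omega>])
    show "integrable (lebesgue_on \<Omega>) (\<lambda>x. (g1 x - g2 x) \<bullet> b)" using int by (auto simp: L1_space_def)
    fix \<phi> :: "'a \<Rightarrow> real" assume \<phi>: "\<phi> \<in> test_functions \<Omega>"
    have "(LINT x|lebesgue_on \<Omega>. (g1 x - g2 x) \<bullet> b * \<phi> x) =
        (LINT x|lebesgue_on \<Omega>. (g1 x \<bullet> b) * \<phi> x) - (LINT x|lebesgue_on \<Omega>. (g2 x \<bullet> b) * \<phi> x)"
      using integrable_inner_test_function[OF \<Omega> int(1) \<phi>, of b] integrable_inner_test_function[OF \<Omega> int(2) \<phi>, of b]
      by (simp add: inner_diff_left left_diff_distrib)
    also have "\<dots> = 0" using has_weak_gradientD[OF g1 \<phi> b] has_weak_gradientD[OF g2 \<phi> b] by simp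
    finally show "(LINT x|lebesgue_on \<Omega>. (g1 x - g2 x) \<bullet> b * \<phi> x) = 0" .
  qed
  then have "AE x in lebesgue_on \<Omega>. \<forall>b\<in>Basis. (g1 x - g2 x) \<bullet> b = 0"
    by (intro AE_finite_allI) auto
  then show ?thesis
    by eventually_elim (auto simp: inner_diff_left intro: euclidean_eqI)
qed

section \<open>Integration by parts and classical gradients\<close>

lemma conv_commute:
  fixes k G :: "'a::euclidean_space \<Rightarrow> real"
  assumes [measurable]: "k \<in> borel_measurable borel" "G \<in> borel_measurable borel"
  shows "conv k G z = conv G k z"
  using integral_reflect[of "\<lambda>x. k (z - x) * G x" z] by (simp add: conv_def mult.commute)

text \<open>The derivative at \<open>0\<close> of the convolution of \<open>\<phi>\<close> with the reflection of \<open>v\<close> may fall on either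
  factor.\<close>

lemma integration_by_parts_bump:
  fixes v \<phi> :: "'a::euclidean_space \<Rightarrow> real"
  assumes v: "bump v" and \<phi>: "bump \<phi>" and b: "b \<in> Basis"
  shows "(LINT x|lborel. v x * partial b \<phi> x) = - (LINT x|lborel. partial b v x * \<phi> x)"
proof -
  let ?k = "\<lambda>x. v (- x)"
  note k = bump_reflect(1)[OF v]
  have [measurable]: "v \<in> borel_measurable borel" "\<phi> \<in> borel_measurable borel" "?k \<in> borel_measurable borel"
    "(\<lambda>x. partial b \<phi> x) \<in> borel_measurable borel"
    using v \<phi> k bump_measurable bump_partial[OF \<phi> b] by auto
  have "conv ?k \<phi> = conv \<phi> ?k" by (intro ext conv_commute) auto
  then have "partial b (conv ?k \<phi>) 0 = partial b (conv \<phi> ?k) 0" by simp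
  then have "conv (partial b ?k) \<phi> 0 = conv (partial b \<phi>) ?k 0"
    using fun_cong[OF partial_conv[OF k bump_integrable[OF \<phi>] b], of 0]
      fun_cong[OF partial_conv[OF \<phi> bump_integrable[OF k] b], of 0] by simp
  moreover have "conv (partial b ?k) \<phi> 0 = - (LINT x|lborel. partial b v x * \<phi> x)"
    by (simp add: conv_def bump_reflect(2)[OF v])
  moreover have "conv (partial b \<phi>) ?k 0 = (LINT x|lborel. partial b \<phi> (0 - x) * v (0 - x))"
    by (simp add: conv_def)
  moreover have "\<dots> = (LINT x|lborel. partial b \<phi> x * v x)"
    by (rule integral_reflect[of "\<lambda>x. partial b \<phi> x * v x"]) measurable
  ultimately show ?thesis by (simp add: mult.commute)
qed

lemma bump_has_weak_gradient:
  assumes \<Omega>: "open \<Omega>" and v: "bump (v :: 'a::euclidean_space \<Rightarrow> real)"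
  shows "has_weak_gradient \<Omega> v (gradient v)"
  unfolding has_weak_gradient_def
proof (intro conjI ballI)
  show "gradient v \<in> L1_space \<Omega>"
    using integrable_lborel_imp_lebesgue_on[OF \<Omega> bump_integrable[OF bump_gradient[OF v]]]
    by (simp add: L1_space_def)
  fix \<phi> :: "'a \<Rightarrow> real" and b :: 'a assume \<phi>: "\<phi> \<in> test_functions \<Omega>" and b: "b \<in> Basis"
  note \<phi>b = test_function_bump[OF \<phi>]
  have [measurable]: "v \<in> borel_measurable borel" "\<phi> \<in> borel_measurable borel"
    "(\<lambda>x. partial b \<phi> x) \<in> borel_measurable borel" "(\<lambda>x. partial b v x) \<in> borel_measurable borel"
    using bump_measurable v \<phi>b bump_partial[OF \<phi>b b] bump_partial[OF v b] by auto
  have g: "gradient v x \<bullet> b = partial b v x" for x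
    using sum_Basis_inner_scaleR[OF b, of "\<lambda>c. partial c v x"] by (simp add: gradient_inner mult.commute)
  have "(LINT x|lebesgue_on \<Omega>. v x * partial b \<phi> x) = (LINT x|lborel. v x * partial b \<phi> x)"
    by (rule integral_lebesgue_on_eq_lborel[OF \<Omega>]) (auto simp: test_function_outside[OF \<phi>])
  also have "\<dots> = - (LINT x|lborel. partial b v x * \<phi> x)" by (rule integration_by_parts_bump[OF v \<phi>b b])
  also have "(LINT x|lborel. partial b v x * \<phi> x) = (LINT x|lebesgue_on \<Omega>. partial b v x * \<phi> x)"
    by (rule integral_lebesgue_on_eq_lborel[OF \<Omega>, symmetric]) (auto simp: test_function_outside[OF \<phi>])
  finally show "(LINT x|lebesgue_on \<Omega>. v x * partial b \<phi> x) = - (LINT x|lebesgue_on \<Omega>. gradient v x \<bullet> b * \<phi> x)"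
    by (simp add: g)
qed

text \<open>Weak gradients are tested with scalar functions, the total variation with vector fields;
  components translate between the two.\<close>

lemma test_function_component:
  assumes \<phi>: "\<phi> \<in> test_functions \<Omega>"
  shows "(\<lambda>x. \<phi> x \<bullet> b) \<in> test_functions \<Omega>"
    and "frechet_derivative (\<lambda>x. \<phi> x \<bullet> b) (at x) h = frechet_derivative \<phi> (at x) h \<bullet> b"
proof -
  have "C_inf \<phi>" using \<phi> by (simp add: test_functions_def C_inf_def)
  then have "C_inf (\<lambda>x. \<phi> x \<bullet> b)" by (rule C_inf_bounded_linear[OF bounded_linear_inner_left])
  moreover have sub: "closure {x. \<phi> x \<bullet> b \<noteq> 0} \<subseteq> closure {x. \<phi> x \<noteq> 0}" by (rule closure_mono) auto
  moreover have "compact (closure {x. \<phi> x \<bullet> b \<noteq> 0})"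
    using \<phi> compact_Int_closed[of "closure {x. \<phi> x \<noteq> 0}" "closure {x. \<phi> x \<bullet> b \<noteq> 0}"] sub
    by (simp add: test_functions_def Int_absorb1)
  ultimately show "(\<lambda>x. \<phi> x \<bullet> b) \<in> test_functions \<Omega>"
    using \<phi> by (auto simp: test_functions_def C_inf_def)
  have "((\<lambda>x. \<phi> x \<bullet> b) has_derivative (\<lambda>h. frechet_derivative \<phi> (at x) h \<bullet> b)) (at x)"
    by (intro has_derivative_inner_left C_inf_has_derivative \<open>C_inf \<phi>\<close>)
  from frechet_derivative_eq[OF this]
  show "frechet_derivative (\<lambda>x. \<phi> x \<bullet> b) (at x) h = frechet_derivative \<phi> (at x) h \<bullet> b" by simp
qed

lemma bump_divergence:
  assumes "bump \<phi>"
  shows "bump (divergence \<phi>)"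
proof (rule bump_if_derivative_zero[OF assms])
  show "C_inf (divergence \<phi>)"
    unfolding divergence_def
    using assms by (intro C_inf_sum C_inf_bounded_linear[OF bounded_linear_inner_left] C_inf_partial) (auto simp: bump_def)
qed (simp add: divergence_def)

text \<open>Applied componentwise, the weak gradient identity turns the pairing with a field into
  the integral of its inner product with g, which Cauchy-Schwarz bounds.\<close>

lemma total_variation_le_weak_gradient:
  fixes \<Omega> :: "'a::euclidean_space set"
  assumes \<Omega>: "open \<Omega>" and u: "u \<in> L1_space \<Omega>" and g: "has_weak_gradient \<Omega> u g"
  shows "total_variation \<Omega> u \<le> ereal (LINT x|lebesgue_on \<Omega>. norm (g x))"
  unfolding total_variation_def
proof (rule SUP_least)
  fix \<phi> :: "'a \<Rightarrow> 'a" assume "\<phi> \<in> {\<phi> \<in> test_functions \<Omega>. \<forall>x. norm (\<phi> x) \<le> 1}"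
  then have \<phi>: "\<phi> \<in> test_functions \<Omega>" and \<phi>1: "\<And>x. norm (\<phi> x) \<le> 1" by auto
  have gL: "g \<in> L1_space \<Omega>" using g by (simp add: has_weak_gradient_def)
  have uI: "integrable (lebesgue_on \<Omega>) u" using u by (simp add: L1_space_def)
  have i1: "integrable (lebesgue_on \<Omega>) (\<lambda>x. u x * (partial b \<phi> x \<bullet> b))" if b: "b \<in> Basis" for b
    using integrable_mult_bump[OF \<Omega> uI bump_partial[OF test_function_bump[OF test_function_component(1)[OF \<phi>]] b], of b]
    by (simp add: test_function_component(2)[OF \<phi>])
  have i2: "integrable (lebesgue_on \<Omega>) (\<lambda>x. (g x \<bullet> b) * (\<phi> x \<bullet> b))" for b
    by (rule integrable_inner_test_function[OF \<Omega> gL test_function_component(1)[OF \<phi>]])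
  have pw: "g x \<bullet> \<phi> x = (\<Sum>b\<in>Basis. (g x \<bullet> b) * (\<phi> x \<bullet> b))" for x
    by (rule euclidean_inner)
  have "(LINT x|lebesgue_on \<Omega>. u x * divergence \<phi> x) = (\<Sum>b\<in>Basis. LINT x|lebesgue_on \<Omega>. u x * (partial b \<phi> x \<bullet> b))"
    unfolding divergence_def sum_distrib_left using i1 by (intro Bochner_Integration.integral_sum)
  also have "\<dots> = (\<Sum>b\<in>Basis. - (LINT x|lebesgue_on \<Omega>. (g x \<bullet> b) * (\<phi> x \<bullet> b)))"
  proof (rule sum.cong)
    fix b :: 'a assume b: "b \<in> Basis"
    then show "(LINT x|lebesgue_on \<Omega>. u x * (partial b \<phi> x \<bullet> b)) = - (LINT x|lebesgue_on \<Omega>. (g x \<bullet> b) * (\<phi> x \<bullet> b))"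
      using has_weak_gradientD[OF g test_function_component(1)[OF \<phi>] b, of b]
      by (simp add: test_function_component(2)[OF \<phi>])
  qed simp
  also have "\<dots> = - (LINT x|lebesgue_on \<Omega>. g x \<bullet> \<phi> x)"
    unfolding pw using i2 by (subst Bochner_Integration.integral_sum) (auto simp: sum_negf)
  finally have "distributional_derivative \<Omega> u \<phi> = (LINT x|lebesgue_on \<Omega>. g x \<bullet> \<phi> x)"
    by (simp add: distributional_derivative_def)
  also have "\<dots> \<le> (LINT x|lebesgue_on \<Omega>. norm (g x))"
  proof (rule integral_mono)
    show "integrable (lebesgue_on \<Omega>) (\<lambda>x. g x \<bullet> \<phi> x)"
      unfolding pw using i2 by auto
    show "integrable (lebesgue_on \<Omega>) (\<lambda>x. norm (g x))" using gL by (simp add: L1_space_def)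
    fix x show "g x \<bullet> \<phi> x \<le> norm (g x)"
      using norm_cauchy_schwarz[of "g x" "\<phi> x"] mult_left_le[OF \<phi>1[of x] norm_ge_zero[of "g x"]] by linarith
  qed
  finally show "ereal (distributional_derivative \<Omega> u \<phi>) \<le> ereal (LINT x|lebesgue_on \<Omega>. norm (g x))" by simp
qed

section \<open>Strong convexity of the ROF functional\<close>

lemma finite_measure_bounded_open:
  fixes \<Omega> :: "'a::euclidean_space set"
  assumes "open \<Omega>" "bounded \<Omega>"
  shows "finite_measure (lebesgue_on \<Omega>)"
proof
  have "emeasure (lebesgue_on \<Omega>) (space (lebesgue_on \<Omega>)) = emeasure lborel \<Omega>"
    using assms by (simp add: emeasure_restrict_space space_restrict_space)
  then show "emeasure (lebesgue_on \<Omega>) (space (lebesgue_on \<Omega>)) \<noteq> \<infinity>"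
    using emeasure_bounded_finite[OF assms(2)] by simp
qed

lemma L2_spaceD:
  "u \<in> L2_space \<Omega> \<Longrightarrow> u \<in> borel_measurable (lebesgue_on \<Omega>)"
  "u \<in> L2_space \<Omega> \<Longrightarrow> integrable (lebesgue_on \<Omega>) (\<lambda>x. (u x)\<^sup>2)"
  by (simp_all add: L2_space_def)

lemma L2_diff_integrable:
  "u \<in> L2_space \<Omega> \<Longrightarrow> v \<in> L2_space \<Omega> \<Longrightarrow> integrable (lebesgue_on \<Omega>) (\<lambda>x. (u x - v x)\<^sup>2)"
  by (intro integrable_square_diff L2_spaceD)

text \<open>With the parameter s free, this replaces Cauchy-Schwarz in passing from small L^2 norm
  to small L^1 norm on a set of finite measure.\<close>

lemma abs_le_square: "s > 0 \<Longrightarrow> \<bar>w\<bar> \<le> s + w\<^sup>2 / s" for s w :: real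
proof -
  assume s: "s > 0"
  have "0 \<le> (\<bar>w\<bar> - s)\<^sup>2 + \<bar>w\<bar> * s" using s by simp
  then have "\<bar>w\<bar> * s \<le> s * s + w\<^sup>2" by (simp add: power2_eq_square algebra_simps)
  then show ?thesis using s by (simp add: field_simps)
qed

lemma integrable_if_square_integrable:
  fixes w :: "'a::euclidean_space \<Rightarrow> real"
  assumes "open \<Omega>" "bounded \<Omega>" "w \<in> borel_measurable (lebesgue_on \<Omega>)"
    and w2: "integrable (lebesgue_on \<Omega>) (\<lambda>x. (w x)\<^sup>2)"
  shows "integrable (lebesgue_on \<Omega>) w"
    and "s > 0 \<Longrightarrow> (LINT x|lebesgue_on \<Omega>. \<bar>w x\<bar>) \<le>
      s * measure (lebesgue_on \<Omega>) \<Omega> + (LINT x|lebesgue_on \<Omega>. (w x)\<^sup>2) / s"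
proof -
  interpret finite_measure "lebesgue_on \<Omega>" using finite_measure_bounded_open assms by blast
  have i: "integrable (lebesgue_on \<Omega>) (\<lambda>x. s + (w x)\<^sup>2 / s)" for s using w2 by simp
  show *: "integrable (lebesgue_on \<Omega>) w"
    by (rule Bochner_Integration.integrable_bound[OF i[of 1]])
      (use assms(3) abs_le_square[of 1] in \<open>auto intro!: AE_I2 intro: order_trans[OF _ abs_ge_self]\<close>)
  show "(LINT x|lebesgue_on \<Omega>. \<bar>w x\<bar>) \<le> s * measure (lebesgue_on \<Omega>) \<Omega> + (LINT x|lebesgue_on \<Omega>. (w x)\<^sup>2) / s"
    if "s > 0"
  proof -
    have "(LINT x|lebesgue_on \<Omega>. \<bar>w x\<bar>) \<le> (LINT x|lebesgue_on \<Omega>. s + (w x)\<^sup>2 / s)"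
      using * i abs_le_square[OF that] by (intro integral_mono) auto
    also have "\<dots> = s * measure (lebesgue_on \<Omega>) \<Omega> + (LINT x|lebesgue_on \<Omega>. (w x)\<^sup>2) / s"
      using w2 by (simp add: space_restrict_space mult.commute)
    finally show ?thesis .
  qed
qed

lemma L2_subset_L1: "open \<Omega> \<Longrightarrow> bounded \<Omega> \<Longrightarrow> u \<in> L2_space \<Omega> \<Longrightarrow> u \<in> L1_space \<Omega>"
  for u :: "'a::euclidean_space \<Rightarrow> real"
  unfolding L1_space_def using integrable_if_square_integrable(1) L2_spaceD by blast

lemma bump_L2:
  fixes v :: "'a::euclidean_space \<Rightarrow> real"
  assumes "open \<Omega>" "bump v"
  shows "v \<in> L2_space \<Omega>" "integrable (lebesgue_on \<Omega>) v"
proof -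
  show v: "integrable (lebesgue_on \<Omega>) v"
    by (rule integrable_lborel_imp_lebesgue_on[OF assms(1) bump_integrable[OF assms(2)]])
  have "integrable (lebesgue_on \<Omega>) (\<lambda>x. v x * v x)" by (rule integrable_mult_bump[OF assms(1) v assms(2)])
  then show "v \<in> L2_space \<Omega>" using v by (auto simp: L2_space_def power2_eq_square)
qed

section \<open>Total variation and the ROF energy as real numbers\<close>

lemma zero_test_function: "(\<lambda>x. 0) \<in> test_functions \<Omega>"
  using Ck_const by (auto simp: test_functions_def)

lemma total_variation_nonneg: "total_variation \<Omega> u \<ge> 0"
proof -
  have "ereal (distributional_derivative \<Omega> u (\<lambda>x. 0)) \<le> total_variation \<Omega> u"
    unfolding total_variation_def by (rule SUP_upper) (simp add: zero_test_function)
  then show ?thesis by (simp add: distributional_derivative_def divergence_def flip: zero_ereal_def)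
qed

definition unit_fields :: "'a::euclidean_space set \<Rightarrow> ('a \<Rightarrow> 'a) set" where
  "unit_fields \<Omega> = {\<phi> \<in> test_functions \<Omega>. \<forall>x. norm (\<phi> x) \<le> 1}"

lemma total_variation_le_iff:
  "total_variation \<Omega> u \<le> ereal a \<longleftrightarrow> (\<forall>\<phi>\<in>unit_fields \<Omega>. distributional_derivative \<Omega> u \<phi> \<le> a)"
  by (simp add: total_variation_def unit_fields_def SUP_le_iff)

text \<open>An infinite total variation becomes 0 under \<open>real_of_ereal\<close>; the value
  carries its meaning on \<open>BV_space\<close>, and every comparison of energies below is made
  there.\<close>

definition tv :: "'a::euclidean_space set \<Rightarrow> ('a \<Rightarrow> real) \<Rightarrow> real" where
  "tv \<Omega> u = real_of_ereal (total_variation \<Omega> u)"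

lemma BV_total_variation: "u \<in> BV_space \<Omega> \<Longrightarrow> total_variation \<Omega> u = ereal (tv \<Omega> u)"
  using total_variation_nonneg[of \<Omega> u] by (auto simp: BV_space_def tv_def ereal_real)

lemma distributional_derivative_le_tv:
  "u \<in> BV_space \<Omega> \<Longrightarrow> \<phi> \<in> unit_fields \<Omega> \<Longrightarrow> distributional_derivative \<Omega> u \<phi> \<le> tv \<Omega> u"
  using total_variation_le_iff[of \<Omega> u "tv \<Omega> u"] BV_total_variation by auto

lemma BV_intro:
  assumes "u \<in> L1_space \<Omega>" "\<And>\<phi>. \<phi> \<in> unit_fields \<Omega> \<Longrightarrow> distributional_derivative \<Omega> u \<phi> \<le> a"
  shows "u \<in> BV_space \<Omega>" "tv \<Omega> u \<le> a"
proof -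
  have le: "total_variation \<Omega> u \<le> ereal a" using assms by (simp add: total_variation_le_iff)
  then show "u \<in> BV_space \<Omega>" using assms(1) by (auto simp: BV_space_def intro: order.strict_trans1)
  then have "total_variation \<Omega> u = ereal (tv \<Omega> u)" by (rule BV_total_variation)
  then show "tv \<Omega> u \<le> a" using le by simp
qed

definition rof :: "'a::euclidean_space set \<Rightarrow> ('a \<Rightarrow> real) \<Rightarrow> real \<Rightarrow> ('a \<Rightarrow> real) \<Rightarrow> real" where
  "rof \<Omega> f \<alpha> u = fidelity \<Omega> f u + \<alpha> * tv \<Omega> u"

lemma F_ROF_eq_rof: "u \<in> BV_space \<Omega> \<inter> L2_space \<Omega> \<Longrightarrow> F_ROF \<Omega> f \<alpha> u = ereal (rof \<Omega> f \<alpha> u)"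
  by (simp add: F_ROF_def rof_def BV_total_variation)

lemma integrable_mult_divergence:
  fixes \<Omega> :: "'a::euclidean_space set"
  assumes "open \<Omega>" "u \<in> L1_space \<Omega>" "\<phi> \<in> unit_fields \<Omega>"
  shows "integrable (lebesgue_on \<Omega>) (\<lambda>x. u x * divergence \<phi> x)"
proof -
  have "bump (divergence \<phi>)"
    using assms(3) by (intro bump_divergence test_function_bump[of _ \<Omega>]) (simp add: unit_fields_def)
  then show ?thesis using assms by (intro integrable_mult_bump) (auto simp: L1_space_def)
qed

lemma tv_nonneg: "tv \<Omega> u \<ge> 0"
  unfolding tv_def by (intro real_of_ereal_pos total_variation_nonneg)

lemma fidelity_nonneg: "fidelity \<Omega> f u \<ge> 0"
  by (simp add: fidelity_def)

section \<open>Existence of the ROF minimizer\<close>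

locale rof_problem =
  fixes \<Omega> :: "'a::euclidean_space set" and f :: "'a \<Rightarrow> real" and \<alpha> :: real
  assumes \<Omega>: "open \<Omega>" "bounded \<Omega>" and f: "f \<in> L2_space \<Omega>" and \<alpha>: "\<alpha> > 0"
begin

abbreviation "admissible \<equiv> BV_space \<Omega> \<inter> L2_space \<Omega>"
abbreviation "\<mu> \<equiv> lebesgue_on \<Omega>"
abbreviation "J \<equiv> rof \<Omega> f \<alpha>"
abbreviation "dd \<equiv> distributional_derivative \<Omega>"

lemma rof_nonneg: "J u \<ge> 0"
  using \<alpha> tv_nonneg[of \<Omega> u] fidelity_nonneg[of \<Omega> f u] by (simp add: rof_def)

text \<open>The parallelogram identity gives the fidelity an exact gain of 1/4 of the squared
  distance, halved by its prefactor to 1/8. The total variation is convex as a supremum of linear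
  functionals.\<close>

lemma rof_midpoint:
  assumes u: "u \<in> admissible" and v: "v \<in> admissible"
  shows "(\<lambda>x. (u x + v x) / 2) \<in> admissible"
    and "J (\<lambda>x. (u x + v x) / 2) \<le>
      (J u + J v) / 2 - (LINT x|\<mu>. (u x - v x)\<^sup>2) / 8"
proof -
  let ?w = "\<lambda>x. (u x + v x) / 2"
  have uv: "u \<in> L2_space \<Omega>" "v \<in> L2_space \<Omega>" "u \<in> BV_space \<Omega>" "v \<in> BV_space \<Omega>" using u v by auto
  have L1: "u \<in> L1_space \<Omega>" "v \<in> L1_space \<Omega>" using uv by (auto simp: BV_space_def)
  have "integrable (\<mu>) (\<lambda>x. (u x / 2 - (- v x / 2))\<^sup>2)"
    using L2_spaceD[OF uv(1)] L2_spaceD[OF uv(2)] by (intro integrable_square_diff) (auto simp: power_divide)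
  then have w2: "?w \<in> L2_space \<Omega>"
    using L2_spaceD(1)[OF uv(1)] L2_spaceD(1)[OF uv(2)] by (auto simp: L2_space_def add_divide_distrib)
  have dd: "dd ?w \<phi> \<le> (tv \<Omega> u + tv \<Omega> v) / 2" if \<phi>: "\<phi> \<in> unit_fields \<Omega>" for \<phi>
  proof -
    have "(LINT x|\<mu>. ?w x * divergence \<phi> x) =
        (LINT x|\<mu>. (u x * divergence \<phi> x) / 2 + (v x * divergence \<phi> x) / 2)"
      by (intro Bochner_Integration.integral_cong) (auto simp: field_simps)
    also have "\<dots> = (LINT x|\<mu>. u x * divergence \<phi> x) / 2 + (LINT x|\<mu>. v x * divergence \<phi> x) / 2"
      using integrable_mult_divergence[OF \<Omega>(1) L1(1) \<phi>] integrable_mult_divergence[OF \<Omega>(1) L1(2) \<phi>] by simp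
    finally have "dd ?w \<phi> =
        dd u \<phi> / 2 + dd v \<phi> / 2"
      unfolding distributional_derivative_def by (simp only: minus_add_distrib minus_divide_left)
    then show ?thesis
      using distributional_derivative_le_tv[OF uv(3) \<phi>] distributional_derivative_le_tv[OF uv(4) \<phi>]
      by argo
  qed
  note BV = BV_intro[OF L2_subset_L1[OF \<Omega> w2] dd]
  show "?w \<in> admissible" using w2 BV(1) by blast
  have "(LINT x|\<mu>. (?w x - f x)\<^sup>2) =
      (LINT x|\<mu>. ((u x - f x)\<^sup>2 / 2 + (v x - f x)\<^sup>2 / 2) - (u x - v x)\<^sup>2 / 4)"
    by (intro Bochner_Integration.integral_cong) (auto simp: power2_eq_square field_simps)
  also have "\<dots> = ((LINT x|\<mu>. (u x - f x)\<^sup>2) / 2 + (LINT x|\<mu>. (v x - f x)\<^sup>2) / 2)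
      - (LINT x|\<mu>. (u x - v x)\<^sup>2) / 4"
    using L2_diff_integrable[OF uv(1) f] L2_diff_integrable[OF uv(2) f] L2_diff_integrable[OF uv(1,2)] by simp
  finally have "fidelity \<Omega> f ?w = (fidelity \<Omega> f u + fidelity \<Omega> f v) / 2 - (LINT x|\<mu>. (u x - v x)\<^sup>2) / 8"
    by (simp add: fidelity_def)
  moreover have "\<alpha> * tv \<Omega> ?w \<le> (\<alpha> * tv \<Omega> u + \<alpha> * tv \<Omega> v) / 2"
    using mult_left_mono[OF BV(2), of \<alpha>] \<alpha> by (simp add: field_simps)
  ultimately show "J ?w \<le> (J u + J v) / 2 - (LINT x|\<mu>. (u x - v x)\<^sup>2) / 8"
    by (simp add: rof_def field_simps)
qed

definition "m = Inf (J ` admissible)"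

lemma zero_admissible: "(\<lambda>x. 0) \<in> admissible"
proof -
  have "(\<lambda>x. 0 :: real) \<in> L2_space \<Omega>" by (simp add: L2_space_def)
  moreover have "(\<lambda>x. 0) \<in> BV_space \<Omega>"
    by (rule BV_intro(1)[of _ _ 0]) (auto simp: L1_space_def distributional_derivative_def)
  ultimately show ?thesis by blast
qed

lemma m_le: "u \<in> admissible \<Longrightarrow> m \<le> J u"
  unfolding m_def using rof_nonneg by (intro cInf_lower bdd_belowI[of _ 0]) auto

lemma almost_minimizer: "\<delta> > 0 \<Longrightarrow> \<exists>u\<in>admissible. J u < m + \<delta>"
  using cInf_lessD[of "J ` admissible" "m + \<delta>"] zero_admissible by (auto simp: m_def)

text \<open>The midpoint is admissible, so its energy is at least m; solving the midpoint inequality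
  for the distance yields the factor 8 / 2.\<close>

lemma L2_distance_le:
  assumes "u \<in> admissible" "v \<in> admissible"
  shows "(LINT x|\<mu>. (u x - v x)\<^sup>2) \<le> 4 * (J u - m) + 4 * (J v - m)"
  using rof_midpoint(2)[OF assms] m_le[OF rof_midpoint(1)[OF assms]] by (simp add: field_simps)

text \<open>Strong convexity makes a minimizing sequence a Cauchy sequence in \<open>L\<^sup>2(\<Omega>)\<close>, so no compactness is
  needed.\<close>

lemma minimizer_exists: "\<exists>u0\<in>admissible. J u0 = m"
proof -
  interpret finite_measure \<mu> using finite_measure_bounded_open \<Omega> by blast
  \<comment> \<open>Then 4 \<delta> n + 4 \<delta> n = 4^(-n) bounds the squared L^2 distance of
    consecutive terms. With s = 2^(-n) the L^1 distances are at most a multiple of 2^(-n), hence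
    summable.\<close>
  define \<delta> :: "nat \<Rightarrow> real" where "\<delta> n = (1 / 4) ^ n / 8" for n
  have \<delta>: "\<delta> n > 0" for n by (simp add: \<delta>_def)
  have "\<forall>n. \<exists>u. u \<in> admissible \<and> J u < m + \<delta> n" using almost_minimizer[OF \<delta>] by blast
  then obtain u where u: "\<And>n. u n \<in> admissible" "\<And>n. J (u n) < m + \<delta> n"
    by (meson choice)
  have uL2: "u n \<in> L2_space \<Omega>" and uBV: "u n \<in> BV_space \<Omega>" and uL1: "u n \<in> L1_space \<Omega>" for n
    using u(1)[of n] by (auto simp: BV_space_def)
  have [measurable]: "u n \<in> borel_measurable (\<mu>)" "f \<in> borel_measurable (\<mu>)" for n
    using uL2 f L2_spaceD by auto
  define g where "g n x = u (Suc n) x - u n x" for n x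
  have g_meas[measurable]: "g n \<in> borel_measurable (\<mu>)" for n unfolding g_def by measurable
  have g2: "integrable (\<mu>) (\<lambda>x. (g n x)\<^sup>2)" for n
    unfolding g_def using L2_diff_integrable uL2 by blast
  have g2_le: "(LINT x|\<mu>. (g n x)\<^sup>2) \<le> (1 / 4) ^ n" for n
  proof -
    have "4 * (J (u (Suc n)) - m) + 4 * (J (u n) - m) \<le> (1 / 4) ^ n"
    proof -
      have "\<delta> (Suc n) \<le> \<delta> n" by (simp add: \<delta>_def)
      then have "J (u (Suc n)) - m \<le> \<delta> n" "J (u n) - m \<le> \<delta> n"
        using u(2)[of n] u(2)[of "Suc n"] by linarith+
      then have "4 * (J (u (Suc n)) - m) + 4 * (J (u n) - m) \<le> 4 * \<delta> n + 4 * \<delta> n"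
        by (intro add_mono mult_left_mono) auto
      then show ?thesis by (simp add: \<delta>_def)
    qed
    then show ?thesis
      unfolding g_def by (rule order_trans[OF L2_distance_le[OF u(1)[of "Suc n"] u(1)[of n]]])
  qed
  have gI: "integrable (\<mu>) (g n)" for n
    using integrable_if_square_integrable(1)[OF \<Omega> g_meas g2] .
  define A where "A = measure (\<mu>) \<Omega>"
  have g_norm: "(LINT x|\<mu>. \<bar>g n x\<bar>) \<le> (A + 1) * (1 / 2) ^ n" for n
  proof -
    have "(LINT x|\<mu>. \<bar>g n x\<bar>) \<le> (1 / 2) ^ n * A + (LINT x|\<mu>. (g n x)\<^sup>2) / (1 / 2) ^ n"
      unfolding A_def by (rule integrable_if_square_integrable(2)[OF \<Omega> g_meas g2]) simp
    also have "(LINT x|\<mu>. (g n x)\<^sup>2) / (1 / 2) ^ n \<le> (1 / 4) ^ n / (1 / 2) ^ n"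
      by (intro divide_right_mono g2_le) simp
    also have "(1 / 4) ^ n / (1 / 2) ^ n = (1 / 2 :: real) ^ n"
      by (simp flip: power_divide)
    finally show ?thesis by (simp add: algebra_simps)
  qed
  have sum_norm: "summable (\<lambda>n. LINT x|\<mu>. norm (g n x))"
    by (rule summable_comparison_test'[of "\<lambda>n. (A + 1) * (1 / 2) ^ n" 0])
      (use g_norm in \<open>auto intro!: summable_mult summable_geometric\<close>)
  \<comment> \<open>The Riesz-Fischer argument: summable L^1 norms force absolute convergence of the
    increments almost everywhere.\<close>
  have AE_sum: "AE x in \<mu>. summable (\<lambda>n. norm (g n x))"
  proof -
    have "(\<integral>\<^sup>+x. (\<Sum>n. ennreal \<bar>g n x\<bar>) \<partial>\<mu>) = (\<Sum>n. \<integral>\<^sup>+x. ennreal \<bar>g n x\<bar> \<partial>\<mu>)"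
      by (rule nn_integral_suminf) measurable
    also have "\<dots> = (\<Sum>n. ennreal (LINT x|\<mu>. norm (g n x)))"
      using gI by (intro arg_cong[where f = suminf] ext) (simp add: nn_integral_eq_integral)
    also have "\<dots> = ennreal (\<Sum>n. LINT x|\<mu>. norm (g n x))"
      by (rule suminf_ennreal2[OF _ sum_norm]) simp
    finally have "(\<integral>\<^sup>+x. (\<Sum>n. ennreal \<bar>g n x\<bar>) \<partial>\<mu>) \<noteq> \<infinity>" by simp
    then have "AE x in \<mu>. (\<Sum>n. ennreal \<bar>g n x\<bar>) \<noteq> \<infinity>"
      by (intro nn_integral_PInf_AE) measurable
    then show ?thesis by eventually_elim (auto intro: summable_suminf_not_top)
  qed
  \<comment> \<open>An integrable majorant of all \<open>u n\<close> at once, for dominated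
    convergence against the bounded divergence of a field.\<close>
  define w where "w x = \<bar>u 0 x\<bar> + (\<Sum>n. norm (g n x))" for x
  define u' where "u' x = u 0 x + (\<Sum>n. g n x)" for x
  have wI: "integrable (\<mu>) w"
    unfolding w_def
    using uL1[of 0] gI AE_sum sum_norm by (intro Bochner_Integration.integrable_add integrable_suminf) (auto simp: L1_space_def)
  have u'I: "integrable (\<mu>) u'"
    unfolding u'_def
    using uL1[of 0] gI AE_sum sum_norm by (intro Bochner_Integration.integrable_add integrable_suminf) (auto simp: L1_space_def)
  have tel: "u n x = u 0 x + (\<Sum>k<n. g k x)" for n x
    by (induction n) (auto simp: g_def)
  have lim: "AE x in \<mu>. (\<lambda>n. u n x) \<longlonglongrightarrow> u' x"
    using AE_sum
  proof eventually_elim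
    fix x assume "summable (\<lambda>n. norm (g n x))"
    then have "(\<lambda>n. \<Sum>k<n. g k x) \<longlonglongrightarrow> (\<Sum>n. g n x)" by (rule summable_LIMSEQ[OF summable_norm_cancel])
    then have partial_sums: "(\<lambda>n. u 0 x + (\<Sum>k<n. g k x)) \<longlonglongrightarrow> u' x"
      unfolding u'_def by (intro tendsto_add tendsto_const)
    have "(\<lambda>n. u n x) = (\<lambda>n. u 0 x + (\<Sum>k<n. g k x))" by (intro ext tel)
    then show "(\<lambda>n. u n x) \<longlonglongrightarrow> u' x" by (rule ssubst) (rule partial_sums)
  qed
  have dom_w: "AE x in \<mu>. norm (u n x) \<le> w x" for n
    using AE_sum
  proof eventually_elim
    fix x assume s: "summable (\<lambda>n. norm (g n x))"
    have "norm (u n x) \<le> norm (u 0 x) + norm (\<Sum>k<n. g k x)" unfolding tel[of n x] by (rule norm_triangle_ineq)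
    also have "norm (\<Sum>k<n. g k x) \<le> (\<Sum>k<n. norm (g k x))" by (rule norm_sum)
    also have "\<dots> \<le> (\<Sum>n. norm (g n x))" by (rule sum_le_suminf[OF s]) auto
    finally show "norm (u n x) \<le> w x" by (simp add: w_def)
  qed
  have dd_lim: "(\<lambda>n. dd (u n) \<phi>) \<longlonglongrightarrow> dd u' \<phi>"
    if \<phi>: "\<phi> \<in> unit_fields \<Omega>" for \<phi>
  proof -
    have b: "bump (divergence \<phi>)" using \<phi> bump_divergence test_function_bump by (auto simp: unit_fields_def)
    obtain B where B: "\<And>x. norm (divergence \<phi> x) \<le> B" using bump_bounded[OF b] by blast
    have "(\<lambda>n. LINT x|\<mu>. u n x * divergence \<phi> x) \<longlonglongrightarrow> (LINT x|\<mu>. u' x * divergence \<phi> x)"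
    proof (rule integral_dominated_convergence[where w = "\<lambda>x. w x * B"])
      show "(\<lambda>x. u' x * divergence \<phi> x) \<in> borel_measurable (\<mu>)"
        using integrable_mult_bump[OF \<Omega>(1) u'I b] by auto
      show "(\<lambda>x. u n x * divergence \<phi> x) \<in> borel_measurable (\<mu>)" for n
        using integrable_mult_bump[OF \<Omega>(1) _ b, of "u n"] uL1[of n] by (auto simp: L1_space_def)
      show "AE x in \<mu>. (\<lambda>n. u n x * divergence \<phi> x) \<longlonglongrightarrow> u' x * divergence \<phi> x"
        using lim by eventually_elim (intro tendsto_intros)
      show "AE x in \<mu>. norm (u n x * divergence \<phi> x) \<le> w x * B" for n
        using dom_w[of n]
      proof eventually_elim
        fix x assume "norm (u n x) \<le> w x"
        then show "norm (u n x * divergence \<phi> x) \<le> w x * B"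
          unfolding norm_mult using B[of x] by (intro mult_mono) (auto intro: order_trans[OF norm_ge_zero])
      qed
    qed (use wI in auto)
    then show ?thesis unfolding distributional_derivative_def by (rule tendsto_minus)
  qed
  \<comment> \<open>Lower semicontinuity is proved for one field at a time: with the total variation
    replaced by its pairing with \<open>\<phi>\<close>, this bounds the fidelity. Fatou then treats
    the fidelity and dominated convergence the pairing; the supremum over fields comes last.\<close>
  define c where "c \<phi> n = m + \<delta> n - \<alpha> * dd (u n) \<phi>" for \<phi> n
  have fid_le: "fidelity \<Omega> f (u n) \<le> c \<phi> n" if \<phi>: "\<phi> \<in> unit_fields \<Omega>" for \<phi> n
  proof -
    have "\<alpha> * dd (u n) \<phi> \<le> \<alpha> * tv \<Omega> (u n)"
      using \<alpha> by (intro mult_left_mono distributional_derivative_le_tv[OF uBV \<phi>]) simp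
    then show ?thesis using u(2)[of n] by (simp add: c_def rof_def)
  qed
  have c_lim: "c \<phi> \<longlonglongrightarrow> m - \<alpha> * dd u' \<phi>" if \<phi>: "\<phi> \<in> unit_fields \<Omega>" for \<phi>
  proof -
    have "(\<lambda>n. (1 / 4 :: real) ^ n / 8) \<longlonglongrightarrow> 0 / 8" by (intro tendsto_divide LIMSEQ_power_zero tendsto_const) auto
    then have "\<delta> \<longlonglongrightarrow> 0" by (simp add: \<delta>_def[abs_def])
    then have "c \<phi> \<longlonglongrightarrow> m + 0 - \<alpha> * dd u' \<phi>"
      unfolding c_def by (intro tendsto_intros dd_lim[OF \<phi>])
    then show ?thesis by simp
  qed
  \<comment> \<open>\<open>ennreal\<close> truncates negative reals to 0, so nonnegativity is
    required to return from the Fatou bound to a real inequality.\<close>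
  have c_nonneg: "0 \<le> m - \<alpha> * dd u' \<phi>" if \<phi>: "\<phi> \<in> unit_fields \<Omega>" for \<phi>
    using order_trans[OF fidelity_nonneg fid_le[OF \<phi>]] by (intro LIMSEQ_le[OF tendsto_const c_lim[OF \<phi>]]) blast
  have fid: "(\<integral>\<^sup>+x. ennreal ((u' x - f x)\<^sup>2) \<partial>\<mu>) \<le> ennreal (2 * (m - \<alpha> * dd u' \<phi>))"
    if \<phi>: "\<phi> \<in> unit_fields \<Omega>" for \<phi>
  proof -
    have "(\<integral>\<^sup>+x. ennreal ((u' x - f x)\<^sup>2) \<partial>\<mu>) =
        (\<integral>\<^sup>+x. liminf (\<lambda>n. ennreal ((u n x - f x)\<^sup>2)) \<partial>\<mu>)"
    proof (rule nn_integral_cong_AE)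
      show "AE x in \<mu>. ennreal ((u' x - f x)\<^sup>2) = liminf (\<lambda>n. ennreal ((u n x - f x)\<^sup>2))"
        using lim
      proof eventually_elim
        fix x assume "(\<lambda>n. u n x) \<longlonglongrightarrow> u' x"
        then have "(\<lambda>n. ennreal ((u n x - f x)\<^sup>2)) \<longlonglongrightarrow> ennreal ((u' x - f x)\<^sup>2)"
          by (intro tendsto_ennrealI tendsto_intros)
        then show "ennreal ((u' x - f x)\<^sup>2) = liminf (\<lambda>n. ennreal ((u n x - f x)\<^sup>2))"
          by (intro lim_imp_Liminf[symmetric]) auto
      qed
    qed
    also have "\<dots> \<le> liminf (\<lambda>n. \<integral>\<^sup>+x. ennreal ((u n x - f x)\<^sup>2) \<partial>\<mu>)"
      by (rule nn_integral_liminf) measurable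
    also have "\<dots> \<le> liminf (\<lambda>n. ennreal (2 * c \<phi> n))"
    proof (intro Liminf_mono always_eventually allI)
      fix n show "(\<integral>\<^sup>+x. ennreal ((u n x - f x)\<^sup>2) \<partial>\<mu>) \<le> ennreal (2 * c \<phi> n)"
        using L2_diff_integrable[OF uL2[of n] f] fid_le[OF \<phi>, of n]
        by (subst nn_integral_eq_integral) (auto intro: ennreal_leI simp: fidelity_def)
    qed
    also have "\<dots> = ennreal (2 * (m - \<alpha> * dd u' \<phi>))"
      by (intro lim_imp_Liminf tendsto_ennrealI tendsto_mult tendsto_const c_lim[OF \<phi>]) auto
    finally show ?thesis .
  qed
  have [measurable]: "u' \<in> borel_measurable (\<mu>)" using u'I by auto
  \<comment> \<open>The zero field already gives a finite bound, from which square integrability of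
    the limit follows.\<close>
  have 0: "(\<lambda>x. 0) \<in> unit_fields \<Omega>" by (simp add: unit_fields_def zero_test_function)
  have sq: "integrable (\<mu>) (\<lambda>x. (u' x - f x)\<^sup>2)"
    using fid[OF 0] by (intro integrableI_bounded) (auto intro: order.strict_trans1)
  have "integrable (\<mu>) (\<lambda>x. ((u' x - f x) - (- f x))\<^sup>2)"
    by (rule integrable_square_diff) (use L2_spaceD[OF f] sq in simp_all)
  then have u'L2: "u' \<in> L2_space \<Omega>" by (simp add: L2_space_def)
  have "fidelity \<Omega> f u' + \<alpha> * dd u' \<phi> \<le> m" if \<phi>: "\<phi> \<in> unit_fields \<Omega>" for \<phi>
  proof -
    have "ennreal (LINT x|\<mu>. (u' x - f x)\<^sup>2) \<le> ennreal (2 * (m - \<alpha> * dd u' \<phi>))"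
      using fid[OF \<phi>] sq by (simp add: nn_integral_eq_integral)
    then have "(LINT x|\<mu>. (u' x - f x)\<^sup>2) \<le> 2 * (m - \<alpha> * dd u' \<phi>)"
      using c_nonneg[OF \<phi>] by (subst (asm) ennreal_le_iff) auto
    then show ?thesis by (simp add: fidelity_def)
  qed
  then have "dd u' \<phi> \<le> (m - fidelity \<Omega> f u') / \<alpha>" if "\<phi> \<in> unit_fields \<Omega>" for \<phi>
    using that \<alpha> by (simp add: pos_le_divide_eq mult.commute[of _ \<alpha>] algebra_simps)
  note BV = BV_intro[OF L2_subset_L1[OF \<Omega> u'L2] this]
  have "u' \<in> admissible" using BV(1) u'L2 by blast
  moreover have "J u' \<le> m"
    using BV(2) \<alpha> by (simp add: rof_def pos_le_divide_eq mult.commute)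
  ultimately show ?thesis using m_le by (intro bexI[of _ u']) (auto intro: antisym)
qed

end

section \<open>Convergence of minimizers\<close>

lemma log_plus_nonneg: "0 \<le> log_plus r"
  by (simp add: log_plus_def)

lemma log_plus_mono: "r \<le> s \<Longrightarrow> log_plus r \<le> log_plus s"
  by (auto simp: log_plus_def max_def)

lemma phi_ge: "\<alpha> > 0 \<Longrightarrow> \<gamma> > 0 \<Longrightarrow> t \<ge> 0 \<Longrightarrow> \<alpha> * t \<le> phi \<alpha> \<kappa> \<gamma> x t"
  using mult_left_mono[of 1 "1 + \<gamma> * log_plus (t / \<kappa> x)" "\<alpha> * t"] by (simp add: phi_def log_plus_nonneg)

lemma weak_gradient_works:
  "u \<in> W11_space \<Omega> \<Longrightarrow> has_weak_gradient \<Omega> u (weak_gradient \<Omega> u)"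
  unfolding W11_space_def weak_gradient_def using someI_ex[of "has_weak_gradient \<Omega> u"] by auto

context rof_problem
begin

lemma rof_le_F_gamma:
  assumes \<gamma>: "\<gamma> > 0" and u: "u \<in> X_space \<Omega> \<alpha> \<kappa> \<gamma>"
  shows "u \<in> admissible" "ereal (J u) \<le> F_gamma \<Omega> f \<alpha> \<kappa> \<gamma> u"
proof -
  let ?g = "weak_gradient \<Omega> u"
  have uL2: "u \<in> L2_space \<Omega>" and g: "has_weak_gradient \<Omega> u ?g" and uL1: "u \<in> L1_space \<Omega>"
    using u weak_gradient_works[of u \<Omega>] by (auto simp: X_space_def W11_space_def)
  define a where "a = (LINT x|\<mu>. norm (?g x))"
  have gI: "integrable (\<mu>) (\<lambda>x. norm (?g x))"
    using g by (simp add: has_weak_gradient_def L1_space_def)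
  have le: "total_variation \<Omega> u \<le> ereal a"
    unfolding a_def by (rule total_variation_le_weak_gradient[OF \<Omega>(1) uL1 g])
  then have "u \<in> BV_space \<Omega>" "tv \<Omega> u \<le> a"
    using BV_intro[OF uL1, of a] by (auto simp: total_variation_le_iff)
  then show "u \<in> admissible" using uL2 by blast
  have "a \<ge> 0" by (simp add: a_def)
  have "ennreal (\<alpha> * a) = (\<integral>\<^sup>+x. ennreal (\<alpha> * norm (?g x)) \<partial>\<mu>)"
    unfolding a_def using gI \<alpha> by (subst nn_integral_eq_integral) auto
  also have "\<dots> \<le> phi_energy \<Omega> \<alpha> \<kappa> \<gamma> u"
    unfolding phi_energy_def by (intro nn_integral_mono ennreal_leI phi_ge \<alpha> \<gamma> norm_ge_zero)
  finally have "enn2ereal (ennreal (\<alpha> * a)) \<le> enn2ereal (phi_energy \<Omega> \<alpha> \<kappa> \<gamma> u)"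
    by (simp add: less_eq_ennreal.rep_eq)
  then have "ereal (\<alpha> * a) \<le> enn2ereal (phi_energy \<Omega> \<alpha> \<kappa> \<gamma> u)"
    using \<open>a \<ge> 0\<close> \<alpha> by (simp add: enn2ereal_ennreal)
  moreover have "\<alpha> * tv \<Omega> u \<le> \<alpha> * a" using \<open>tv \<Omega> u \<le> a\<close> \<alpha> by (intro mult_left_mono) auto
  ultimately have "ereal (\<alpha> * tv \<Omega> u) \<le> enn2ereal (phi_energy \<Omega> \<alpha> \<kappa> \<gamma> u)"
    by (meson ereal_less_eq(3) order_trans)
  then have "ereal (fidelity \<Omega> f u) + ereal (\<alpha> * tv \<Omega> u) \<le> ereal (fidelity \<Omega> f u) + enn2ereal (phi_energy \<Omega> \<alpha> \<kappa> \<gamma> u)"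
    by (intro add_left_mono)
  then show "ereal (J u) \<le> F_gamma \<Omega> f \<alpha> \<kappa> \<gamma> u"
    using u by (simp add: F_gamma_def rof_def)
qed

text \<open>Since \<open>log_plus\<close> is monotone, the bounds on the gradient and on \<kappa>
  dominate the logarithmic term by one constant, integrated over a set of finite measure.\<close>

lemma F_gamma_bump_le:
  assumes \<gamma>: "\<gamma> > 0" and v: "bump v" and \<kappa>: "0 < \<kappa>_lo" "AE x in \<mu>. \<kappa>_lo \<le> \<kappa> x"
    and M: "\<And>x. norm (gradient v x) \<le> M"
  shows "F_gamma \<Omega> f \<alpha> \<kappa> \<gamma> v \<le> ereal (fidelity \<Omega> f v +
    \<alpha> * (LINT x|lborel. indicator \<Omega> x * norm (gradient v x)) +
    \<gamma> * (\<alpha> * M * log_plus (M / \<kappa>_lo) * measure (\<mu>) \<Omega>))"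
proof -
  interpret finite_measure \<mu> using finite_measure_bounded_open \<Omega> by blast
  define L where "L = \<alpha> * M * log_plus (M / \<kappa>_lo)"
  have M0: "M \<ge> 0" using M[of 0] norm_ge_zero order_trans by blast
  have L0: "L \<ge> 0" using M0 \<alpha> log_plus_nonneg by (simp add: L_def)
  note wg = bump_has_weak_gradient[OF \<Omega>(1) v]
  note vL2 = bump_L2(1)[OF \<Omega>(1) v]
  have vW: "v \<in> W11_space \<Omega>" using bump_L2(2)[OF \<Omega>(1) v] wg by (auto simp: W11_space_def L1_space_def)
  have gI: "integrable (\<mu>) (\<lambda>x. norm (gradient v x))"
    using wg by (simp add: has_weak_gradient_def L1_space_def)
  have eq: "(LINT x|\<mu>. norm (gradient v x)) = (LINT x|lborel. indicator \<Omega> x * norm (gradient v x))"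
  proof -
    have [measurable]: "gradient v \<in> borel_measurable borel" "\<Omega> \<in> sets borel"
      using bump_measurable[OF bump_gradient[OF v]] \<Omega> by auto
    have "(LINT x|\<mu>. norm (gradient v x)) = (LINT x|\<mu>. indicator \<Omega> x * norm (gradient v x))"
      by (intro Bochner_Integration.integral_cong) (auto simp: space_restrict_space)
    also have "\<dots> = (LINT x|lborel. indicator \<Omega> x * norm (gradient v x))"
      by (rule integral_lebesgue_on_eq_lborel[OF \<Omega>(1)]) auto
    finally show ?thesis .
  qed
  have "AE x in \<mu>. phi \<alpha> \<kappa> \<gamma> x (norm (weak_gradient \<Omega> v x)) \<le> \<alpha> * norm (gradient v x) + \<gamma> * L"
    \<comment> \<open>The energy is written with the chosen weak gradient; almost everywhere it may
      be replaced by the classical one.\<close>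
    using weak_gradient_unique[OF \<Omega>(1) weak_gradient_works[OF vW] wg] \<kappa>(2)
  proof eventually_elim
    fix x assume x: "weak_gradient \<Omega> v x = gradient v x" "\<kappa>_lo \<le> \<kappa> x"
    have "norm (gradient v x) / \<kappa> x \<le> M / \<kappa>_lo"
      using x(2) \<kappa>(1) M[of x] M0 by (intro frac_le) auto
    then have "norm (gradient v x) * log_plus (norm (gradient v x) / \<kappa> x) \<le> M * log_plus (M / \<kappa>_lo)"
      using M[of x] M0 log_plus_nonneg by (intro mult_mono log_plus_mono) auto
    then have "\<gamma> * (\<alpha> * (norm (gradient v x) * log_plus (norm (gradient v x) / \<kappa> x))) \<le> \<gamma> * (\<alpha> * (M * log_plus (M / \<kappa>_lo)))"
      using \<alpha> \<gamma> by (intro mult_left_mono) auto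
    then show "phi \<alpha> \<kappa> \<gamma> x (norm (weak_gradient \<Omega> v x)) \<le> \<alpha> * norm (gradient v x) + \<gamma> * L"
      by (simp add: phi_def x(1) L_def algebra_simps)
  qed
  then have "phi_energy \<Omega> \<alpha> \<kappa> \<gamma> v \<le> (\<integral>\<^sup>+x. ennreal (\<alpha> * norm (gradient v x) + \<gamma> * L) \<partial>\<mu>)"
    unfolding phi_energy_def by (intro nn_integral_mono_AE) (auto elim!: eventually_mono intro: ennreal_leI)
  also have "\<dots> = ennreal (LINT x|\<mu>. \<alpha> * norm (gradient v x) + \<gamma> * L)"
    using gI \<alpha> \<gamma> L0 by (intro nn_integral_eq_integral) auto
  also have "(LINT x|\<mu>. \<alpha> * norm (gradient v x) + \<gamma> * L) =
      \<alpha> * (LINT x|lborel. indicator \<Omega> x * norm (gradient v x)) + \<gamma> * (L * measure (\<mu>) \<Omega>)"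
    using gI by (simp add: eq space_restrict_space mult_ac)
  finally have le: "phi_energy \<Omega> \<alpha> \<kappa> \<gamma> v \<le> ennreal (\<alpha> * (LINT x|lborel. indicator \<Omega> x * norm (gradient v x)) + \<gamma> * (L * measure (\<mu>) \<Omega>))"
    (is "_ \<le> ennreal ?e") .
  then have X: "v \<in> X_space \<Omega> \<alpha> \<kappa> \<gamma>"
    using vL2 vW by (auto simp: X_space_def intro: order.strict_trans1)
  have "?e \<ge> 0" using \<alpha> \<gamma> L0 by (auto intro!: add_nonneg_nonneg mult_nonneg_nonneg)
  have "enn2ereal (phi_energy \<Omega> \<alpha> \<kappa> \<gamma> v) \<le> enn2ereal (ennreal ?e)" using le by (simp add: less_eq_ennreal.rep_eq)
  also have "\<dots> = ereal ?e" using \<open>?e \<ge> 0\<close> by (rule enn2ereal_ennreal)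
  finally have "ereal (fidelity \<Omega> f v) + enn2ereal (phi_energy \<Omega> \<alpha> \<kappa> \<gamma> v) \<le> ereal (fidelity \<Omega> f v) + ereal ?e"
    by (rule add_left_mono)
  then show ?thesis using X by (simp add: F_gamma_def L_def add.assoc)
qed

text \<open>Young's inequality 2ab \<le> s a^2 + b^2 / s, applied pointwise, takes the place of the
  triangle inequality for the L^2 norm and keeps everything in squares.\<close>

lemma fidelity_perturbation:
  assumes u: "u \<in> L2_space \<Omega>" and v: "v \<in> L2_space \<Omega>" and "s > 0"
  shows "fidelity \<Omega> f v \<le> (1 + s) * fidelity \<Omega> f u + (1 + 1 / s) / 2 * (LINT x|\<mu>. (v x - u x)\<^sup>2)"
proof -
  have pw: "(v x - f x)\<^sup>2 \<le> (1 + s) * (u x - f x)\<^sup>2 + (1 + 1 / s) * (v x - u x)\<^sup>2" for x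
  proof -
    define a b where "a = u x - f x" and "b = v x - u x"
    have "0 \<le> (s * a - b)\<^sup>2 / s" using \<open>s > 0\<close> by simp
    also have "\<dots> = s * a\<^sup>2 - 2 * a * b + b\<^sup>2 / s"
      using \<open>s > 0\<close> by (simp add: power2_eq_square field_simps)
    finally have "(a + b)\<^sup>2 \<le> (1 + s) * a\<^sup>2 + (1 + 1 / s) * b\<^sup>2"
      by (simp add: power2_eq_square algebra_simps)
    then show ?thesis by (simp add: a_def b_def)
  qed
  have "(LINT x|\<mu>. (v x - f x)\<^sup>2) \<le>
      (LINT x|\<mu>. (1 + s) * (u x - f x)\<^sup>2 + (1 + 1 / s) * (v x - u x)\<^sup>2)"
    using L2_diff_integrable[OF v f] L2_diff_integrable[OF u f] L2_diff_integrable[OF v u] pw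
    by (intro integral_mono) auto
  also have "\<dots> = (1 + s) * (LINT x|\<mu>. (u x - f x)\<^sup>2) + (1 + 1 / s) * (LINT x|\<mu>. (v x - u x)\<^sup>2)"
    using L2_diff_integrable[OF u f] L2_diff_integrable[OF v u] by simp
  finally show ?thesis by (simp add: fidelity_def)
qed

text \<open>The recovery function has a bounded gradient, so its logarithmic energy is linear in \<open>\<gamma>\<close>.\<close>

lemma F_gamma_recovery:
  assumes "bounded_lipschitz_domain \<Omega>" and \<kappa>: "0 < \<kappa>_lo" "AE x in \<mu>. \<kappa>_lo \<le> \<kappa> x"
    and "\<eta> > 0"
  shows "\<exists>v\<in>L1_space \<Omega>. \<exists>C. \<forall>\<gamma>>0. F_gamma \<Omega> f \<alpha> \<kappa> \<gamma> v \<le> ereal (m + \<eta> + \<gamma> * C)"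
proof -
  obtain u where u: "u \<in> admissible" and u_min: "J u = m" using minimizer_exists by blast
  have uL2: "u \<in> L2_space \<Omega>" and uBV: "u \<in> BV_space \<Omega>" using u by auto
  obtain U where U_meas[measurable]: "U \<in> borel_measurable borel" and U0: "\<And>x. x \<notin> \<Omega> \<Longrightarrow> U x = 0"
    and Uu: "AE x in \<mu>. U x = u x"
    by (rule borel_representative[OF \<Omega>(1) L2_spaceD(1)[OF uL2]], rule that)
  note U_on = borel_measurable_lebesgue_on[OF U_meas] and u_on = L2_spaceD(1)[OF uL2]
  have "integrable (\<mu>) U"
  proof -
    have "integrable (\<mu>) u" using uBV by (simp add: BV_space_def L1_space_def)
    then show ?thesis using integrable_cong_AE[OF U_on u_on Uu] by simp
  qed
  then have U1: "integrable lborel U" using integral_lebesgue_on_eq_lborel(2)[OF \<Omega>(1) U_meas U0] by simp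
  have "integrable (\<mu>) (\<lambda>x. (U x)\<^sup>2)"
  proof -
    have "AE x in \<mu>. (U x)\<^sup>2 = (u x)\<^sup>2" using Uu by eventually_elim simp
    then show ?thesis
      using L2_spaceD(2)[OF uL2] U_on u_on by (subst integrable_cong_AE[of _ _ "\<lambda>x. (u x)\<^sup>2"]) auto
  qed
  then have U2: "integrable lborel (\<lambda>x. (U x)\<^sup>2)"
    using integral_lebesgue_on_eq_lborel(2)[OF \<Omega>(1), of "\<lambda>x. (U x)\<^sup>2"] U0 by simp
  have TV: "- (LINT y|lborel. U y * divergence \<psi> y) \<le> tv \<Omega> u"
    if \<psi>: "\<psi> \<in> test_functions \<Omega>" "\<And>x. norm (\<psi> x) \<le> 1" for \<psi>
  proof -
    have [measurable]: "divergence \<psi> \<in> borel_measurable borel"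
      by (rule bump_measurable[OF bump_divergence[OF test_function_bump[OF \<psi>(1)]]])
    have "(LINT y|lborel. U y * divergence \<psi> y) = (LINT y|\<mu>. U y * divergence \<psi> y)"
      using U0 by (intro integral_lebesgue_on_eq_lborel(1)[symmetric] \<Omega>) auto
    also have "\<dots> = (LINT y|\<mu>. u y * divergence \<psi> y)"
      using Uu U_on u_on borel_measurable_lebesgue_on[of "divergence \<psi>"] by (intro integral_cong_AE) auto
    finally show ?thesis
      using distributional_derivative_le_tv[OF uBV, of \<psi>] \<psi> by (simp add: distributional_derivative_def unit_fields_def)
  qed
  \<comment> \<open>The Young parameter is chosen so that the relative loss in the fidelity of
    \<open>u\<close> costs at most \<eta> / 4; the added 1 covers zero fidelity.\<close>
  define s where "s = \<eta> / (4 * (fidelity \<Omega> f u + 1))"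
  have s: "s > 0" "s * fidelity \<Omega> f u \<le> \<eta> / 4"
    using \<open>\<eta> > 0\<close> fidelity_nonneg[of \<Omega> f u] by (auto simp: s_def field_simps)
  \<comment> \<open>The first entry pays for the gradient, the second for the L^2 error at the
    chosen s. Together the losses are at most \<eta> / 4 + \<eta> / 8 + \<eta> / 4.\<close>
  define \<delta> where "\<delta> = min (\<eta> / (4 * \<alpha>)) (\<eta> / (4 * (1 + 1 / s)))"
  have "1 + 1 / s > 0" using s(1) by (simp add: add_pos_pos)
  then have \<delta>: "\<delta> > 0" "\<alpha> * \<delta> \<le> \<eta> / 4" "(1 + 1 / s) * \<delta> \<le> \<eta> / 4"
  proof -
    show "\<delta> > 0" using \<open>\<eta> > 0\<close> \<alpha> \<open>1 + 1 / s > 0\<close> by (simp add: \<delta>_def)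
    have le: "q * \<delta> \<le> \<eta> / 4" if "q > 0" "\<delta> \<le> \<eta> / (4 * q)" for q
      using that by (simp add: field_simps)
    show "\<alpha> * \<delta> \<le> \<eta> / 4" "(1 + 1 / s) * \<delta> \<le> \<eta> / 4"
      by (rule le; use \<alpha> \<open>1 + 1 / s > 0\<close> in \<open>simp add: \<delta>_def\<close>)+
  qed
  obtain v where v: "bump v" "(LINT x|lborel. indicator \<Omega> x * norm (gradient v x)) \<le> tv \<Omega> u + \<delta>"
    "(\<integral>\<^sup>+x. ennreal ((v x - U x)\<^sup>2) \<partial>lborel) \<le> ennreal \<delta>"
    using BV_smooth_recovery[OF assms(1) U1 U2 U0 TV \<delta>(1)] by blast
  note vL2 = bump_L2(1)[OF \<Omega>(1) v(1)]
  have dist: "(LINT x|\<mu>. (v x - u x)\<^sup>2) \<le> \<delta>"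
  proof -
    have "ennreal (LINT x|\<mu>. (v x - u x)\<^sup>2) = (\<integral>\<^sup>+x. ennreal ((v x - u x)\<^sup>2) \<partial>\<mu>)"
      using L2_diff_integrable[OF vL2 uL2] by (simp add: nn_integral_eq_integral)
    also have "\<dots> = (\<integral>\<^sup>+x. ennreal ((v x - U x)\<^sup>2) \<partial>\<mu>)"
      using Uu by (intro nn_integral_cong_AE) (auto elim!: eventually_mono)
    also have "\<dots> \<le> (\<integral>\<^sup>+x. ennreal ((v x - U x)\<^sup>2) \<partial>lborel)" by (rule nn_integral_lebesgue_on_le_lborel[OF \<Omega>(1)])
    also have "\<dots> \<le> ennreal \<delta>" by (rule v(3))
    finally show ?thesis using \<delta>(1) by (simp add: ennreal_le_iff)
  qed
  have "fidelity \<Omega> f v \<le> (1 + s) * fidelity \<Omega> f u + (1 + 1 / s) / 2 * (LINT x|\<mu>. (v x - u x)\<^sup>2)"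
    by (rule fidelity_perturbation[OF uL2 vL2 s(1)])
  also have "(1 + 1 / s) / 2 * (LINT x|\<mu>. (v x - u x)\<^sup>2) \<le> (1 + 1 / s) / 2 * \<delta>"
    using dist \<open>1 + 1 / s > 0\<close> by (intro mult_left_mono) auto
  also have "(1 + s) * fidelity \<Omega> f u \<le> fidelity \<Omega> f u + \<eta> / 4"
    using s(2) by (simp add: distrib_right)
  also have "(1 + 1 / s) / 2 * \<delta> \<le> \<eta> / 4 / 2"
    unfolding times_divide_eq_left using \<delta>(3) by (rule divide_right_mono) simp
  finally have fid: "fidelity \<Omega> f v \<le> fidelity \<Omega> f u + \<eta> / 4 + \<eta> / 4 / 2" by simp
  have "\<alpha> * (LINT x|lborel. indicator \<Omega> x * norm (gradient v x)) \<le> \<alpha> * (tv \<Omega> u + \<delta>)"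
    using v(2) \<alpha> by (intro mult_left_mono) auto
  then have grad: "\<alpha> * (LINT x|lborel. indicator \<Omega> x * norm (gradient v x)) \<le> \<alpha> * tv \<Omega> u + \<eta> / 4"
    using \<delta>(2) by (simp add: distrib_left)
  have m_eq: "m = fidelity \<Omega> f u + \<alpha> * tv \<Omega> u" using u_min by (simp add: rof_def)
  obtain M where M: "\<And>x. norm (gradient v x) \<le> M" using bump_bounded[OF bump_gradient[OF v(1)]] by blast
  have "F_gamma \<Omega> f \<alpha> \<kappa> \<gamma> v \<le>
      ereal (m + \<eta> + \<gamma> * (\<alpha> * M * log_plus (M / \<kappa>_lo) * measure (\<mu>) \<Omega>))" if "\<gamma> > 0" for \<gamma>
    by (rule order_trans[OF F_gamma_bump_le[OF that v(1) \<kappa> M]])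
      (use fid grad m_eq \<open>\<eta> > 0\<close> in simp)
  moreover have "v \<in> L1_space \<Omega>" using bump_L2(2)[OF \<Omega>(1) v(1)] by (simp add: L1_space_def)
  ultimately show ?thesis by blast
qed

section \<open>Uniqueness and convergence\<close>

lemma is_unique_minimizer:
  assumes u0: "u0 \<in> admissible" "J u0 = m"
  shows "is_unique_L1_minimizer \<Omega> (F_ROF \<Omega> f \<alpha>) u0"
proof -
  have F0: "F_ROF \<Omega> f \<alpha> u0 = ereal m" using F_ROF_eq_rof[OF u0(1)] u0(2) by simp
  have "F_ROF \<Omega> f \<alpha> u0 \<le> F_ROF \<Omega> f \<alpha> v" for v
  proof (cases "v \<in> admissible")
    case True
    then show ?thesis using F0 F_ROF_eq_rof[OF True] m_le[OF True] by simp
  next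
    case False
    then have "F_ROF \<Omega> f \<alpha> v = \<infinity>" unfolding F_ROF_def by (rule if_not_P)
    then show ?thesis by simp
  qed
  moreover have u0L1: "u0 \<in> L1_space \<Omega>" using u0 by (simp add: BV_space_def)
  moreover have "AE x in \<mu>. v x = u0 x" if v: "is_L1_minimizer \<Omega> (F_ROF \<Omega> f \<alpha>) v" for v
  proof -
    have le: "F_ROF \<Omega> f \<alpha> v \<le> ereal m" using v u0L1 F0 by (auto simp: is_L1_minimizer_def)
    have vd: "v \<in> admissible"
    proof (rule ccontr)
      assume "v \<notin> admissible"
      then have "F_ROF \<Omega> f \<alpha> v = \<infinity>" unfolding F_ROF_def by (rule if_not_P)
      then show False using le by simp
    qed
    then have "J v \<le> m" using le F_ROF_eq_rof[OF vd] by simp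
    then have "(LINT x|\<mu>. (v x - u0 x)\<^sup>2) \<le> 0" using L2_distance_le[OF vd u0(1)] u0(2) by simp
    then have "(LINT x|\<mu>. (v x - u0 x)\<^sup>2) = 0"
      by (intro antisym integral_nonneg_AE) auto
    moreover have "integrable (\<mu>) (\<lambda>x. (v x - u0 x)\<^sup>2)"
      using vd u0(1) by (intro L2_diff_integrable) auto
    ultimately have "AE x in \<mu>. (v x - u0 x)\<^sup>2 = 0"
      by (subst (asm) integral_nonneg_eq_0_iff_AE) auto
    then show ?thesis by eventually_elim simp
  qed
  ultimately show ?thesis by (auto simp: is_unique_L1_minimizer_def is_L1_minimizer_def)
qed

lemma asymptotic_minimizers_tendsto:
  assumes dom: "bounded_lipschitz_domain \<Omega>" and \<kappa>: "0 < \<kappa>_lo" "AE x in \<mu>. \<kappa>_lo \<le> \<kappa> x"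
    and u0: "u0 \<in> admissible" "J u0 = m"
    and u: "asymptotic_minimizers \<Omega> (F_gamma \<Omega> f \<alpha> \<kappa>) u"
  shows "tendsto_L1 \<Omega> u u0 (at_right 0)"
proof -
  obtain \<epsilon> :: "real \<Rightarrow> real" where \<epsilon>: "(\<epsilon> \<longlongrightarrow> 0) (at_right 0)"
    and u_le: "\<forall>\<^sub>F \<gamma> in at_right 0. F_gamma \<Omega> f \<alpha> \<kappa> \<gamma> (u \<gamma>) \<le> (INF v\<in>L1_space \<Omega>. F_gamma \<Omega> f \<alpha> \<kappa> \<gamma> v) + ereal (\<epsilon> \<gamma>)"
    and uL1: "\<And>\<gamma>. \<gamma> > 0 \<Longrightarrow> u \<gamma> \<in> L1_space \<Omega>"
    using u by (auto simp: asymptotic_minimizers_def)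
  have pos: "\<forall>\<^sub>F \<gamma> in at_right (0::real). \<gamma> > 0" by (simp add: eventually_at_filter)
  \<comment> \<open>With \<eta> fixed, \<open>v\<close> and \<open>C\<close> are fixed too, and for
    small \<gamma> the errors \<open>\<gamma> * C + \<epsilon> \<gamma>\<close> drop below \<eta>.
    The energy of \<open>u \<gamma>\<close> is then within 2 \<eta> of m, and the factor 4 of strong
    convexity gives 8 \<eta>.\<close>
  have close: "\<forall>\<^sub>F \<gamma> in at_right 0. u \<gamma> \<in> admissible \<and> (LINT x|\<mu>. (u \<gamma> x - u0 x)\<^sup>2) \<le> 8 * \<eta>"
    if \<eta>: "\<eta> > 0" for \<eta>
  proof -
    obtain v C where v: "v \<in> L1_space \<Omega>" "\<And>\<gamma>. \<gamma> > 0 \<Longrightarrow> F_gamma \<Omega> f \<alpha> \<kappa> \<gamma> v \<le> ereal (m + \<eta> + \<gamma> * C)"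
      using F_gamma_recovery[OF dom \<kappa> \<eta>] by blast
    have "((\<lambda>\<gamma>. \<gamma> * C + \<epsilon> \<gamma>) \<longlongrightarrow> 0 * C + 0) (at_right 0)" by (intro tendsto_intros \<epsilon>)
    then have "\<forall>\<^sub>F \<gamma> in at_right 0. \<gamma> * C + \<epsilon> \<gamma> < \<eta>" using \<eta> by (intro order_tendstoD) auto
    with u_le pos show ?thesis
    proof eventually_elim
      case (elim \<gamma>)
      have "(INF v\<in>L1_space \<Omega>. F_gamma \<Omega> f \<alpha> \<kappa> \<gamma> v) \<le> ereal (m + \<eta> + \<gamma> * C)"
        using INF_lower[OF v(1), of "F_gamma \<Omega> f \<alpha> \<kappa> \<gamma>"] v(2)[OF elim(2)] by (rule order_trans)
      then have "F_gamma \<Omega> f \<alpha> \<kappa> \<gamma> (u \<gamma>) \<le> ereal (m + \<eta> + \<gamma> * C) + ereal (\<epsilon> \<gamma>)"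
        by (intro order_trans[OF elim(1)] add_right_mono)
      also have "\<dots> \<le> ereal (m + 2 * \<eta>)" using elim(3) by simp
      finally have le: "F_gamma \<Omega> f \<alpha> \<kappa> \<gamma> (u \<gamma>) \<le> ereal (m + 2 * \<eta>)" .
      have X: "u \<gamma> \<in> X_space \<Omega> \<alpha> \<kappa> \<gamma>"
      proof (rule ccontr)
        assume "u \<gamma> \<notin> X_space \<Omega> \<alpha> \<kappa> \<gamma>"
        then have "F_gamma \<Omega> f \<alpha> \<kappa> \<gamma> (u \<gamma>) = \<infinity>" by (simp add: F_gamma_def)
        then show False using le by simp
      qed
      note r = rof_le_F_gamma[OF elim(2) X]
      have "J (u \<gamma>) \<le> m + 2 * \<eta>" using order_trans[OF r(2) le] by simp
      then show ?case using r(1) L2_distance_le[OF r(1) u0(1)] u0(2) by simp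
    qed
  qed
  define A where "A = measure (\<mu>) \<Omega>"
  define h where "h \<gamma> = (LINT x|\<mu>. \<bar>u \<gamma> x - u0 x\<bar>)" for \<gamma>
  have A: "A \<ge> 0" by (simp add: A_def)
  have "(h \<longlongrightarrow> 0) (at_right 0)"
  proof (rule tendstoI)
    fix \<rho> :: real assume \<rho>: "\<rho> > 0"
    \<comment> \<open>Half of \<rho> is spent on \<open>s * A\<close>. Taking \<eta> = \<rho> s / 16
      in \<open>close\<close> makes the squared distance divided by s at most \<rho> / 2.\<close>
    define s where "s = \<rho> / (2 * (A + 1))"
    have s: "s > 0" "s * A < \<rho> / 2" using \<rho> A by (auto simp: s_def field_simps)
    have "\<rho> * s / 16 > 0" using \<rho> s by simp
    from close[OF this] show "\<forall>\<^sub>F \<gamma> in at_right 0. dist (h \<gamma>) 0 < \<rho>"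
    proof eventually_elim
      case (elim \<gamma>)
      have ug: "u \<gamma> \<in> L2_space \<Omega>" "u0 \<in> L2_space \<Omega>" using elim u0 by auto
      have meas: "(\<lambda>x. u \<gamma> x - u0 x) \<in> borel_measurable (\<mu>)"
        using L2_spaceD(1)[OF ug(1)] L2_spaceD(1)[OF ug(2)] by simp
      have "h \<gamma> \<le> s * A + (LINT x|\<mu>. (u \<gamma> x - u0 x)\<^sup>2) / s"
        unfolding h_def A_def
        by (rule integrable_if_square_integrable(2)[OF \<Omega> meas L2_diff_integrable[OF ug] s(1)])
      also have "(LINT x|\<mu>. (u \<gamma> x - u0 x)\<^sup>2) / s \<le> (8 * (\<rho> * s / 16)) / s"
        using elim s(1) by (intro divide_right_mono) auto
      also have "(8 * (\<rho> * s / 16)) / s = \<rho> / 2" using s(1) by simp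
      finally have "h \<gamma> < \<rho>" using s(2) by simp
      moreover have "h \<gamma> \<ge> 0" by (simp add: h_def)
      ultimately show ?case by simp
    qed
  qed
  then have "((\<lambda>\<gamma>. ennreal (h \<gamma>)) \<longlongrightarrow> ennreal 0) (at_right 0)" by (rule tendsto_ennrealI)
  then have lim: "((\<lambda>\<gamma>. ennreal (h \<gamma>)) \<longlongrightarrow> 0) (at_right 0)" by simp
  show ?thesis
    unfolding tendsto_L1_def
  \<comment> \<open>Only for positive \<gamma> is \<open>u \<gamma>\<close> known to be integrable;
    there the real integral agrees with the extended one in \<open>tendsto_L1\<close>.\<close>
  proof (rule Lim_transform_eventually[OF lim])
    show "\<forall>\<^sub>F \<gamma> in at_right 0. ennreal (h \<gamma>) = (\<integral>\<^sup>+x. ennreal \<bar>u \<gamma> x - u0 x\<bar> \<partial>\<mu>)"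
      using pos
    proof eventually_elim
      case (elim \<gamma>)
      have "integrable (\<mu>) (\<lambda>x. \<bar>u \<gamma> x - u0 x\<bar>)"
        using uL1[OF elim] u0(1) by (auto simp: L1_space_def BV_space_def)
      then show ?case unfolding h_def by (subst nn_integral_eq_integral) auto
    qed
  qed
qed

end

text \<open>Exact minimizers are the case of error 0, so their convergence is an instance of that of
  asymptotic minimizers.\<close>

lemma minimizers_asymptotic:
  assumes "\<And>\<gamma>. \<gamma> > 0 \<Longrightarrow> is_L1_minimizer \<Omega> (F \<gamma>) (u \<gamma>)"
  shows "asymptotic_minimizers \<Omega> F u"
proof -
  have "F \<gamma> (u \<gamma>) \<le> (INF v\<in>L1_space \<Omega>. F \<gamma> v) + ereal 0" if "\<gamma> > 0" for \<gamma>
    using assms[OF that] by (auto simp: is_L1_minimizer_def intro: INF_greatest simp flip: zero_ereal_def)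
  then have "\<forall>\<^sub>F \<gamma> in at_right 0. F \<gamma> (u \<gamma>) \<le> (INF v\<in>L1_space \<Omega>. F \<gamma> v) + ereal ((\<lambda>_. 0) \<gamma>)"
    by (simp add: eventually_at_filter)
  moreover have "((\<lambda>_. 0 :: real) \<longlongrightarrow> 0) (at_right 0)" by simp
  ultimately show ?thesis
    using assms unfolding asymptotic_minimizers_def is_L1_minimizer_def by blast
qed

theorem mainTheorem9:
  fixes \<Omega> :: "'a::euclidean_space set"
    and f \<kappa> :: "'a \<Rightarrow> real"
    and \<alpha> \<kappa>_lo \<kappa>_hi :: real
  assumes "bounded_lipschitz_domain \<Omega>"
    and "f \<in> L2_space \<Omega>"
    and "\<alpha> > 0"
    and "\<kappa> \<in> borel_measurable (lebesgue_on \<Omega>)"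
    and "0 < \<kappa>_lo"
    and "AE x in lebesgue_on \<Omega>. \<kappa>_lo \<le> \<kappa> x \<and> \<kappa> x \<le> \<kappa>_hi"
  shows "\<exists>u0. is_unique_L1_minimizer \<Omega> (F_ROF \<Omega> f \<alpha>) u0 \<and>
           (\<forall>u. (\<forall>\<gamma>>0. is_unique_L1_minimizer \<Omega> (F_gamma \<Omega> f \<alpha> \<kappa> \<gamma>) (u \<gamma>)) \<longrightarrow>
              tendsto_L1 \<Omega> u u0 (at_right 0)) \<and>
           (\<forall>u. asymptotic_minimizers \<Omega> (F_gamma \<Omega> f \<alpha> \<kappa>) u \<longrightarrow>
              tendsto_L1 \<Omega> u u0 (at_right 0))"
proof -
  interpret rof_problem \<Omega> f \<alpha>
    using assms(1-3) by unfold_locales (auto simp: bounded_lipschitz_domain_def)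
  obtain u0 where u0: "u0 \<in> admissible" "rof \<Omega> f \<alpha> u0 = m" using minimizer_exists by blast
  have \<kappa>: "AE x in lebesgue_on \<Omega>. \<kappa>_lo \<le> \<kappa> x" using assms(6) by eventually_elim simp
  note conv = asymptotic_minimizers_tendsto[OF assms(1,5) \<kappa> u0]
  show ?thesis
  proof (intro exI[of _ u0] conjI allI impI)
    show "is_unique_L1_minimizer \<Omega> (F_ROF \<Omega> f \<alpha>) u0" by (rule is_unique_minimizer[OF u0])
    show "tendsto_L1 \<Omega> u u0 (at_right 0)"
      if "\<forall>\<gamma>>0. is_unique_L1_minimizer \<Omega> (F_gamma \<Omega> f \<alpha> \<kappa> \<gamma>) (u \<gamma>)" for u
      using that by (intro conv minimizers_asymptotic) (simp add: is_unique_L1_minimizer_def)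
  qed (rule conv)
qed

end
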